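(* Let $d = d(n)$ be positive integers with $d = o(n^{1/3})$ as $n \to \infty$, and let $p = \binom{n}{d}$. For each $n$, let $m = m(n)$ be a positive integer and let $X = X^{(p)}$ be a $p \times m$ random matrix whose columns are independent and each follow the random tensor model of degree $d$ (each column generated from its own random vector in $\mathbb{R}^n$). Assume that $p/m \to \lambda \in (0,\infty)$ as $n \to \infty$, and that the entries of the underlying random vectors $x \in \mathbb{R}^n$ have uniformly bounded fourth moments (uniformly in $n$ and in the column). Then, with probability $1$, the empirical spectral distribution of $W = \frac{1}{m}XX^\mathsf{T}$ converges weakly to the Marchenko-Pastur distribution with parameter $\lambda$.
   Context: Random tensor model of degree $d$: let $x = (x_1,\dots,x_n) \in \mathbb{R}^n$ have independent entries with $\mathbb{E}x_i = 0$ and $\mathbb{E}x_i^2 = 1$. The random vector ${\bm{x}} \in \mathbb{R}^{\binom{n}{d}}$ has entries indexed by $d$-element subsets $\mathbf{i} = \{i_1,\dots,i_d\} \subset [n]$, given by ${\bm{x}}_{\mathbf{i}} = \prod_{i \in \mathbf{i}} x_i = x_{i_1}\cdots x_{i_d}$; we say ${\bm{x}}$ follows the random tensor model. (Note the fourth moment assumption concerns only the entries of $x$, not those of ${\bm{x}}$.) Empirical spectral distribution of a symmetric $p\times p$ matrix $W$: $F^W(x) = \frac{1}{p}\#\{i : \lambda_i(W) \le x\}$. Marchenko-Pastur distribution with parameter $\lambda\in(0,\infty)$: with $\lambda_\pm = (1\pm\sqrt{\lambda})^2$ and $f_\lambda(x) = \frac{1}{2\pi \lambda x}\sqrt{[(\lambda_+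 - x)(x-\lambda_-)]_+}$, it is the distribution with density $f_\lambda$ if $\lambda\le 1$, and for $\lambda>1$ the distribution consisting of a point mass $1-1/\lambda$ at $0$ plus the absolutely continuous part with density $f_\lambda$. *)

theory Defs
  imports "HOL-Probability.Probability" "Jordan_Normal_Form.Char_Poly"
begin

definition dsubsets :: "nat \<Rightarrow> nat \<Rightarrow> nat set set" where
  "dsubsets n d = {I. I \<subseteq> {..<n} \<and> card I = d}"

(* a fixed (arbitrary) enumeration of the d-subsets by row indices 0..<(n choose d);
   the spectrum of W does not depend on this choice *)
definition sub_enum :: "nat \<Rightarrow> nat \<Rightarrow> nat \<Rightarrow> nat set" where
  "sub_enum n d = (SOME f. bij_betw f {..<n choose d} (dsubsets n d))"

definition tensor_entry :: "(nat \<Rightarrow> real) \<Rightarrow> nat set \<Rightarrow> real" where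
  "tensor_entry x I = (\<Prod>i\<in>I. x i)"

definition tensor_data_matrix :: "nat \<Rightarrow> nat \<Rightarrow> nat \<Rightarrow> (nat \<Rightarrow> nat \<Rightarrow> real) \<Rightarrow> real mat" where
  "tensor_data_matrix n d m xs =
     mat (n choose d) m (\<lambda>(a, j). tensor_entry (xs j) (sub_enum n d a))"

definition sample_cov :: "nat \<Rightarrow> nat \<Rightarrow> nat \<Rightarrow> (nat \<Rightarrow> nat \<Rightarrow> real) \<Rightarrow> real mat" where
  "sample_cov n d m xs =
     (1 / real m) \<cdot>\<^sub>m (tensor_data_matrix n d m xs * (tensor_data_matrix n d m xs)\<^sup>T)"

definition esd_cdf :: "real mat \<Rightarrow> real \<Rightarrow> real" where
  "esd_cdf W x = real (size (filter_mset (\<lambda>r. r \<le> x) (proots (char_poly W)))) / real (dim_row W)"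

definition mp_density :: "real \<Rightarrow> real \<Rightarrow> real" where
  "mp_density lam x =
     (let lp = (1 + sqrt lam)^2; lm = (1 - sqrt lam)^2
      in sqrt (max 0 ((lp - x) * (x - lm))) / (2 * pi * lam * x))"

definition mp_cdf :: "real \<Rightarrow> real \<Rightarrow> real" where
  "mp_cdf lam x =
     (if lam > 1 \<and> 0 \<le> x then 1 - 1 / lam else 0) + (LINT t:{..x}|lborel. mp_density lam t)"

end

theory Submission
  imports Defs "Jordan_Normal_Form.Schur_Decomposition"
begin

text \<open>
  Everything is done with the Stieltjes transform at negative reals: for \<open>t > 0\<close> let
  \<open>s = tr (W + t)\<^sup>-\<^sup>1 / p\<close>. Removing one column \<open>x\<close> of the data at a time, the Sherman--Morrison formula
  gives \<open>(p/m) (1 - t s) = 1 - (1/m) \<Sum> 1 / (1 + q/m)\<close>, where \<open>q = x\<^sup>T R x\<close> and the leave-one-out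
  resolvent \<open>R\<close> is independent of \<open>x\<close>. If each \<open>q\<close> is close to \<open>tr R\<close>, which differs from \<open>p s\<close> by at most
  \<open>1/t\<close>, then \<open>s\<close> almost solves the Marchenko--Pastur equation; the latter is stable because its defect is
  strictly decreasing in \<open>s\<close>.

  The variance of \<open>q\<close> is bounded by a Schur test on the covariances of the products \<open>x\<^sub>I x\<^sub>J\<close>: a pair
  \<open>(K, L)\<close> can be correlated with \<open>(I, J)\<close> only if no index has multiplicity one in \<open>I, J, K, L\<close>, so \<open>K\<close> and
  \<open>L\<close> agree outside \<open>S = I \<union> J\<close>. Each element of \<open>K \<inter> S\<close> or \<open>L \<inter> S\<close> costs a factor \<open>\<tau> \<approx> (d/n)\<^sup>1\<^sup>/\<^sup>2\<close>,
  which makes every row sum of the covariance matrix \<open>O(p d \<tau>) = o(p)\<close> exactly when \<open>d\<^sup>3 = o(n)\<close>.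

  Almost sure convergence follows from the bounded-difference inequality (a change of one column moves
  \<open>tr (W + t)\<^sup>-\<^sup>1\<close> by at most \<open>1/t\<close>) and the Borel--Cantelli lemma, since \<open>p \<ge> n\<close>.
\<close>

section \<open>The Marchenko--Pastur distribution\<close>

text \<open>Staying at \<open>-t\<close> with \<open>t > 0\<close> keeps everything real: the
  resolvent is positive definite with entries at most \<open>1 / t\<close>, and every denominator
  \<open>1 + q / m\<close> is at least 1. The price is that weak convergence must be recovered from
  the transform at countably many \<open>t\<close>, since null sets can be collected only over a
  countable set. The obstacle is that the entries of one column are dependent and that only single
  coordinates have controlled fourth moments; the fourth moment of a tensor entry may be as large as
  \<open>C ^ d\<close>. Such covariances belong to pairs that share many indices, and these are
  rare. If \<open>K\<close> and \<open>L\<close> agree outside \<open>S\<close>, then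
  \<open>K\<close> and \<open>L\<close> meet \<open>S\<close> in equally many elements, say
  \<open>r\<close>, and prescribing both traces leaves about \<open>p * (d / n) ^ r\<close> pairs.
  Writing this as \<open>p * \<tau> ^ (r + r)\<close> shares the gain between \<open>K\<close> and
  \<open>L\<close> and turns the weight into a product over the elements of \<open>S\<close>. The
  sum over all traces then factors: an element of \<open>I \<inter> J\<close> contributes
  \<open>1 + O(\<tau>)\<close>, an element of only one of the sets \<open>O(\<tau>)\<close>. For
  \<open>I = J\<close> the traceless pairs have covariance 0, which removes the leading 1 and leaves
  \<open>(1 + O(\<tau>)) ^ d - 1\<close>, of order \<open>d * \<tau>\<close>.\<close>

lemma semicircle_quotient_integral_at_0:
  fixes \<alpha> \<beta> :: real
  assumes ab: "0 \<le> \<alpha>" "\<alpha> < \<beta>"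
  shows "((\<lambda>x. sqrt ((\<beta> - x) * (x - \<alpha>)) / x) has_integral pi * ((\<alpha> + \<beta>) / 2 - sqrt (\<alpha> * \<beta>))) {\<alpha>..\<beta>}"
proof -
  define g where "g = sqrt (\<alpha> * \<beta>)"
  define q where "q x = sqrt ((\<beta> - x) * (x - \<alpha>))" for x
  define v where "v x = ((\<alpha> + \<beta>) * x - 2 * \<alpha> * \<beta>) / ((\<beta> - \<alpha>) * x)" for x
  define w where "w x = (2 * x - \<alpha> - \<beta>) / (\<beta> - \<alpha>)" for x
  \<comment> \<open>The integrand equals
    \<open>(\<alpha> + \<beta> - x - \<alpha> * \<beta> / x) / q x\<close>. The arcsine of the
    affine \<open>w\<close> integrates \<open>1 / q x\<close>, the arcsine of \<open>v\<close>,
    affine in \<open>1 / x\<close>, integrates a multiple of \<open>1 / (x * q x)\<close>, and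
    \<open>q\<close> itself accounts for the remaining linear part.\<close>
  define F where "F x = q x + (\<alpha> + \<beta>) / 2 * arcsin (w x) - g * arcsin (v x)" for x
  have q2: "(q x)\<^sup>2 = (\<beta> - x) * (x - \<alpha>)" if "x \<in> {\<alpha>..\<beta>}" for x
    using that by (simp add: q_def)
  have qpos: "q x > 0" if "x \<in> {\<alpha><..<\<beta>}" for x using that by (simp add: q_def)
  have w1: "1 - (w x)\<^sup>2 = (2 * q x / (\<beta> - \<alpha>))\<^sup>2" if "x \<in> {\<alpha>..\<beta>}" for x
  proof -
    have "(\<beta> - \<alpha>)\<^sup>2 - (2 * x - \<alpha> - \<beta>)\<^sup>2 = 4 * ((\<beta> - x) * (x - \<alpha>))"
      by (simp add: power2_eq_square algebra_simps)
    moreover have "1 - (w x)\<^sup>2 = ((\<beta> - \<alpha>)\<^sup>2 - (2 * x - \<alpha> - \<beta>)\<^sup>2) / (\<beta> - \<alpha>)\<^sup>2"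
      unfolding w_def power_divide using ab by (subst diff_divide_distrib) simp
    ultimately show ?thesis by (simp add: power_divide power_mult_distrib q2[OF that])
  qed
  have v1: "1 - (v x)\<^sup>2 = (2 * g * q x / ((\<beta> - \<alpha>) * x))\<^sup>2" if "x \<in> {\<alpha>..\<beta>}" "x > 0" for x
  proof -
    have "((\<beta> - \<alpha>) * x)\<^sup>2 - ((\<alpha> + \<beta>) * x - 2 * \<alpha> * \<beta>)\<^sup>2 = 4 * (\<alpha> * \<beta>) * ((\<beta> - x) * (x - \<alpha>))"
      by (simp add: power2_eq_square algebra_simps)
    moreover have "1 - (v x)\<^sup>2 = (((\<beta> - \<alpha>) * x)\<^sup>2 - ((\<alpha> + \<beta>) * x - 2 * \<alpha> * \<beta>)\<^sup>2) / ((\<beta> - \<alpha>) * x)\<^sup>2"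
      unfolding v_def power_divide using ab that by (subst diff_divide_distrib) simp
    moreover have "g\<^sup>2 = \<alpha> * \<beta>" using ab by (simp add: g_def)
    ultimately show ?thesis by (simp add: power_divide power_mult_distrib q2[OF that(1)])
  qed
  have absle: "-1 \<le> y \<and> y \<le> 1" if "1 - y\<^sup>2 = z\<^sup>2" for y z :: real
  proof -
    have "y\<^sup>2 \<le> 1" using that zero_le_power2[of z] by linarith
    then show ?thesis using abs_square_le_1[of y] by auto
  qed
  have contw: "continuous_on {\<alpha>..\<beta>} (\<lambda>x. arcsin (w x))"
    using absle[OF w1] ab by (intro continuous_on_arcsin) (auto simp: w_def intro!: continuous_intros)
  have contv: "continuous_on {\<alpha>..\<beta>} (\<lambda>x. g * arcsin (v x))"
  \<comment> \<open>For \<open>\<alpha> = 0\<close>, the lower edge when the parameter is 1,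
    division by zero makes \<open>v\<close> jump at 0, but its coefficient \<open>g\<close>
    vanishes.\<close>
  proof (cases "\<alpha> = 0")
    case False
    then have "x > 0" if "x \<in> {\<alpha>..\<beta>}" for x using that ab by auto
    then show ?thesis using absle[OF v1] ab False
      by (intro continuous_on_mult_left continuous_on_arcsin)
         (auto simp: v_def intro!: continuous_intros)
  qed (simp add: g_def)
  have cont: "continuous_on {\<alpha>..\<beta>} F"
    unfolding F_def q_def by (intro continuous_intros contw contv)
  have deriv: "(F has_vector_derivative q x / x) (at x)" if x: "x \<in> {\<alpha><..<\<beta>}" for x
  proof -
    have x0: "x > 0" "x \<in> {\<alpha>..\<beta>}" using x ab by auto
    note qp = qpos[OF x]
    have lt: "-1 < y \<and> y < 1" if "1 - y\<^sup>2 = z\<^sup>2" "z \<noteq> 0" for y z :: real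
    proof -
      have "z\<^sup>2 > 0" using that by simp
      then have "y\<^sup>2 < 1" using that by linarith
      then show ?thesis using abs_square_less_1[of y] by auto
    qed
    have dq: "(q has_real_derivative (\<alpha> + \<beta> - 2 * x) / (2 * q x)) (at x)"
    proof -
      have pos: "(\<beta> - x) * (x - \<alpha>) > 0" using x by simp
      have "((\<lambda>x. (\<beta> - x) * (x - \<alpha>)) has_real_derivative \<alpha> + \<beta> - 2 * x) (at x)"
        by (auto intro!: derivative_eq_intros simp: algebra_simps)
      from DERIV_chain2[OF DERIV_real_sqrt[OF pos] this] show ?thesis
        by (simp add: q_def[abs_def] field_simps)
    qed
    have wl: "-1 < w x \<and> w x < 1" using w1[OF x0(2)] qp ab by (intro lt) auto
    have sw: "sqrt (1 - (w x)\<^sup>2) = 2 * q x / (\<beta> - \<alpha>)"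
      unfolding w1[OF x0(2)] using qp ab by simp
    have "(w has_real_derivative 2 / (\<beta> - \<alpha>)) (at x)"
      unfolding w_def by (rule DERIV_cdivide) (auto intro!: derivative_eq_intros)
    from DERIV_chain2[OF DERIV_arcsin this] wl
    have "((\<lambda>x. arcsin (w x)) has_real_derivative inverse (sqrt (1 - (w x)\<^sup>2)) * (2 / (\<beta> - \<alpha>))) (at x)"
      by auto
    moreover have alg: "inverse (2 * r / k) * (2 / k) = 1 / r" if "k \<noteq> 0" "r \<noteq> 0" for k r :: real
      using that by (simp add: field_simps)
    have "inverse (sqrt (1 - (w x)\<^sup>2)) * (2 / (\<beta> - \<alpha>)) = 1 / q x"
      unfolding sw using ab qp by (intro alg) auto
    ultimately have dw: "((\<lambda>x. arcsin (w x)) has_real_derivative 1 / q x) (at x)"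
      by (simp only:)
    have dv: "((\<lambda>x. g * arcsin (v x)) has_real_derivative \<alpha> * \<beta> / (x * q x)) (at x)"
    proof (cases "\<alpha> = 0")
      case False
      have g: "g > 0" using ab False by (simp add: g_def)
      have vl: "-1 < v x \<and> v x < 1" using v1[OF x0(2,1)] qp ab g x0 by (intro lt) auto
      have sv: "sqrt (1 - (v x)\<^sup>2) = 2 * g * q x / ((\<beta> - \<alpha>) * x)"
        unfolding v1[OF x0(2,1)] using qp ab g x0 by simp
      have "(v has_real_derivative 2 * \<alpha> * \<beta> / ((\<beta> - \<alpha>) * x\<^sup>2)) (at x)"
      proof -
        have dk: "((\<lambda>x. (\<alpha> + \<beta>) / k - 2 * \<alpha> * \<beta> / k * inverse x) has_real_derivative 2 * \<alpha> * \<beta> / (k * x\<^sup>2)) (at x)"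
          if "k \<noteq> 0" for k using x0(1) that by (auto intro!: derivative_eq_intros simp: field_simps power2_eq_square)
        have ev: "\<forall>\<^sub>F y in nhds x. v y = (\<alpha> + \<beta>) / (\<beta> - \<alpha>) - 2 * \<alpha> * \<beta> / (\<beta> - \<alpha>) * inverse y"
        proof -
          have "\<forall>\<^sub>F y in nhds x. y \<in> {0<..}" using x0 by (intro eventually_nhds_in_open) auto
          then show ?thesis by eventually_elim (simp add: v_def diff_divide_distrib inverse_eq_divide)
        qed
        show ?thesis unfolding DERIV_cong_ev[OF refl ev refl] using ab by (intro dk) auto
      qed
      from DERIV_cmult[OF DERIV_chain2[OF DERIV_arcsin this], of g] vl
      have "((\<lambda>x. g * arcsin (v x)) has_real_derivative g * (inverse (sqrt (1 - (v x)\<^sup>2)) * (2 * \<alpha> * \<beta> / ((\<beta> - \<alpha>) * x\<^sup>2)))) (at x)"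
        by auto
      moreover have alg: "g * (inverse (2 * g * r / (k * x)) * (2 * \<alpha> * \<beta> / (k * x\<^sup>2))) = \<alpha> * \<beta> / (x * r)"
        if "k \<noteq> 0" "r \<noteq> 0" for k r :: real
        using that g x0(1) by (simp add: field_simps power2_eq_square)
      have "g * (inverse (sqrt (1 - (v x)\<^sup>2)) * (2 * \<alpha> * \<beta> / ((\<beta> - \<alpha>) * x\<^sup>2))) = \<alpha> * \<beta> / (x * q x)"
        unfolding sv using ab qp by (intro alg) auto
      ultimately show ?thesis by (simp only:)
    qed (simp add: g_def)
    have "(F has_real_derivative (\<alpha> + \<beta> - 2 * x) / (2 * q x) + (\<alpha> + \<beta>) / 2 * (1 / q x) - \<alpha> * \<beta> / (x * q x)) (at x)"
      unfolding F_def by (intro DERIV_diff DERIV_add DERIV_cmult dq dw dv)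
    also have "(\<alpha> + \<beta> - 2 * x) / (2 * q x) + (\<alpha> + \<beta>) / 2 * (1 / q x) - \<alpha> * \<beta> / (x * q x)
        = ((\<beta> - x) * (x - \<alpha>)) / (x * q x)"
      using qp x0 by (simp add: field_simps)
    also have "\<dots> = q x / x" unfolding q2[OF x0(2), symmetric] using qp by (simp add: power2_eq_square)
    finally show ?thesis by (simp add: has_real_derivative_iff_has_vector_derivative)
  qed
  have "((\<lambda>x. q x / x) has_integral (F \<beta> - F \<alpha>)) {\<alpha>..\<beta>}"
    using ab cont deriv by (intro fundamental_theorem_of_calculus_interior) auto
  also have "F \<beta> - F \<alpha> = pi * ((\<alpha> + \<beta>) / 2 - g)"
  proof -
    have "w \<beta> = 1" "w \<alpha> = -1" using ab by (auto simp: w_def field_simps)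
    moreover have "v \<beta> = 1" using ab by (simp add: v_def field_simps)
    moreover have "g * arcsin (v \<alpha>) = - g * pi / 2"
    proof (cases "\<alpha> = 0")
      case False
      then have "v \<alpha> = -1" using ab by (simp add: v_def field_simps)
      then show ?thesis by simp
    qed (simp add: g_def)
    ultimately show ?thesis by (simp add: F_def q_def algebra_simps)
  qed
  finally show ?thesis by (simp add: q_def g_def)
qed

lemma semicircle_quotient_integral:
  fixes a b s :: real
  assumes "0 \<le> a + s" "a < b"
  shows "((\<lambda>x. sqrt ((b - x) * (x - a)) / (x + s)) has_integral
      pi * ((a + b) / 2 + s - sqrt ((a + s) * (b + s)))) {a..b}"
proof -
  have "((\<lambda>x. sqrt ((b + s - x) * (x - (a + s))) / x) has_integral
      pi * ((a + s + (b + s)) / 2 - sqrt ((a + s) * (b + s)))) {a + s..b + s}"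
    using assms by (intro semicircle_quotient_integral_at_0) auto
  from has_integral_affinity'[OF this[unfolded box_real(2)[symmetric]], of 1 s]
  show ?thesis by (simp add: add_divide_distrib add_ac)
qed

text \<open>The cut-off \<open>max 0\<close> makes the integrand vanish off \<open>{a..b}\<close>
  and nonnegative everywhere, which is what carries the gauge integral over to the Lebesgue
  integral.\<close>

lemma semicircle_quotient_bochner:
  fixes a b s :: real
  assumes "0 \<le> a + s" "a < b"
  shows "has_bochner_integral lborel (\<lambda>x. sqrt (max 0 ((b - x) * (x - a))) / (x + s))
      (pi * ((a + b) / 2 + s - sqrt ((a + s) * (b + s))))"
proof -
  let ?f = "\<lambda>x. sqrt ((b - x) * (x - a)) / (x + s)"
  let ?g = "\<lambda>x. sqrt (max 0 ((b - x) * (x - a))) / (x + s)"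
  let ?I = "pi * ((a + b) / 2 + s - sqrt ((a + s) * (b + s)))"
  have eq: "?g x = (if x \<in> {a..b} then ?f x else 0)" for x
  proof (cases "x \<in> {a..b}")
    case False
    then have "(b - x) * (x - a) \<le> 0" using assms by (auto simp: mult_le_0_iff)
    then have "max 0 ((b - x) * (x - a)) = 0" by simp
    then show ?thesis using False by (simp only: real_sqrt_zero div_0 if_False)
  qed (simp add: max_absorb2)
  have nn: "?g x \<ge> 0" for x
  proof (cases "x \<in> {a..b}")
    case True
    then have "x + s \<ge> 0" using assms by auto
    then show ?thesis by simp
  qed (simp only: eq, simp)
  have "(?f has_integral ?I) {a..b}" by (rule semicircle_quotient_integral[OF assms])
  then have hi: "(?g has_integral ?I) UNIV"
    unfolding eq by (subst has_integral_restrict_UNIV)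
  have "(\<integral>\<^sup>+ x. ennreal (?g x) \<partial>lborel) = ennreal ?I"
    using nn_integral_has_integral_lborel[OF _ nn hi] by simp
  moreover have "?I \<ge> 0" using has_integral_nonneg[OF hi] nn by auto
  ultimately show ?thesis using nn by (intro has_bochner_integral_nn_integral) auto
qed

section \<open>Mass and Stieltjes transform of the Marchenko-Pastur law\<close>

definition mp_atom :: "real \<Rightarrow> real" where
  "mp_atom lam = (if lam > 1 then 1 - 1 / lam else 0)"

text \<open>The nonnegative root \<open>s\<close> of
  \<open>lam * t * s^2 + (1 - lam + t) * s - 1 = 0\<close>, which is the integral of
  \<open>1 / (x + t)\<close> against the Marchenko-Pastur law.\<close>

definition mp_stieltjes :: "real \<Rightarrow> real \<Rightarrow> real" where
  "mp_stieltjes lam t = (lam - 1 - t + sqrt ((1 - lam + t)\<^sup>2 + 4 * lam * t)) / (2 * lam * t)"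

lemma mp_edges:
  assumes "lam > 0"
  shows "(1 - sqrt lam)\<^sup>2 + (1 + sqrt lam)\<^sup>2 = 2 * (1 + lam)"
    "(1 - sqrt lam)\<^sup>2 * (1 + sqrt lam)\<^sup>2 = (1 - lam)\<^sup>2" "(1 - sqrt lam)\<^sup>2 < (1 + sqrt lam)\<^sup>2"
proof -
  have s: "sqrt lam * sqrt lam = lam" "sqrt lam > 0" using assms by auto
  show "(1 - sqrt lam)\<^sup>2 + (1 + sqrt lam)\<^sup>2 = 2 * (1 + lam)"
    using s by (simp add: power2_eq_square algebra_simps)
  have "(1 - sqrt lam) * (1 + sqrt lam) = 1 - lam" using s by (simp add: algebra_simps)
  then show "(1 - sqrt lam)\<^sup>2 * (1 + sqrt lam)\<^sup>2 = (1 - lam)\<^sup>2"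
    by (metis power_mult_distrib)
  show "(1 - sqrt lam)\<^sup>2 < (1 + sqrt lam)\<^sup>2"
    using s by (simp add: power2_eq_square algebra_simps)
qed

text \<open>The product of the edges is \<open>(1 - lam)^2\<close>, so the mass is
  \<open>(1 + lam - \<bar>1 - lam\<bar>) / (2 * lam)\<close>, the minimum of 1 and
  \<open>1 / lam\<close>. The absolute value is the source of the case distinction in
  \<open>mp_atom\<close>.\<close>

lemma mp_density_bochner:
  assumes lam: "lam > 0"
  shows "has_bochner_integral lborel (mp_density lam) (1 - mp_atom lam)"
proof -
  let ?a = "(1 - sqrt lam)\<^sup>2" and ?b = "(1 + sqrt lam)\<^sup>2"
  note e = mp_edges[OF lam]
  have "has_bochner_integral lborel (\<lambda>x. (1 / (2 * pi * lam)) * (sqrt (max 0 ((?b - x) * (x - ?a))) / (x + 0)))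
      ((1 / (2 * pi * lam)) * (pi * ((?a + ?b) / 2 + 0 - sqrt ((?a + 0) * (?b + 0)))))"
    using e(3) by (intro has_bochner_integral_mult_right semicircle_quotient_bochner) auto
  also have "(\<lambda>x. (1 / (2 * pi * lam)) * (sqrt (max 0 ((?b - x) * (x - ?a))) / (x + 0))) = mp_density lam"
    by (simp add: mp_density_def Let_def fun_eq_iff)
  also have "(1 / (2 * pi * lam)) * (pi * ((?a + ?b) / 2 + 0 - sqrt ((?a + 0) * (?b + 0)))) = 1 - mp_atom lam"
    unfolding add_0_right e using lam by (auto simp: mp_atom_def field_simps)
  finally show ?thesis .
qed

lemma mp_radicand_nonpos:
  fixes x :: real
  assumes "x < 0"
  shows "((1 + sqrt lam)\<^sup>2 - x) * (x - (1 - sqrt lam)\<^sup>2) \<le> 0"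
proof (rule mult_nonneg_nonpos)
  show "0 \<le> (1 + sqrt lam)\<^sup>2 - x" using assms zero_le_power2[of "1 + sqrt lam"] by linarith
  show "x - (1 - sqrt lam)\<^sup>2 \<le> 0" using assms zero_le_power2[of "1 - sqrt lam"] by linarith
qed

lemma mp_density_neg: "x < 0 \<Longrightarrow> mp_density lam x = 0"
  using mp_radicand_nonpos[of x lam] by (simp add: mp_density_def Let_def max_absorb1)

lemma mp_density_nonneg: "lam > 0 \<Longrightarrow> 0 \<le> mp_density lam x"
  by (cases "x < 0") (simp_all add: mp_density_neg, simp add: mp_density_def Let_def)

text \<open>Partial fractions, \<open>1 / (x * (x + t)) = (1 / x - 1 / (x + t)) / t\<close>, reduce
  the integral to the semicircle quotients with shifts 0 and \<open>t\<close>. The atom turns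
  \<open>- \<bar>1 - lam\<bar>\<close> into \<open>lam - 1\<close> when \<open>lam > 1\<close>, so a
  single formula covers both regimes.\<close>

lemma mp_density_stieltjes:
  assumes lam: "lam > 0" and t: "t > 0"
  shows "mp_atom lam * (1 / (0 + t)) + (LINT x|lborel. mp_density lam x * (1 / (x + t))) = mp_stieltjes lam t"
proof -
  let ?a = "(1 - sqrt lam)\<^sup>2" and ?b = "(1 + sqrt lam)\<^sup>2"
  let ?q = "\<lambda>x. sqrt (max 0 ((?b - x) * (x - ?a)))"
  note e = mp_edges[OF lam]
  have "has_bochner_integral lborel (\<lambda>x. (1 / (2 * pi * lam * t)) * (?q x / (x + 0) - ?q x / (x + t)))
      ((1 / (2 * pi * lam * t)) * (pi * ((?a + ?b) / 2 + 0 - sqrt ((?a + 0) * (?b + 0)))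
        - pi * ((?a + ?b) / 2 + t - sqrt ((?a + t) * (?b + t)))))"
    using e(3) t
    by (intro has_bochner_integral_mult_right has_bochner_integral_diff semicircle_quotient_bochner) auto
  also have "(\<lambda>x. (1 / (2 * pi * lam * t)) * (?q x / (x + 0) - ?q x / (x + t)))
      = (\<lambda>x. mp_density lam x * (1 / (x + t)))"
  proof
    fix x
    show "(1 / (2 * pi * lam * t)) * (?q x / (x + 0) - ?q x / (x + t)) = mp_density lam x * (1 / (x + t))"
    proof (cases "?q x = 0")
      case False
      have "x \<ge> 0"
      proof (rule ccontr)
        assume "\<not> x \<ge> 0"
        then have "(?b - x) * (x - ?a) \<le> 0" by (intro mp_radicand_nonpos) simp
        then show False using False by (simp add: max_absorb1)
      qed
      show ?thesis
      proof (cases "x = 0")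
        \<comment> \<open>At 0 the radicand is minus the product of the edges, so \<open>?q\<close>
          vanishes there, against the case assumption.\<close>
        case True
        then have "?q x = 0" by (simp add: mult_nonneg_nonpos)
        then show ?thesis using False by simp
      next
        case x: False
        then have "x > 0" using \<open>x \<ge> 0\<close> by simp
        then show ?thesis using t lam by (simp add: mp_density_def Let_def field_simps)
      qed
    qed (simp add: mp_density_def Let_def)
  qed
  finally have "(LINT x|lborel. mp_density lam x * (1 / (x + t)))
      = (1 / (2 * pi * lam * t)) * (pi * ((?a + ?b) / 2 + 0 - sqrt ((?a + 0) * (?b + 0)))
        - pi * ((?a + ?b) / 2 + t - sqrt ((?a + t) * (?b + t))))"
    by (rule has_bochner_integral_integral_eq)
  also have "\<dots> = ((?a + ?b) / 2 - sqrt (?a * ?b) - ((?a + ?b) / 2 + t - sqrt ((?a + t) * (?b + t)))) / (2 * lam * t)"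
    by (simp flip: right_diff_distrib)
  also have "(?a + t) * (?b + t) = (1 - lam + t)\<^sup>2 + 4 * lam * t"
  proof -
    have "(?a + t) * (?b + t) = ?a * ?b + (?a + ?b) * t + t\<^sup>2" by (simp add: power2_eq_square algebra_simps)
    also have "\<dots> = (1 - lam + t)\<^sup>2 + 4 * lam * t" unfolding e by (simp add: power2_eq_square algebra_simps)
    finally show ?thesis .
  qed
  finally have I: "(LINT x|lborel. mp_density lam x * (1 / (x + t)))
      = (1 + lam - \<bar>1 - lam\<bar> - (1 + lam + t - sqrt ((1 - lam + t)\<^sup>2 + 4 * lam * t))) / (2 * lam * t)"
    unfolding e by simp
  show ?thesis
    unfolding I mp_stieltjes_def using lam t
    by (auto simp: mp_atom_def field_simps)
qed

text \<open>Squaring away the radical gives the quadratic equation; multiplied by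
  \<open>- lam / (1 + lam * s)\<close> it becomes the fixed-point form that the resolvent trace
  satisfies approximately.\<close>

lemma mp_stieltjes_root:
  assumes lam: "lam > 0" and t: "t > 0"
  shows "mp_stieltjes lam t \<ge> 0"
    "lam * (1 - t * mp_stieltjes lam t) - 1 + 1 / (1 + lam * mp_stieltjes lam t) = 0"
proof -
  let ?R = "sqrt ((1 - lam + t)\<^sup>2 + 4 * lam * t)" and ?s = "mp_stieltjes lam t"
  have R2: "?R\<^sup>2 = (1 - lam + t)\<^sup>2 + 4 * lam * t" using lam t by simp
  have "\<bar>1 - lam + t\<bar> \<le> ?R" using lam t by (intro real_le_rsqrt) auto
  then have "lam - 1 - t + ?R \<ge> 0" by linarith
  then show s0: "?s \<ge> 0" using lam t by (simp add: mp_stieltjes_def)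
  have R: "?R = 2 * lam * t * ?s - (lam - 1 - t)" using lam t by (simp add: mp_stieltjes_def)
  have "(2 * lam * t * ?s - (lam - 1 - t))\<^sup>2 = (1 - lam + t)\<^sup>2 + 4 * lam * t"
    using R2 unfolding R .
  then have "4 * lam * t * (lam * t * ?s\<^sup>2 + (1 - lam + t) * ?s - 1) = 0"
    by (simp add: power2_eq_square algebra_simps)
  then have "lam * t * ?s\<^sup>2 + (1 - lam + t) * ?s - 1 = 0" using lam t by simp
  moreover have "1 + lam * ?s > 0" using lam s0 by (simp add: add_pos_nonneg)
  moreover from this have "lam * (1 - t * ?s) - 1 + 1 / (1 + lam * ?s)
      = - lam * (lam * t * ?s\<^sup>2 + (1 - lam + t) * ?s - 1) / (1 + lam * ?s)"
    by (simp add: field_simps power2_eq_square)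
  ultimately show "lam * (1 - t * ?s) - 1 + 1 / (1 + lam * ?s) = 0" by simp
qed

text \<open>The linear term alone decreases at rate \<open>lam * t\<close>, and the antitone term
  \<open>1 / (1 + lam * s)\<close> can only increase the gap.\<close>

lemma self_consistent_stability:
  fixes lam t s s' :: real
  assumes lam: "lam > 0" and t: "t > 0" and s: "0 \<le> s" "0 \<le> s'"
    and root: "lam * (1 - t * s') - 1 + 1 / (1 + lam * s') = 0"
  shows "lam * t * \<bar>s - s'\<bar> \<le> \<bar>lam * (1 - t * s) - 1 + 1 / (1 + lam * s)\<bar>"
proof -
  define \<phi> where "\<phi> s = lam * (1 - t * s) - 1 + 1 / (1 + lam * s)" for s
  have *: "lam * t * (y - x) \<le> \<phi> x - \<phi> y" if "0 \<le> x" "x \<le> y" for x y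
  proof -
    have "1 / (1 + lam * y) \<le> 1 / (1 + lam * x)"
      using that lam by (intro divide_left_mono mult_pos_pos add_pos_nonneg) auto
    then show ?thesis by (simp add: \<phi>_def algebra_simps)
  qed
  show ?thesis
  proof (cases "s \<le> s'")
    case True
    then show ?thesis using *[OF s(1) True] root by (simp add: \<phi>_def)
  next
    case False
    then show ?thesis using *[OF s(2), of s] root by (simp add: \<phi>_def)
  qed
qed

section \<open>Weak convergence from Stieltjes transforms at positive rationals\<close>

definition list_avg :: "(real \<Rightarrow> real) \<Rightarrow> real list \<Rightarrow> real" where
  "list_avg f es = (\<Sum>e\<leftarrow>es. f e) / real (length es)"

lemma list_avg_mono:
  assumes "\<And>e. e \<in> set es \<Longrightarrow> f e \<le> g e"
  shows "list_avg f es \<le> list_avg g es"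
  unfolding list_avg_def using assms by (intro divide_right_mono sum_list_mono) auto

lemma list_avg_const: "es \<noteq> [] \<Longrightarrow> list_avg (\<lambda>_. c) es = c"
  by (simp add: list_avg_def sum_list_triv)

lemma list_avg_add: "list_avg (\<lambda>x. f x + g x) es = list_avg f es + list_avg g es"
  by (simp add: list_avg_def sum_list_addf add_divide_distrib)

lemma list_avg_cmult: "list_avg (\<lambda>x. c * f x) es = c * list_avg f es"
  by (simp add: list_avg_def sum_list_const_mult)

lemma list_avg_dist:
  assumes "\<And>e. e \<in> set es \<Longrightarrow> \<bar>f e - g e\<bar> \<le> \<epsilon>" "es \<noteq> []"
  shows "\<bar>list_avg f es - list_avg g es\<bar> \<le> \<epsilon>"
proof -
  have "list_avg f es \<le> list_avg (\<lambda>x. g x + \<epsilon>) es" "list_avg g es \<le> list_avg (\<lambda>x. f x + \<epsilon>) es"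
    using assms(1) by (intro list_avg_mono; force simp: abs_le_iff)+
  then show ?thesis using assms(2) by (simp add: list_avg_add list_avg_const abs_le_iff)
qed

lemma inverse_power_diff:
  fixes u v :: real
  assumes "0 < u" "u < v"
  shows "\<exists>\<xi>. u < \<xi> \<and> \<xi> < v \<and> 1 / u ^ k - 1 / v ^ k = k * (v - u) / \<xi> ^ Suc k"
proof -
  have "\<exists>\<xi>. u < \<xi> \<and> \<xi> < v \<and> inverse (v ^ k) - inverse (u ^ k) = (v - u) * (- (real k / \<xi> ^ Suc k))"
  proof (rule MVT2[OF assms(2)])
    fix x assume "u \<le> x" "x \<le> v"
    then have "x > 0" using assms by simp
    then show "((\<lambda>x. inverse (x ^ k)) has_real_derivative - (real k / x ^ Suc k)) (at x)"
      by (auto intro!: derivative_eq_intros simp: field_simps power2_eq_square)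
         (cases k; simp add: field_simps)
  qed
  then show ?thesis by (auto simp: field_simps)
qed

text \<open>By the mean value theorem the quotient is exactly \<open>1 / \<xi> ^ Suc k\<close> with
  \<open>\<xi>\<close> within \<open>h\<close> of \<open>x + t\<close>; a second application
  compares it with the value at \<open>x + t\<close>. The bound is uniform in \<open>x\<close>, as
  uniform approximation requires.\<close>

lemma difference_quotient_approx:
  fixes x t h :: real
  assumes "0 \<le> x" "0 < t" "0 < h" "0 < k"
  shows "\<bar>1 / (x + t) ^ Suc k - (1 / (k * h)) * (1 / (x + t) ^ k + (-1) * (1 / (x + (t + h)) ^ k))\<bar>
    \<le> h * (Suc k / t ^ Suc (Suc k))"
proof -
  obtain \<xi> where \<xi>: "x + t < \<xi>" "\<xi> < x + (t + h)"
      "1 / (x + t) ^ k - 1 / (x + (t + h)) ^ k = k * (x + (t + h) - (x + t)) / \<xi> ^ Suc k"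
    using inverse_power_diff[of "x + t" "x + (t + h)" k] assms by auto
  obtain \<eta> where \<eta>: "x + t < \<eta>" "\<eta> < \<xi>"
      "1 / (x + t) ^ Suc k - 1 / \<xi> ^ Suc k = Suc k * (\<xi> - (x + t)) / \<eta> ^ Suc (Suc k)"
    using inverse_power_diff[of "x + t" \<xi> "Suc k"] assms \<xi> by auto
  have "(1 / (k * h)) * (1 / (x + t) ^ k + (-1) * (1 / (x + (t + h)) ^ k)) = 1 / \<xi> ^ Suc k"
    using \<xi>(3) assms by (simp del: power_Suc)
  then have "\<bar>1 / (x + t) ^ Suc k - (1 / (k * h)) * (1 / (x + t) ^ k + (-1) * (1 / (x + (t + h)) ^ k))\<bar>
      = \<bar>Suc k * (\<xi> - (x + t)) / \<eta> ^ Suc (Suc k)\<bar>"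
    using \<eta>(3) by presburger
  also have "\<dots> = Suc k * (\<xi> - (x + t)) / \<eta> ^ Suc (Suc k)"
    using \<eta> \<xi> assms by (intro abs_of_nonneg divide_nonneg_nonneg mult_nonneg_nonneg zero_le_power) auto
  also have "\<dots> \<le> Suc k * h / t ^ Suc (Suc k)"
    using \<eta> \<xi> assms by (intro frac_le mult_mono power_mono mult_nonneg_nonneg zero_less_power) auto
  finally show ?thesis by (simp add: mult_ac)
qed

text \<open>The integral of \<open>f\<close> against a point mass \<open>c0\<close> at 0 plus the
  density \<open>\<rho>\<close>.\<close>

definition lim_avg :: "real \<Rightarrow> (real \<Rightarrow> real) \<Rightarrow> (real \<Rightarrow> real) \<Rightarrow> real" where
  "lim_avg c0 \<rho> f = c0 * f 0 + (LINT x|lborel. \<rho> x * f x)"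

lemma lim_avg_indicator:
  "lim_avg c0 \<rho> (indicator {..x}) = (if 0 \<le> x then c0 else 0) + (LINT y:{..x}|lborel. \<rho> y)"
  by (simp add: lim_avg_def set_lebesgue_integral_def indicator_def mult_ac)

context
  fixes c0 :: real and \<rho> :: "real \<Rightarrow> real" and es :: "nat \<Rightarrow> real list"
  assumes c0: "c0 \<ge> 0" and rho_int: "integrable lborel \<rho>" and rho_nn: "\<And>x. 0 \<le> \<rho> x"
    and rho_neg: "\<And>x. x < 0 \<Longrightarrow> \<rho> x = 0"
    and mass: "c0 + (LINT x|lborel. \<rho> x) = 1"
    and es_ne: "\<forall>\<^sub>F n in sequentially. es n \<noteq> []" and es_nn: "\<And>n e. e \<in> set (es n) \<Longrightarrow> 0 \<le> e"
begin

text \<open>The test functions along which the averages converge. They form a vector space closed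
  under uniform limits on the nonnegative half-line, which carries all the mass; boundedness is
  therefore asked only there.\<close>

definition avg_conv :: "(real \<Rightarrow> real) \<Rightarrow> bool" where
  "avg_conv f \<longleftrightarrow> f \<in> borel_measurable borel \<and> (\<exists>K. \<forall>x\<ge>0. \<bar>f x\<bar> \<le> K)
     \<and> (\<lambda>n. list_avg f (es n)) \<longlonglongrightarrow> lim_avg c0 \<rho> f"

lemma rho_mult_integrable:
  assumes f: "f \<in> borel_measurable borel" "\<And>x. x \<ge> 0 \<Longrightarrow> \<bar>f x\<bar> \<le> K"
  shows "integrable lborel (\<lambda>x. \<rho> x * f x)"
proof (rule Bochner_Integration.integrable_bound)
  show "integrable lborel (\<lambda>x. \<rho> x * K)" using rho_int by simp
  have "\<bar>\<rho> x * f x\<bar> \<le> \<rho> x * \<bar>K\<bar>" for x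
  proof (cases "x < 0")
    case False
    then have "\<bar>f x\<bar> \<le> \<bar>K\<bar>" using f(2)[of x] by linarith
    then show ?thesis using rho_nn[of x] by (simp add: abs_mult mult_left_mono)
  qed (simp add: rho_neg)
  then show "AE x in lborel. norm (\<rho> x * f x) \<le> norm (\<rho> x * K)"
    using rho_nn by (simp add: abs_mult)
qed (use f rho_int in auto)

lemma lim_avg_mono:
  assumes "f \<in> borel_measurable borel" "\<And>x. x \<ge> 0 \<Longrightarrow> \<bar>f x\<bar> \<le> K"
    and "g \<in> borel_measurable borel" "\<And>x. x \<ge> 0 \<Longrightarrow> \<bar>g x\<bar> \<le> K'"
    and le: "\<And>x. x \<ge> 0 \<Longrightarrow> f x \<le> g x"
  shows "lim_avg c0 \<rho> f \<le> lim_avg c0 \<rho> g"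
proof -
  have "(LINT x|lborel. \<rho> x * f x) \<le> (LINT x|lborel. \<rho> x * g x)"
  proof (rule integral_mono)
    show "\<rho> x * f x \<le> \<rho> x * g x" for x
      using le[of x] rho_nn[of x] by (cases "x < 0") (auto simp: rho_neg mult_left_mono)
  qed (rule rho_mult_integrable[OF assms(1,2)] rho_mult_integrable[OF assms(3,4)]; assumption)+
  then show ?thesis unfolding lim_avg_def using le[of 0] c0 by (intro add_mono mult_left_mono) auto
qed

lemma lim_avg_add:
  assumes "f \<in> borel_measurable borel" "\<And>x. x \<ge> 0 \<Longrightarrow> \<bar>f x\<bar> \<le> K"
    and "g \<in> borel_measurable borel" "\<And>x. x \<ge> 0 \<Longrightarrow> \<bar>g x\<bar> \<le> K'"
  shows "lim_avg c0 \<rho> (\<lambda>x. f x + g x) = lim_avg c0 \<rho> f + lim_avg c0 \<rho> g"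
  unfolding lim_avg_def using rho_mult_integrable[OF assms(1,2)] rho_mult_integrable[OF assms(3,4)]
  by (simp add: distrib_left)

lemma lim_avg_cmult: "lim_avg c0 \<rho> (\<lambda>x. c * f x) = c * lim_avg c0 \<rho> f"
proof -
  have "(LINT x|lborel. \<rho> x * (c * f x)) = (LINT x|lborel. c * (\<rho> x * f x))"
    by (simp add: mult_ac)
  then show ?thesis by (simp add: lim_avg_def algebra_simps)
qed

lemma lim_avg_const: "lim_avg c0 \<rho> (\<lambda>_. c) = c"
  using mass by (simp add: lim_avg_def) (metis distrib_right mult_1)

lemma lim_avg_dist:
  assumes f: "f \<in> borel_measurable borel" "\<And>x. x \<ge> 0 \<Longrightarrow> \<bar>f x\<bar> \<le> K"
    and g: "g \<in> borel_measurable borel" "\<And>x. x \<ge> 0 \<Longrightarrow> \<bar>g x\<bar> \<le> K'"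
    and d: "\<And>x. x \<ge> 0 \<Longrightarrow> \<bar>f x - g x\<bar> \<le> \<epsilon>"
  shows "\<bar>lim_avg c0 \<rho> f - lim_avg c0 \<rho> g\<bar> \<le> \<epsilon>"
proof -
  have *: "lim_avg c0 \<rho> f \<le> lim_avg c0 \<rho> g + \<epsilon>"
    if f: "f \<in> borel_measurable borel" "\<And>x. x \<ge> 0 \<Longrightarrow> \<bar>f x\<bar> \<le> K"
    and g: "g \<in> borel_measurable borel" "\<And>x. x \<ge> 0 \<Longrightarrow> \<bar>g x\<bar> \<le> K'"
    and d: "\<And>x. x \<ge> 0 \<Longrightarrow> \<bar>f x - g x\<bar> \<le> \<epsilon>" for f g K K'
  proof -
    have "lim_avg c0 \<rho> f \<le> lim_avg c0 \<rho> (\<lambda>x. g x + \<epsilon>)"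
    proof (rule lim_avg_mono[OF f, where K' = "K' + \<bar>\<epsilon>\<bar>"])
      show "\<bar>g x + \<epsilon>\<bar> \<le> K' + \<bar>\<epsilon>\<bar>" if "0 \<le> x" for x using g(2)[OF that] by linarith
      show "f x \<le> g x + \<epsilon>" if "0 \<le> x" for x using d[OF that] by linarith
    qed (use g in auto)
    also have "\<dots> = lim_avg c0 \<rho> g + \<epsilon>"
      using lim_avg_add[OF g, of "\<lambda>_. \<epsilon>" "\<bar>\<epsilon>\<bar>"] by (simp add: lim_avg_const)
    finally show ?thesis .
  qed
  show ?thesis using *[OF f g d] *[OF g f] d by (simp add: abs_le_iff abs_minus_commute)
qed

lemma avg_conv_const: "avg_conv (\<lambda>_. c)"
  unfolding avg_conv_def lim_avg_const
proof (intro conjI exI[of _ "\<bar>c\<bar>"])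
  show "(\<lambda>n. list_avg (\<lambda>_. c) (es n)) \<longlonglongrightarrow> c"
    by (rule tendsto_eventually) (use es_ne in eventually_elim, simp add: list_avg_const)
qed auto

lemma avg_conv_add: "avg_conv f \<Longrightarrow> avg_conv g \<Longrightarrow> avg_conv (\<lambda>x. f x + g x)"
  unfolding avg_conv_def
proof (elim conjE exE, intro conjI)
  fix K K' assume f: "f \<in> borel_measurable borel" "\<forall>x\<ge>0. \<bar>f x\<bar> \<le> K"
    and g: "g \<in> borel_measurable borel" "\<forall>x\<ge>0. \<bar>g x\<bar> \<le> K'"
    and l: "(\<lambda>n. list_avg f (es n)) \<longlonglongrightarrow> lim_avg c0 \<rho> f" "(\<lambda>n. list_avg g (es n)) \<longlonglongrightarrow> lim_avg c0 \<rho> g"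
  show "(\<lambda>x. f x + g x) \<in> borel_measurable borel" using f g by simp
  show "\<exists>K. \<forall>x\<ge>0. \<bar>f x + g x\<bar> \<le> K"
    using f(2) g(2) by (intro exI[of _ "K + K'"]) (meson abs_triangle_ineq add_mono order_trans)
  show "(\<lambda>n. list_avg (\<lambda>x. f x + g x) (es n)) \<longlonglongrightarrow> lim_avg c0 \<rho> (\<lambda>x. f x + g x)"
    unfolding list_avg_add using lim_avg_add[of f K g K'] f g tendsto_add[OF l] by simp
qed

lemma avg_conv_cmult: "avg_conv f \<Longrightarrow> avg_conv (\<lambda>x. c * f x)"
  unfolding avg_conv_def
proof (elim conjE exE, intro conjI)
  fix K assume f: "f \<in> borel_measurable borel" "\<forall>x\<ge>0. \<bar>f x\<bar> \<le> K"
    and l: "(\<lambda>n. list_avg f (es n)) \<longlonglongrightarrow> lim_avg c0 \<rho> f"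
  show "(\<lambda>x. c * f x) \<in> borel_measurable borel" using f by simp
  show "\<exists>K. \<forall>x\<ge>0. \<bar>c * f x\<bar> \<le> K"
    using f(2) by (intro exI[of _ "\<bar>c\<bar> * K"]) (auto simp: abs_mult intro: mult_left_mono)
  show "(\<lambda>n. list_avg (\<lambda>x. c * f x) (es n)) \<longlonglongrightarrow> lim_avg c0 \<rho> (\<lambda>x. c * f x)"
    unfolding list_avg_cmult lim_avg_cmult by (intro tendsto_mult_left l)
qed

text \<open>A uniform error of at most \<open>\<epsilon>\<close> moves the averages and the limit
  functional by at most \<open>\<epsilon>\<close>, so the convergence of \<open>g\<close> passes to
  \<open>f\<close>.\<close>

lemma avg_conv_approx:
  assumes f: "f \<in> borel_measurable borel"
    and approx: "\<And>\<epsilon>. \<epsilon> > 0 \<Longrightarrow> \<exists>g. avg_conv g \<and> (\<forall>x\<ge>0. \<bar>f x - g x\<bar> \<le> \<epsilon>)"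
  shows "avg_conv f"
proof -
  obtain g0 where g0: "avg_conv g0" "\<forall>x\<ge>0. \<bar>f x - g0 x\<bar> \<le> 1" using approx[of 1] by auto
  then obtain K0 where "\<forall>x\<ge>0. \<bar>g0 x\<bar> \<le> K0" by (auto simp: avg_conv_def)
  then have fb: "\<bar>f x\<bar> \<le> K0 + 1" if "x \<ge> 0" for x
    using g0(2) that by (smt (verit, best))
  have "(\<lambda>n. list_avg f (es n)) \<longlonglongrightarrow> lim_avg c0 \<rho> f"
  proof (rule LIMSEQ_I, goal_cases)
    case (1 r)
    then obtain g where g: "avg_conv g" "\<And>x. x \<ge> 0 \<Longrightarrow> \<bar>f x - g x\<bar> \<le> r / 4"
      using approx[of "r / 4"] by auto
    then obtain K where K: "g \<in> borel_measurable borel" "\<And>x. x \<ge> 0 \<Longrightarrow> \<bar>g x\<bar> \<le> K"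
      and gl: "(\<lambda>n. list_avg g (es n)) \<longlonglongrightarrow> lim_avg c0 \<rho> g" by (auto simp: avg_conv_def)
    have L: "\<bar>lim_avg c0 \<rho> f - lim_avg c0 \<rho> g\<bar> \<le> r / 4" by (rule lim_avg_dist[OF f fb K g(2)])
    have "\<forall>\<^sub>F n in sequentially. \<bar>list_avg g (es n) - lim_avg c0 \<rho> g\<bar> < r / 4"
      using tendstoD[OF gl, of "r / 4"] 1 by (simp add: dist_real_def)
    with es_ne have "\<forall>\<^sub>F n in sequentially. norm (list_avg f (es n) - lim_avg c0 \<rho> f) < r"
    proof eventually_elim
      case (elim n)
      have "\<bar>list_avg f (es n) - list_avg g (es n)\<bar> \<le> r / 4"
        using elim es_nn g(2) by (intro list_avg_dist) auto
      then show ?case using elim L 1 unfolding real_norm_def by linarith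
    qed
    then show ?case by (simp add: eventually_sequentially)
  qed
  then show ?thesis using f fb by (auto simp: avg_conv_def)
qed

text \<open>Derivatives in \<open>t\<close> are uniform limits of difference quotients, so all powers of \<open>1 / (x + t)\<close> are reached.\<close>

lemma avg_conv_inverse_power:
  assumes base: "\<And>t. t \<in> \<rat> \<Longrightarrow> t > 0 \<Longrightarrow> (\<lambda>n. list_avg (\<lambda>x. 1 / (x + t)) (es n)) \<longlonglongrightarrow> lim_avg c0 \<rho> (\<lambda>x. 1 / (x + t))"
    and t: "t \<in> \<rat>" "t > 0"
  shows "avg_conv (\<lambda>x. 1 / (x + t) ^ Suc k)"
  using t
proof (induction k arbitrary: t)
  case 0
  have "\<bar>1 / (x + t)\<bar> \<le> 1 / t" if "x \<ge> 0" for x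
    using that 0 by (simp add: frac_le)
  then show ?case unfolding avg_conv_def using base[OF 0] by auto
next
  case (Suc k)
  show ?case
  proof (rule avg_conv_approx)
    fix \<epsilon> :: real assume e: "\<epsilon> > 0"
    define A where "A = real (Suc (Suc k)) / t ^ Suc (Suc (Suc k))"
    have A: "A > 0" unfolding A_def using Suc by (intro divide_pos_pos) auto
    obtain N :: nat where N: "N > 0" "1 / real N < \<epsilon> / A"
      using ex_inverse_of_nat_less[of "\<epsilon> / A"] e A by (auto simp: inverse_eq_divide)
    \<comment> \<open>A rational step keeps \<open>t + h\<close> rational, so that the induction
      hypothesis covers both terms of the difference quotient.\<close>
    define h where "h = 1 / real N"
    have h: "h > 0" "h \<in> \<rat>" "h * A \<le> \<epsilon>" using N A by (auto simp: h_def field_simps)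
    define g where "g x = (1 / (Suc k * h)) * (1 / (x + t) ^ Suc k + (-1) * (1 / (x + (t + h)) ^ Suc k))" for x
    have "avg_conv g" unfolding g_def
      using Suc h by (intro avg_conv_cmult avg_conv_add Suc.IH) auto
    moreover have "\<bar>1 / (x + t) ^ Suc (Suc k) - g x\<bar> \<le> \<epsilon>" if "x \<ge> 0" for x
      using difference_quotient_approx[of x t h "Suc k"] that Suc.prems h unfolding g_def A_def
      by (intro order_trans[OF _ h(3)[unfolded A_def]]) blast
    ultimately show "\<exists>g. avg_conv g \<and> (\<forall>x\<ge>0. \<bar>1 / (x + t) ^ Suc (Suc k) - g x\<bar> \<le> \<epsilon>)" by blast
  qed simp
qed

text \<open>The step vanishes beyond \<open>b\<close>, hence extends continuously by 0 to
  \<open>x = \<infinity>\<close>. A polynomial in \<open>1 / (x + 1)\<close> is a combination of a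
  constant and of the inverse powers at the rational point \<open>t = 1\<close>, all of which are
  already in the class.\<close>

lemma avg_conv_cts_step:
  assumes base: "\<And>t. t \<in> \<rat> \<Longrightarrow> t > 0 \<Longrightarrow> (\<lambda>n. list_avg (\<lambda>x. 1 / (x + t)) (es n)) \<longlonglongrightarrow> lim_avg c0 \<rho> (\<lambda>x. 1 / (x + t))"
    and ab: "a < b"
  shows "avg_conv (cts_step a b)"
proof (rule avg_conv_approx)
  have cont: "continuous_on UNIV (cts_step a b)"
    using cts_step_uniformly_continuous[OF ab] by (rule uniformly_continuous_imp_continuous)
  show "cts_step a b \<in> borel_measurable borel"
    using cont by (rule borel_measurable_continuous_onI)
  \<comment> \<open>The substitution \<open>y = 1 / (x + 1)\<close> compactifies \<open>[0, \<infinity>)\<close>, so that Weierstrass applies on \<open>[0, 1]\<close>.\<close>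
  define G where "G y = (if y = 0 then 0 else cts_step a b (1 / y - 1))" for y :: real
  have "isCont G y \<or> continuous (at y within {0..1}) G" if y: "y \<in> {0..1}" for y
  proof (cases "y = 0")
    case True
    \<comment> \<open>For \<open>0 < z < \<delta>\<close> the point \<open>1 / z - 1\<close> exceeds
      \<open>\<bar>b\<bar>\<close> and lies past the step.\<close>
    define \<delta> where "\<delta> = 1 / (\<bar>b\<bar> + 1)"
    have d: "\<delta> > 0" by (simp add: \<delta>_def)
    have "\<forall>\<^sub>F z in at y within {0..1}. G z = 0"
      unfolding eventually_at
    proof (intro exI[of _ \<delta>] conjI d ballI impI)
      fix z assume z: "z \<in> {0..1}" "z \<noteq> y \<and> dist z y < \<delta>"
      then have z1: "0 < z" "z < \<delta>" using True by (auto simp: dist_real_def)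
      then have "1 / z > \<bar>b\<bar> + 1" by (simp add: \<delta>_def field_simps)
      then show "G z = 0" using ab by (auto simp: G_def cts_step_def)
    qed
    then have "(G \<longlongrightarrow> 0) (at y within {0..1})" by (rule tendsto_eventually)
    then show ?thesis using True by (simp add: continuous_within G_def)
  next
    case False
    then have yp: "y > 0" using y by auto
    have ev: "\<forall>\<^sub>F z in nhds y. cts_step a b (1 / z - 1) = G z"
    proof -
      have "\<forall>\<^sub>F z in nhds y. z \<in> {0<..}" using yp by (intro eventually_nhds_in_open) auto
      then show ?thesis by eventually_elim (simp add: G_def)
    qed
    have "isCont (cts_step a b) (1 / y - 1)"
      using cont by (simp add: continuous_on_eq_continuous_at)
    moreover have "isCont (\<lambda>z. 1 / z - 1) y" using yp by (intro continuous_intros) auto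
    ultimately have "isCont (\<lambda>z. cts_step a b (1 / z - 1)) y"
      by (intro isCont_o2[where f = "\<lambda>z. 1 / z - 1" and g = "cts_step a b"])
    then have "isCont G y" using isCont_cong[OF ev] by simp
    then show ?thesis by simp
  qed
  then have Gc: "continuous_on {0..1} G"
    unfolding continuous_on_eq_continuous_within using continuous_at_imp_continuous_at_within by blast
  fix \<epsilon> :: real assume e: "\<epsilon> > 0"
  obtain P where P: "real_polynomial_function P" "\<And>y. y \<in> {0..1} \<Longrightarrow> \<bar>G y - P y\<bar> < \<epsilon>"
    using Stone_Weierstrass_real_polynomial_function[OF _ Gc e] by auto
  then obtain c N where PN: "P = (\<lambda>y. \<Sum>i\<le>N. c i * y ^ i)"
    using real_polynomial_function_iff_sum by blast
  have "avg_conv (\<lambda>x. \<Sum>i\<le>M. c i * (1 / (x + 1)) ^ i)" for M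
  proof (induction M)
    case 0
    show ?case using avg_conv_const by simp
  next
    case (Suc M)
    have "avg_conv (\<lambda>x. 1 / (x + 1) ^ Suc M)" by (rule avg_conv_inverse_power[OF base]) auto
    from avg_conv_add[OF Suc avg_conv_cmult[OF this, of "c (Suc M)"]] show ?case
      by (simp add: power_one_over del: power_Suc)
  qed
  from this[of N] have "avg_conv (\<lambda>x. P (1 / (x + 1)))" by (simp add: PN)
  moreover have "\<bar>cts_step a b x - P (1 / (x + 1))\<bar> \<le> \<epsilon>" if "x \<ge> 0" for x
  proof -
    have "G (1 / (x + 1)) = cts_step a b x" using that by (simp add: G_def)
    then show ?thesis using P(2)[of "1 / (x + 1)"] that by (simp add: less_imp_le)
  qed
  ultimately show "\<exists>g. avg_conv g \<and> (\<forall>x\<ge>0. \<bar>cts_step a b x - g x\<bar> \<le> \<epsilon>)" by blast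
qed

text \<open>At a continuity point the indicator is squeezed between two continuous steps, one
  descending just before \<open>x\<close> and one just after; their limits are controlled by the
  limiting distribution function at nearby points.\<close>

lemma stieltjes_imp_weak_conv:
  assumes base: "\<And>t. t \<in> \<rat> \<Longrightarrow> t > 0 \<Longrightarrow> (\<lambda>n. list_avg (\<lambda>x. 1 / (x + t)) (es n)) \<longlonglongrightarrow> lim_avg c0 \<rho> (\<lambda>x. 1 / (x + t))"
  shows "weak_conv (\<lambda>n x. list_avg (indicator {..x}) (es n)) (\<lambda>x. lim_avg c0 \<rho> (indicator {..x}))"
  unfolding weak_conv_def
proof (intro allI impI)
  fix x assume cont: "isCont (\<lambda>x. lim_avg c0 \<rho> (indicator {..x})) x"
  let ?F = "\<lambda>x. lim_avg c0 \<rho> (indicator {..x})"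
  have cs_b: "\<bar>cts_step a b y\<bar> \<le> 1" if "a < b" for a b y using that by (auto simp: cts_step_def field_simps)
  have cs_i: "indicator {..a} y \<le> cts_step a b y" "cts_step a b y \<le> indicator {..b} y" if "a < b" for a b y
    using that by (auto simp: cts_step_def indicator_def field_simps)
  have conv: "(\<lambda>n. list_avg (cts_step a b) (es n)) \<longlonglongrightarrow> lim_avg c0 \<rho> (cts_step a b)"
    and meas: "cts_step a b \<in> borel_measurable borel" if "a < b" for a b
    using avg_conv_cts_step[OF base that] by (auto simp: avg_conv_def)
  have ind_b: "\<bar>indicator {..a} y :: real\<bar> \<le> 1" for a y :: real by (simp add: indicator_def)
  have up: "lim_avg c0 \<rho> (cts_step a b) \<le> ?F b" "?F a \<le> lim_avg c0 \<rho> (cts_step a b)" if "a < b" for a b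
    by (rule lim_avg_mono[where K = 1 and K' = 1]; use cs_b[OF that] cs_i[OF that] meas[OF that] ind_b in simp)+
  show "(\<lambda>n. list_avg (indicator {..x}) (es n)) \<longlonglongrightarrow> ?F x"
  proof (rule LIMSEQ_I, goal_cases)
    case (1 r)
    obtain \<delta> where d: "\<delta> > 0" "\<And>y. \<bar>y - x\<bar> < \<delta> \<Longrightarrow> \<bar>?F y - ?F x\<bar> < r / 2"
      using cont[unfolded continuous_at_eps_delta] 1 by (metis half_gt_zero dist_real_def real_norm_def)
    let ?y = "x + \<delta> / 2" and ?z = "x - \<delta> / 2"
    have F: "\<bar>?F ?y - ?F x\<bar> < r / 2" "\<bar>?F ?z - ?F x\<bar> < r / 2" using d by auto
    have lt: "x < ?y" "?z < x" using d by auto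
    have "\<forall>\<^sub>F n in sequentially. \<bar>list_avg (cts_step x ?y) (es n) - lim_avg c0 \<rho> (cts_step x ?y)\<bar> < r / 2"
      using tendstoD[OF conv[OF lt(1)], of "r / 2"] 1 by (simp add: dist_real_def)
    moreover have "\<forall>\<^sub>F n in sequentially. \<bar>list_avg (cts_step ?z x) (es n) - lim_avg c0 \<rho> (cts_step ?z x)\<bar> < r / 2"
      using tendstoD[OF conv[OF lt(2)], of "r / 2"] 1 by (simp add: dist_real_def)
    ultimately have "\<forall>\<^sub>F n in sequentially. norm (list_avg (indicator {..x}) (es n) - ?F x) < r"
    proof eventually_elim
      case (elim n)
      have "list_avg (indicator {..x}) (es n) \<le> list_avg (cts_step x ?y) (es n)"
        "list_avg (cts_step ?z x) (es n) \<le> list_avg (indicator {..x}) (es n)"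
        by (intro list_avg_mono cs_i lt)+
      then show ?case using elim up[OF lt(1)] up[OF lt(2)] F unfolding real_norm_def by linarith
    qed
    then show ?case by (simp add: eventually_sequentially)
  qed
qed

end

section \<open>Resolvents of sums of rank-one matrices\<close>

text \<open>Vectors and matrices are plain functions read only on the index set \<open>D\<close>, so
  that the \<open>d\<close>-subsets themselves can serve as indices.\<close>

definition app :: "'i set \<Rightarrow> ('i \<Rightarrow> 'i \<Rightarrow> real) \<Rightarrow> ('i \<Rightarrow> real) \<Rightarrow> 'i \<Rightarrow> real" where
  "app D B v a = (\<Sum>b\<in>D. B a b * v b)"

definition quad :: "'i set \<Rightarrow> ('i \<Rightarrow> 'i \<Rightarrow> real) \<Rightarrow> ('i \<Rightarrow> real) \<Rightarrow> real" where
  "quad D B v = (\<Sum>a\<in>D. v a * app D B v a)"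

definition reg_gram ::
  "real \<Rightarrow> real \<Rightarrow> (nat \<Rightarrow> 'i \<Rightarrow> real) \<Rightarrow> nat list \<Rightarrow> 'i \<Rightarrow> 'i \<Rightarrow> real" where
  "reg_gram t c x ks a b = (if a = b then t else 0) + c * (\<Sum>k\<leftarrow>ks. x k a * x k b)"

text \<open>
  The inverse of \<open>reg_gram\<close>, built up one column at a time by the Sherman--Morrison formula. The recursion
  makes symmetry and measurability immediate and avoids determinants.
\<close>

primrec resolv ::
  "'i set \<Rightarrow> real \<Rightarrow> real \<Rightarrow> (nat \<Rightarrow> 'i \<Rightarrow> real) \<Rightarrow> nat list \<Rightarrow> 'i \<Rightarrow> 'i \<Rightarrow> real" where
  "resolv D t c x [] = (\<lambda>a b. if a = b then 1 / t else 0)"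
| "resolv D t c x (k # ks) = (\<lambda>a b. resolv D t c x ks a b
     - c / (1 + c * quad D (resolv D t c x ks) (x k))
       * app D (resolv D t c x ks) (x k) a * app D (resolv D t c x ks) (x k) b)"

lemma resolv_sym: "resolv D t c x ks a b = resolv D t c x ks b a"
  by (induction ks arbitrary: a b) (auto simp: mult_ac)

lemma reg_gram_sym: "reg_gram t c x ks a b = reg_gram t c x ks b a"
  by (simp add: reg_gram_def mult.commute)

lemma reg_gram_Cons: "reg_gram t c x (k # ks) a e = reg_gram t c x ks a e + c * x k a * x k e"
  by (simp add: reg_gram_def algebra_simps)

text \<open>Only the columns listed in \<open>ks\<close> are read. This is how the leave-one-out
  resolvent is seen to ignore the removed column.\<close>

lemma resolv_cong:
  assumes "\<And>k a. k \<in> set ks \<Longrightarrow> a \<in> D \<Longrightarrow> x k a = y k a"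
  shows "resolv D t c x ks = resolv D t c y ks"
  using assms
proof (induction ks)
  case (Cons k ks)
  have e: "resolv D t c x ks = resolv D t c y ks" using Cons by simp
  have "app D B (x k) = app D B (y k)" for B
    unfolding app_def using Cons.prems by (intro ext sum.cong) auto
  moreover from this have "quad D B (x k) = quad D B (y k)" for B
    unfolding quad_def using Cons.prems by (intro sum.cong) auto
  ultimately show ?case by (simp add: e)
qed simp

context
  fixes D :: "'i set" and t c :: real and x :: "nat \<Rightarrow> 'i \<Rightarrow> real"
  assumes fin: "finite D" and t: "t > 0" and c: "c \<ge> 0"
begin

text \<open>Each rank-one term adds \<open>c\<close> times a square, so the identity part alone
  gives the lower bound.\<close>

lemma reg_gram_coercive:
  "t * (\<Sum>a\<in>D. (v a)\<^sup>2) \<le> (\<Sum>a\<in>D. v a * app D (reg_gram t c x ks) v a)"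
proof (induction ks)
  case Nil
  have "app D (reg_gram t c x []) v a = t * v a" if "a \<in> D" for a
  proof -
    have "app D (reg_gram t c x []) v a = (\<Sum>b\<in>D. if b = a then t * v b else 0)"
      unfolding app_def reg_gram_def by (intro sum.cong) auto
    then show ?thesis using fin that by simp
  qed
  then show ?case by (simp add: sum_distrib_left power2_eq_square mult_ac)
next
  case (Cons k ks)
  have "app D (reg_gram t c x (k # ks)) v a
      = app D (reg_gram t c x ks) v a + c * x k a * (\<Sum>b\<in>D. x k b * v b)" for a
    unfolding app_def sum_distrib_left sum.distrib[symmetric]
    by (intro sum.cong refl) (simp add: reg_gram_def algebra_simps)
  then have "(\<Sum>a\<in>D. v a * app D (reg_gram t c x (k # ks)) v a)
      = (\<Sum>a\<in>D. v a * app D (reg_gram t c x ks) v a)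
        + c * (\<Sum>a\<in>D. x k a * v a) * (\<Sum>b\<in>D. x k b * v b)"
    by (simp add: sum_distrib_left sum_distrib_right sum.distrib algebra_simps)
  moreover have "c * (\<Sum>a\<in>D. x k a * v a) * (\<Sum>b\<in>D. x k b * v b) \<ge> 0"
    using c by (metis (no_types) mult.assoc mult_nonneg_nonneg zero_le_square)
  ultimately show ?case using Cons by linarith
qed

lemma app_inverse:
  assumes inv: "\<And>a b. a \<in> D \<Longrightarrow> b \<in> D \<Longrightarrow> (\<Sum>e\<in>D. A a e * B e b) = (if a = b then 1 else 0)"
    and a: "a \<in> D"
  shows "app D A (app D B v) a = v a"
proof -
  have "app D A (app D B v) a = (\<Sum>e\<in>D. \<Sum>b\<in>D. A a e * B e b * v b)"
    by (simp add: app_def sum_distrib_left mult_ac)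
  also have "\<dots> = (\<Sum>b\<in>D. (\<Sum>e\<in>D. A a e * B e b) * v b)"
    by (subst sum.swap) (simp add: sum_distrib_right)
  also have "\<dots> = (\<Sum>b\<in>D. if a = b then v b else 0)"
    using inv a by (intro sum.cong) auto
  finally show ?thesis using fin a by simp
qed

text \<open>Substituting \<open>v = A (B v)\<close> with \<open>A\<close> the regularised Gram
  matrix gives \<open>v . B v = (B v) . A (B v)\<close>, and coercivity of \<open>A\<close> applies.
  The statement takes an arbitrary right inverse because it is used inside the induction that proves
  \<open>resolv\<close> to be one.\<close>

lemma quad_ge_of_inverse:
  assumes inv: "\<And>a b. a \<in> D \<Longrightarrow> b \<in> D \<Longrightarrow>
      (\<Sum>e\<in>D. reg_gram t c x ks a e * B e b) = (if a = b then 1 else 0)"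
  shows "t * (\<Sum>a\<in>D. (app D B v a)\<^sup>2) \<le> quad D B v"
proof -
  have "quad D B v = (\<Sum>a\<in>D. app D B v a * app D (reg_gram t c x ks) (app D B v) a)"
    unfolding quad_def using app_inverse[OF inv] by (intro sum.cong) (auto simp: mult_ac)
  then show ?thesis using reg_gram_coercive by simp
qed

text \<open>Expanding the product leaves, besides the identity, a rank-one term with factor
  \<open>c - g * (1 + c * ?q)\<close>, which vanishes by the choice of \<open>g\<close>. Positivity
  of the denominator comes from the quadratic form bound for the shorter list.\<close>

lemma resolv_inverse:
  assumes "a \<in> D" "b \<in> D"
  shows "(\<Sum>e\<in>D. reg_gram t c x ks a e * resolv D t c x ks e b) = (if a = b then 1 else 0)"
  using assms
proof (induction ks arbitrary: a b)
  case Nil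
  have "(\<Sum>e\<in>D. reg_gram t c x [] a e * resolv D t c x [] e b)
      = (\<Sum>e\<in>D. if e = a then (if a = b then 1 else 0) else 0)"
    using t by (intro sum.cong) (auto simp: reg_gram_def)
  then show ?case using fin Nil by simp
next
  case (Cons k ks)
  let ?A = "reg_gram t c x ks" and ?B = "resolv D t c x ks"
  let ?y = "app D ?B (x k)" and ?q = "quad D ?B (x k)"
  define g where "g = c / (1 + c * ?q)"
  note inv = Cons.IH
  have "0 \<le> t * (\<Sum>a\<in>D. (?y a)\<^sup>2)" using t by (simp add: sum_nonneg)
  also have "\<dots> \<le> ?q" by (rule quad_ge_of_inverse[OF inv])
  finally have q: "1 + c * ?q > 0" using c by (simp add: add_pos_nonneg)
  have Ay: "(\<Sum>e\<in>D. ?A a e * ?y e) = x k a"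
    using app_inverse[OF inv Cons.prems(1), of "x k"] by (simp add: app_def)
  have xB: "(\<Sum>e\<in>D. x k e * ?B e b) = ?y b"
    unfolding app_def by (intro sum.cong) (auto simp: resolv_sym mult_ac)
  have xy: "(\<Sum>e\<in>D. x k e * ?y e) = ?q" by (simp add: quad_def)
  have "reg_gram t c x (k # ks) a e * resolv D t c x (k # ks) e b
     = ?A a e * ?B e b + c * x k a * (x k e * ?B e b) - g * ?y b * (?A a e * ?y e)
       - c * g * x k a * ?y b * (x k e * ?y e)" for e
    unfolding reg_gram_Cons resolv.simps g_def[symmetric] by (simp only: algebra_simps)
  then have "(\<Sum>e\<in>D. reg_gram t c x (k # ks) a e * resolv D t c x (k # ks) e b)
     = (\<Sum>e\<in>D. ?A a e * ?B e b) + c * x k a * (\<Sum>e\<in>D. x k e * ?B e b)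
       - g * ?y b * (\<Sum>e\<in>D. ?A a e * ?y e)
       - c * g * x k a * ?y b * (\<Sum>e\<in>D. x k e * ?y e)"
    by (simp add: sum.distrib sum_subtractf sum_distrib_left)
  also have "\<dots> = (if a = b then 1 else 0) + x k a * ?y b * (c - g * (1 + c * ?q))"
    unfolding Ay xB xy inv[OF Cons.prems] by (simp add: algebra_simps)
  also have "c - g * (1 + c * ?q) = 0" unfolding g_def using q by simp
  finally show ?case by simp
qed

text \<open>From \<open>B = B (A Z) = (B A) Z\<close>; symmetry of \<open>A\<close> and
  \<open>B\<close> turns the known right inverse into a left inverse.\<close>

lemma resolv_unique:
  assumes Z: "\<And>a b. a \<in> D \<Longrightarrow> b \<in> D \<Longrightarrow>
      (\<Sum>e\<in>D. reg_gram t c x ks a e * Z e b) = (if a = b then 1 else 0)"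
    and ab: "a \<in> D" "b \<in> D"
  shows "Z a b = resolv D t c x ks a b"
proof -
  let ?A = "reg_gram t c x ks" and ?B = "resolv D t c x ks"
  have "?B a b = (\<Sum>e\<in>D. if e = b then ?B a e else 0)" using fin ab by simp
  also have "\<dots> = (\<Sum>e\<in>D. ?B a e * (\<Sum>f\<in>D. ?A e f * Z f b))"
    using Z ab by (intro sum.cong) auto
  also have "\<dots> = (\<Sum>e\<in>D. \<Sum>f\<in>D. ?A f e * ?B e a * Z f b)"
    unfolding sum_distrib_left
    by (intro sum.cong refl) (simp add: mult_ac resolv_sym[of D t c x ks a] reg_gram_sym[of t c x ks])
  also have "\<dots> = (\<Sum>f\<in>D. (\<Sum>e\<in>D. ?A f e * ?B e a) * Z f b)"
    by (subst sum.swap) (simp add: sum_distrib_right)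
  also have "\<dots> = (\<Sum>f\<in>D. if f = a then Z f b else 0)"
    using resolv_inverse ab by (intro sum.cong) auto
  finally show ?thesis using fin ab by simp
qed

text \<open>The Gram matrix depends on the list only through a sum, so uniqueness of the inverse
  makes the order irrelevant. Any column can thus be treated as the one added last.\<close>

lemma resolv_mset_eq:
  assumes "mset ks = mset ks'" "a \<in> D" "b \<in> D"
  shows "resolv D t c x ks a b = resolv D t c x ks' a b"
proof (rule resolv_unique[OF _ assms(2,3)])
  have "(\<Sum>k\<leftarrow>ks. f k) = (\<Sum>k\<leftarrow>ks'. f k)" for f :: "nat \<Rightarrow> real"
    using assms(1) by (metis mset_map sum_mset_sum_list)
  then have "reg_gram t c x ks' = reg_gram t c x ks"
    by (intro ext) (simp add: reg_gram_def)
  then show "(\<Sum>e\<in>D. reg_gram t c x ks' a e * resolv D t c x ks e b) = (if a = b then 1 else 0)"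
    if "a \<in> D" "b \<in> D" for a b
    using resolv_inverse[OF that] by simp
qed

lemma resolv_quad_ge: "t * (\<Sum>a\<in>D. (app D (resolv D t c x ks) v a)\<^sup>2) \<le> quad D (resolv D t c x ks) v"
  by (rule quad_ge_of_inverse[OF resolv_inverse])

lemma resolv_quad_nonneg: "0 \<le> quad D (resolv D t c x ks) v"
  using resolv_quad_ge[of ks v] t
  by (meson mult_nonneg_nonneg order_trans sum_nonneg zero_le_power2 less_imp_le)

lemma app_unit: "b \<in> D \<Longrightarrow> app D B (\<lambda>e. if e = b then 1 else 0) a = B a b"
  using fin by (simp add: app_def if_distrib cong: if_cong)

lemma quad_unit: "b \<in> D \<Longrightarrow> quad D B (\<lambda>e. if e = b then 1 else 0) = B b b"
  using fin by (simp add: quad_def app_unit if_distrib if_distribR cong: if_cong)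

text \<open>For a unit vector the quadratic form bound reads
  \<open>t * \<Sum>a. B a b ^ 2 \<le> B b b\<close>, while \<open>B b b ^ 2\<close> is one of the
  summands on the left. Together they bound the diagonal entry and then the whole column.\<close>

lemma resolv_column_norm:
  assumes b: "b \<in> D"
  shows "(\<Sum>a\<in>D. (resolv D t c x ks a b)\<^sup>2) \<le> 1 / t\<^sup>2" "0 \<le> resolv D t c x ks b b"
    "resolv D t c x ks b b \<le> 1 / t"
proof -
  let ?B = "resolv D t c x ks"
  have *: "t * (\<Sum>a\<in>D. (?B a b)\<^sup>2) \<le> ?B b b"
    using resolv_quad_ge[of ks "\<lambda>e. if e = b then 1 else 0"] b by (simp add: app_unit quad_unit)
  have le: "(?B b b)\<^sup>2 \<le> (\<Sum>a\<in>D. (?B a b)\<^sup>2)"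
    using fin b by (intro member_le_sum) auto
  show nn: "0 \<le> ?B b b" using resolv_quad_nonneg[of ks "\<lambda>e. if e = b then 1 else 0"] b
    by (simp add: quad_unit)
  have "t * (?B b b)\<^sup>2 \<le> ?B b b" using * le t by (meson mult_left_mono order_trans less_imp_le)
  then have "t * ?B b b \<le> 1" using nn
    by (cases "?B b b = 0") (auto simp: power2_eq_square)
  then show B: "?B b b \<le> 1 / t" using t by (simp add: field_simps)
  have "(\<Sum>a\<in>D. (?B a b)\<^sup>2) \<le> ?B b b / t" using * t by (simp add: field_simps)
  also have "\<dots> \<le> (1 / t) / t" using B t by (intro divide_right_mono) auto
  finally show "(\<Sum>a\<in>D. (?B a b)\<^sup>2) \<le> 1 / t\<^sup>2" by (simp add: power2_eq_square)
qed

lemma resolv_frobenius: "(\<Sum>a\<in>D. \<Sum>b\<in>D. (resolv D t c x ks a b)\<^sup>2) \<le> card D / t\<^sup>2"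
proof -
  have "(\<Sum>b\<in>D. \<Sum>a\<in>D. (resolv D t c x ks a b)\<^sup>2) \<le> (\<Sum>b\<in>D. 1 / t\<^sup>2)"
    by (intro sum_mono resolv_column_norm)
  then show ?thesis by (subst sum.swap) simp
qed

lemma resolv_entry_bound: "a \<in> D \<Longrightarrow> b \<in> D \<Longrightarrow> \<bar>resolv D t c x ks a b\<bar> \<le> 1 / t"
proof -
  assume "a \<in> D" "b \<in> D"
  then have "(resolv D t c x ks a b)\<^sup>2 \<le> (\<Sum>a\<in>D. (resolv D t c x ks a b)\<^sup>2)"
    using fin by (intro member_le_sum) auto
  also have "\<dots> \<le> (1 / t)\<^sup>2" using resolv_column_norm(1)[OF \<open>b \<in> D\<close>] by (simp add: power_divide)
  finally show ?thesis using t by (metis abs_le_square_iff abs_of_pos zero_less_divide_1_iff)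
qed

lemma trace_resolv_bounds:
  "0 \<le> (\<Sum>a\<in>D. resolv D t c x ks a a)" "(\<Sum>a\<in>D. resolv D t c x ks a a) \<le> card D / t"
  using sum_mono[of D "\<lambda>a. resolv D t c x ks a a" "\<lambda>_. 1 / t"] resolv_column_norm
  by (auto intro!: sum_nonneg)

text \<open>The trace drops by \<open>c / (1 + c * q)\<close> times the squared norm of
  \<open>R x\<close>; that norm is at most \<open>q / t\<close>, and
  \<open>c * q / (1 + c * q)\<close> is below 1. The bound is free of the size of the column, so it
  holds however large the tensor entries are.\<close>

lemma trace_resolv_Cons:
  "(\<Sum>a\<in>D. resolv D t c x ks a a) - 1 / t \<le> (\<Sum>a\<in>D. resolv D t c x (k # ks) a a)"
  "(\<Sum>a\<in>D. resolv D t c x (k # ks) a a) \<le> (\<Sum>a\<in>D. resolv D t c x ks a a)"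
proof -
  let ?B = "resolv D t c x ks"
  let ?y = "app D ?B (x k)" and ?q = "quad D ?B (x k)"
  have q: "?q \<ge> 0" "t * (\<Sum>a\<in>D. (?y a)\<^sup>2) \<le> ?q" by (rule resolv_quad_nonneg resolv_quad_ge)+
  have eq: "(\<Sum>a\<in>D. resolv D t c x (k # ks) a a)
      = (\<Sum>a\<in>D. ?B a a) - c / (1 + c * ?q) * (\<Sum>a\<in>D. (?y a)\<^sup>2)"
    by (simp add: sum_subtractf sum_distrib_left power2_eq_square mult_ac)
  have s: "0 \<le> (\<Sum>a\<in>D. (?y a)\<^sup>2)" by (simp add: sum_nonneg)
  have cq: "c / (1 + c * ?q) \<ge> 0" using c q by simp
  show "(\<Sum>a\<in>D. resolv D t c x (k # ks) a a) \<le> (\<Sum>a\<in>D. ?B a a)"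
    unfolding eq using mult_nonneg_nonneg[OF cq s] by simp
  have "c / (1 + c * ?q) * (\<Sum>a\<in>D. (?y a)\<^sup>2) \<le> c / (1 + c * ?q) * (?q / t)"
    using cq q t by (intro mult_left_mono) (auto simp: field_simps)
  also have "\<dots> = c * ?q / (1 + c * ?q) / t" by simp
  also have "\<dots> \<le> 1 / t" using c q t by (intro divide_right_mono) (auto simp: divide_le_eq_1 add_pos_nonneg)
  finally show "(\<Sum>a\<in>D. ?B a a) - 1 / t \<le> (\<Sum>a\<in>D. resolv D t c x (k # ks) a a)"
    unfolding eq by simp
qed

text \<open>Adding the column rescales \<open>R x\<close> by the factor
  \<open>1 / (1 + c * q)\<close>.\<close>

lemma quad_resolv_Cons:
  "c * quad D (resolv D t c x (k # ks)) (x k)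
     = 1 - 1 / (1 + c * quad D (resolv D t c x ks) (x k))"
proof -
  let ?B = "resolv D t c x ks"
  let ?y = "app D ?B (x k)" and ?q = "quad D ?B (x k)"
  define g where "g = c / (1 + c * ?q)"
  have q: "1 + c * ?q > 0" using resolv_quad_nonneg[of ks "x k"] c by (simp add: add_pos_nonneg)
  have xy: "(\<Sum>b\<in>D. x k b * ?y b) = ?q" by (simp add: quad_def)
  have y: "app D (resolv D t c x (k # ks)) (x k) a = (1 - g * ?q) * ?y a" for a
  proof -
    have "app D (resolv D t c x (k # ks)) (x k) a
        = (\<Sum>b\<in>D. ?B a b * x k b - g * ?y a * (x k b * ?y b))"
      unfolding app_def[of D "resolv D t c x (k # ks)"] unfolding resolv.simps g_def[symmetric]
      by (intro sum.cong refl) (simp only: left_diff_distrib right_diff_distrib mult_ac)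
    also have "\<dots> = ?y a - g * ?y a * ?q"
      unfolding sum_subtractf sum_distrib_left[symmetric] xy app_def[of D ?B "x k" a] ..
    finally show ?thesis by (simp add: algebra_simps)
  qed
  have "quad D (resolv D t c x (k # ks)) (x k) = (1 - g * ?q) * (\<Sum>b\<in>D. x k b * ?y b)"
    unfolding quad_def[of D "resolv D t c x (k # ks)"] y sum_distrib_left
    by (intro sum.cong refl) (simp only: mult_ac)
  also have "c * \<dots> = 1 - 1 / (1 + c * ?q)"
    unfolding xy g_def using q by (simp add: field_simps)
  finally show ?thesis by simp
qed

text \<open>The trace of the Gram matrix times its inverse is the dimension; the identity part
  yields the resolvent trace and each column a quadratic form.\<close>

lemma trace_identity:
  "real (card D) = (\<Sum>k\<leftarrow>ks. c * quad D (resolv D t c x ks) (x k)) + t * (\<Sum>a\<in>D. resolv D t c x ks a a)"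
proof -
  let ?B = "resolv D t c x ks"
  have d: "(\<Sum>e\<in>D. (if a = e then t else 0) * ?B e a) = t * ?B a a" if "a \<in> D" for a
  proof -
    have "(\<Sum>e\<in>D. (if a = e then t else 0) * ?B e a) = (\<Sum>e\<in>D. if e = a then t * ?B a a else 0)"
      by (intro sum.cong) auto
    then show ?thesis using fin that by simp
  qed
  have "real (card D) = (\<Sum>a\<in>D. \<Sum>e\<in>D. reg_gram t c x ks a e * ?B e a)"
    using resolv_inverse by simp
  also have "\<dots> = (\<Sum>a\<in>D. t * ?B a a + (\<Sum>e\<in>D. (c * (\<Sum>k\<leftarrow>ks. x k a * x k e)) * ?B e a))"
    using d by (intro sum.cong refl) (simp add: reg_gram_def distrib_right sum.distrib)
  also have "\<dots> = t * (\<Sum>a\<in>D. ?B a a) + (\<Sum>a\<in>D. \<Sum>e\<in>D. (c * (\<Sum>k\<leftarrow>ks. x k a * x k e)) * ?B e a)"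
    by (simp add: sum.distrib sum_distrib_left)
  \<comment> \<open>The list \<open>js\<close> of summed columns varies in the induction while the
    resolvent stays that of \<open>ks\<close>.\<close>
  also have "(\<Sum>a\<in>D. \<Sum>e\<in>D. (c * (\<Sum>k\<leftarrow>js. x k a * x k e)) * ?B e a)
      = (\<Sum>k\<leftarrow>js. c * quad D ?B (x k))" for js
  proof (induction js)
    case (Cons j js)
    have "(\<Sum>a\<in>D. \<Sum>e\<in>D. (c * (\<Sum>k\<leftarrow>j # js. x k a * x k e)) * ?B e a)
      = (\<Sum>a\<in>D. \<Sum>e\<in>D. c * (x j a * (?B a e * x j e)))
        + (\<Sum>a\<in>D. \<Sum>e\<in>D. (c * (\<Sum>k\<leftarrow>js. x k a * x k e)) * ?B e a)"
      unfolding sum.distrib[symmetric]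
      by (intro sum.cong refl) (simp add: algebra_simps resolv_sym[of D t c x ks])
    then show ?case using Cons by (simp add: quad_def app_def sum_distrib_left mult_ac)
  qed simp
  finally show ?thesis by simp
qed

end

section \<open>The approximate fixed-point equation for the resolvent trace\<close>

lemma inverse_one_plus_lipschitz:
  assumes "0 \<le> u" "0 \<le> (v::real)"
  shows "\<bar>1 / (1 + u) - 1 / (1 + v)\<bar> \<le> \<bar>u - v\<bar>"
proof -
  have "\<bar>1 / (1 + u) - 1 / (1 + v)\<bar> = \<bar>u - v\<bar> / ((1 + u) * (1 + v))"
    using assms by (simp add: field_simps abs_mult flip: abs_minus_commute[of u v])
  also have "\<dots> \<le> \<bar>u - v\<bar> / 1"
    using assms by (intro divide_left_mono mult_pos_pos) (auto simp: algebra_simps)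
  finally show ?thesis by simp
qed

text \<open>Each column in turn is moved to the front of the list. Replacing its quadratic form by
  the trace of its own leave-one-out resolvent gives the first error, replacing that trace by
  \<open>T\<close> costs at most \<open>1 / t\<close>. One factor \<open>1 / m\<close> comes from
  \<open>c\<close>, the other from averaging over the columns.\<close>

lemma self_consistent_bound:
  fixes x :: "nat \<Rightarrow> 'i \<Rightarrow> real"
  assumes fin: "finite D" and t: "t > 0" and m: "m > 0"
  defines "c \<equiv> 1 / real m" and "p \<equiv> real (card D)"
  defines "T \<equiv> (\<Sum>a\<in>D. resolv D t c x [0..<m] a a)"
    and "B \<equiv> \<lambda>k. resolv D t c x (remove1 k [0..<m])"
  shows "\<bar>(p - t * T) / m - 1 + 1 / (1 + T / m)\<bar>
    \<le> (\<Sum>k<m. \<bar>quad D (B k) (x k) - (\<Sum>a\<in>D. B k a a)\<bar> + 1 / t) / m\<^sup>2"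
proof -
  have c: "c \<ge> 0" by (simp add: c_def)
  let ?R = "resolv D t c x [0..<m]"
  let ?q = "\<lambda>k. quad D (B k) (x k)"
  have T0: "T \<ge> 0" unfolding T_def by (rule trace_resolv_bounds[OF fin t c])
  have q0: "?q k \<ge> 0" for k unfolding B_def by (rule resolv_quad_nonneg[OF fin t c])
  have R: "?R a b = resolv D t c x (k # remove1 k [0..<m]) a b"
    if "k < m" "a \<in> D" "b \<in> D" for k a b
    using that by (intro resolv_mset_eq[OF fin t c]) simp_all
  have qR: "c * quad D ?R (x k) = 1 - 1 / (1 + c * ?q k)" if "k < m" for k
  proof -
    have "quad D ?R (x k) = quad D (resolv D t c x (k # remove1 k [0..<m])) (x k)"
      unfolding quad_def app_def using R[OF that] by (intro sum.cong refl arg_cong2[where f="(*)"]) auto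
    then show ?thesis unfolding B_def using quad_resolv_Cons[OF fin t c] by simp
  qed
  have TB: "\<bar>T - (\<Sum>a\<in>D. B k a a)\<bar> \<le> 1 / t" if "k < m" for k
  proof -
    have "T = (\<Sum>a\<in>D. resolv D t c x (k # remove1 k [0..<m]) a a)"
      unfolding T_def using R[OF that] by (intro sum.cong) auto
    then show ?thesis unfolding B_def
      using trace_resolv_Cons[OF fin t c, where x=x and k=k and ks="remove1 k [0..<m]"] by linarith
  qed
  have "p - t * T = (\<Sum>k\<leftarrow>[0..<m]. c * quad D ?R (x k))"
    unfolding p_def T_def using trace_identity[OF fin t c, where x=x and ks="[0..<m]"] by simp
  also have "\<dots> = (\<Sum>k<m. 1 - 1 / (1 + c * ?q k))"
    using qR by (simp add: interv_sum_list_conv_sum_set_nat lessThan_atLeast0)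
  finally have "(p - t * T) / m - 1 + 1 / (1 + T / m)
      = (\<Sum>k<m. 1 / (1 + T / m) - 1 / (1 + c * ?q k)) / m"
    using m by (simp add: sum_subtractf field_simps)
  also have "\<bar>\<dots>\<bar> \<le> (\<Sum>k<m. \<bar>1 / (1 + T / m) - 1 / (1 + c * ?q k)\<bar>) / m"
    by (simp add: abs_divide divide_right_mono)
  also have "\<dots> \<le> (\<Sum>k<m. (\<bar>?q k - (\<Sum>a\<in>D. B k a a)\<bar> + 1 / t) / m) / m"
  proof (intro divide_right_mono sum_mono)
    fix k assume "k \<in> {..<m}"
    then have k: "k < m" by simp
    have "\<bar>1 / (1 + T / m) - 1 / (1 + c * ?q k)\<bar> \<le> \<bar>T / m - c * ?q k\<bar>"
      using T0 q0 c by (intro inverse_one_plus_lipschitz) auto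
    also have "\<dots> = \<bar>T - ?q k\<bar> / m"
      by (simp add: c_def flip: diff_divide_distrib)
    also have "\<dots> \<le> (\<bar>?q k - (\<Sum>a\<in>D. B k a a)\<bar> + 1 / t) / m"
      using TB[OF k] by (intro divide_right_mono) auto
    finally show "\<bar>1 / (1 + T / m) - 1 / (1 + c * ?q k)\<bar>
        \<le> (\<bar>?q k - (\<Sum>a\<in>D. B k a a)\<bar> + 1 / t) / m" .
  qed simp
  also have "\<dots> = (\<Sum>k<m. \<bar>?q k - (\<Sum>a\<in>D. B k a a)\<bar> + 1 / t) / m\<^sup>2"
    by (simp only: sum_divide_distrib[symmetric] power2_eq_square divide_divide_eq_left of_nat_mult)
  finally show ?thesis .
qed

section \<open>Spectrum of real symmetric matrices\<close>

lemma index_mult_mat_sum: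
  fixes A B :: "'a::semiring_0 mat"
  assumes "A \<in> carrier_mat p p" "B \<in> carrier_mat p p" "i < p" "j < p"
  shows "(A * B) $$ (i, j) = (\<Sum>k<p. A $$ (i, k) * B $$ (k, j))"
  using assms by (auto simp: scalar_prod_def lessThan_atLeast0 intro!: sum.cong)

lemma trace_mult_commute:
  fixes A B :: "'a::comm_semiring_0 mat"
  assumes "A \<in> carrier_mat p p" "B \<in> carrier_mat p p"
  shows "(\<Sum>i<p. (A * B) $$ (i, i)) = (\<Sum>i<p. (B * A) $$ (i, i))"
proof -
  have "(\<Sum>i<p. (A * B) $$ (i, i)) = (\<Sum>i<p. \<Sum>k<p. A $$ (i, k) * B $$ (k, i))"
    using assms by (intro sum.cong) (auto simp: index_mult_mat_sum simp del: index_mult_mat)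
  also have "\<dots> = (\<Sum>i<p. \<Sum>k<p. B $$ (i, k) * A $$ (k, i))"
    by (subst sum.swap) (simp add: mult.commute)
  also have "\<dots> = (\<Sum>i<p. (B * A) $$ (i, i))"
    using assms by (intro sum.cong) (auto simp: index_mult_mat_sum simp del: index_mult_mat)
  finally show ?thesis .
qed

text \<open>Back substitution shows that \<open>Z\<close> is upper triangular too, so only the
  diagonal product survives in a diagonal entry of \<open>B * Z\<close>.\<close>

lemma upper_triangular_right_inverse_diag:
  fixes B Z :: "'a::field mat"
  assumes B: "B \<in> carrier_mat p p" and Z: "Z \<in> carrier_mat p p" and ut: "upper_triangular B"
    and inv: "B * Z = 1\<^sub>m p" and nz: "\<And>i. i < p \<Longrightarrow> B $$ (i, i) \<noteq> 0"
    and i: "i < p"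
  shows "Z $$ (i, i) = 1 / B $$ (i, i)"
proof -
  have eq: "(\<Sum>k<p. B $$ (i, k) * Z $$ (k, j)) = (if i = j then 1 else 0)" if "i < p" "j < p" for i j
    using index_mult_mat_sum[OF B Z that] inv that by simp
  have split: "(\<Sum>k<p. B $$ (i, k) * Z $$ (k, j))
      = B $$ (i, i) * Z $$ (i, j) + (\<Sum>k\<in>{i<..<p}. B $$ (i, k) * Z $$ (k, j))"
    if "i < p" for i j
  proof -
    have "(\<Sum>k<p. B $$ (i, k) * Z $$ (k, j)) = (\<Sum>k\<in>{i..<p}. B $$ (i, k) * Z $$ (k, j))"
      using ut B that by (intro sum.mono_neutral_right) (auto simp: upper_triangular_def)
    also have "{i..<p} = insert i {i<..<p}" using that by auto
    finally show ?thesis by simp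
  qed
  have lower: "Z $$ (i, j) = 0" if "j < i" "i < p" for i j
    using that
  \<comment> \<open>The rows are treated from the bottom up: below row \<open>i\<close> the entries
    in column \<open>j\<close> are already known to vanish.\<close>
  proof (induction "p - i" arbitrary: i rule: less_induct)
    case less
    have "(\<Sum>k\<in>{i<..<p}. B $$ (i, k) * Z $$ (k, j)) = 0"
      using less by (intro sum.neutral) auto
    then have "B $$ (i, i) * Z $$ (i, j) = 0"
      using eq[of i j] split[of i j] less.prems by simp
    then show ?case using nz less.prems by simp
  qed
  have "(\<Sum>k\<in>{i<..<p}. B $$ (i, k) * Z $$ (k, i)) = 0"
    using lower by (intro sum.neutral) auto
  then have "B $$ (i, i) * Z $$ (i, i) = 1" using eq[of i i] split[of i i] i by simp
  then show ?thesis using nz[OF i] by (simp add: field_simps)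
qed

lemma proots_linear_factors: "proots (\<Prod>e\<leftarrow>es. [:- e, 1:]) = mset (es :: 'a::idom list)"
proof (induction es)
  case (Cons e es)
  have "(\<Prod>e\<leftarrow>es. [:- e, 1:]) \<noteq> 0" by (auto simp: prod_list_zero_iff)
  then show ?case using Cons by (simp add: proots_mult del: mult_pCons_left)
qed simp

text \<open>With eigenvector \<open>f = x + i y\<close>, the number \<open>a * N\<close> is the
  Hermitian form of \<open>W\<close> at \<open>f\<close>. Its imaginary part is the difference of
  the two mixed terms, zero by symmetry, and its real part is the sum of the forms at
  \<open>x\<close> and \<open>y\<close>.\<close>

lemma real_symmetric_psd_eigenvalue:
  fixes W :: "real mat"
  assumes W: "W \<in> carrier_mat p p"
    and sym: "\<And>i j. i < p \<Longrightarrow> j < p \<Longrightarrow> W $$ (i, j) = W $$ (j, i)"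
    and psd: "\<And>v. 0 \<le> (\<Sum>i<p. \<Sum>j<p. v i * W $$ (i, j) * v j)"
    and ev: "eigenvalue (map_mat complex_of_real W) a"
  shows "a = of_real (Re a)" "0 \<le> Re a"
proof -
  let ?W = "map_mat complex_of_real W"
  obtain v where v: "v \<in> carrier_vec p" "v \<noteq> 0\<^sub>v p" "?W *\<^sub>v v = a \<cdot>\<^sub>v v"
    using ev W by (auto simp: eigenvalue_def eigenvector_def)
  define f where "f i = vec_index v i" for i
  have Wv: "(\<Sum>j<p. of_real (W $$ (i, j)) * f j) = a * f i" if "i < p" for i
  proof -
    have "vec_index (?W *\<^sub>v v) i = (\<Sum>j<p. of_real (W $$ (i, j)) * f j)"
      using that W v(1) by (auto simp: scalar_prod_def f_def lessThan_atLeast0 intro!: sum.cong)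
    then show ?thesis using v that by (simp add: f_def)
  qed
  define N where "N = (\<Sum>i<p. (cmod (f i))\<^sup>2)"
  have N: "N > 0"
  proof -
    obtain i where i: "i < p" "f i \<noteq> 0"
      using v unfolding f_def by (metis carrier_vecD eq_vecI index_zero_vec(1) index_zero_vec(2))
    then have "0 < (cmod (f i))\<^sup>2" by simp
    also have "\<dots> \<le> N" unfolding N_def using i by (intro member_le_sum) auto
    finally show ?thesis .
  qed
  let ?S = "\<lambda>g h. (\<Sum>i<p. \<Sum>j<p. g i * W $$ (i, j) * h j)"
  define x where "x i = Re (f i)" for i
  define y where "y i = Im (f i)" for i
  have swap: "?S x y = ?S y x"
    by (subst sum.swap, intro sum.cong refl) (use sym in \<open>simp add: mult_ac\<close>)
  have "a * of_real N = (\<Sum>i<p. cnj (f i) * (a * f i))"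
    unfolding N_def by (simp add: sum_distrib_left complex_norm_square mult_ac del: of_real_power)
  also have "\<dots> = (\<Sum>i<p. \<Sum>j<p. cnj (f i) * (of_real (W $$ (i, j)) * f j))"
    by (intro sum.cong refl) (simp only: Wv lessThan_iff flip: sum_distrib_left)
  finally have eq: "a * of_real N = (\<Sum>i<p. \<Sum>j<p. cnj (f i) * (of_real (W $$ (i, j)) * f j))" .
  have re: "Re a * N = ?S x x + ?S y y"
  proof -
    have "Re a * N = Re (a * of_real N)" by simp
    also have "\<dots> = (\<Sum>i<p. \<Sum>j<p. x i * W $$ (i, j) * x j + y i * W $$ (i, j) * y j)"
      unfolding eq Re_sum by (intro sum.cong refl) (simp add: x_def y_def)
    finally show ?thesis by (simp only: sum.distrib)
  qed
  have "Im a * N = ?S x y - ?S y x"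
  proof -
    have "Im a * N = Im (a * of_real N)" by simp
    also have "\<dots> = (\<Sum>i<p. \<Sum>j<p. x i * W $$ (i, j) * y j - y i * W $$ (i, j) * x j)"
      unfolding eq Im_sum by (intro sum.cong refl) (simp add: x_def y_def)
    finally show ?thesis by (simp only: sum_subtractf)
  qed
  then have "Im a = 0" using swap N by simp
  then show "a = of_real (Re a)" by (simp add: complex_eq_iff)
  have "0 \<le> Re a * N" unfolding re using psd by (simp add: add_nonneg_nonneg)
  then show "0 \<le> Re a" using N by (simp add: zero_le_mult_iff)
qed

text \<open>The complex roots are real, so the characteristic polynomial splits over the reals and
  \<open>W\<close> is similar to a real triangular matrix with diagonal \<open>es\<close>. The trace
  of the inverse of \<open>W + t\<close> can then be read off that diagonal.\<close>

lemma real_symmetric_psd_spectrum: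
  fixes W :: "real mat"
  assumes W: "W \<in> carrier_mat p p"
    and sym: "\<And>i j. i < p \<Longrightarrow> j < p \<Longrightarrow> W $$ (i, j) = W $$ (j, i)"
    and psd: "\<And>v. 0 \<le> (\<Sum>i<p. \<Sum>j<p. v i * W $$ (i, j) * v j)"
  obtains es where "length es = p" "proots (char_poly W) = mset es" "\<And>e. e \<in> set es \<Longrightarrow> 0 \<le> e"
    "\<And>t Y. t > 0 \<Longrightarrow> Y \<in> carrier_mat p p \<Longrightarrow> (W + t \<cdot>\<^sub>m 1\<^sub>m p) * Y = 1\<^sub>m p \<Longrightarrow>
       (\<Sum>i<p. Y $$ (i, i)) = (\<Sum>e\<leftarrow>es. 1 / (e + t))"
proof -
  interpret poly_hom: map_poly_inj_idom_hom complex_of_real ..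
  let ?W = "map_mat complex_of_real W"
  have Wc: "?W \<in> carrier_mat p p" using W by simp
  obtain as where as: "char_poly ?W = (\<Prod>a\<leftarrow>as. [:- a, 1:])" "length as = p"
    using char_poly_factorized[OF Wc] by blast
  define es where "es = map Re as"
  have real: "a = of_real (Re a)" "0 \<le> Re a" if "a \<in> set as" for a
  proof -
    have "poly (char_poly ?W) a = 0"
      unfolding as poly_prod_list using that by (auto simp: prod_list_zero_iff)
    then have "eigenvalue ?W a" using eigenvalue_root_char_poly[OF Wc] by simp
    then show "a = of_real (Re a)" "0 \<le> Re a"
      using real_symmetric_psd_eigenvalue[OF W sym psd] by blast+
  qed
  have "map_poly complex_of_real (char_poly W) = (\<Prod>a\<leftarrow>as. [:- a, 1:])"
    using as of_real_hom.char_poly_hom[OF W, where 'a=complex] by simp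
  also have "\<dots> = (\<Prod>a\<leftarrow>as. map_poly of_real [:- Re a, 1:])"
    using real by (intro arg_cong[of _ _ prod_list] map_cong) auto
  also have "\<dots> = map_poly of_real (\<Prod>e\<leftarrow>es. [:- e, 1:])"
    unfolding es_def by (induction as) (simp_all add: poly_hom.hom_mult o_def del: mult_pCons_left)
  finally have cp: "char_poly W = (\<Prod>e\<leftarrow>es. [:- e, 1:])"
    by simp
  have len: "length es = p" using as by (simp add: es_def)
  have nn: "0 \<le> e" if "e \<in> set es" for e using that real by (auto simp: es_def)
  obtain B P Q where sd: "schur_decomposition W es = (B, P, Q)" by (cases "schur_decomposition W es")
  from schur_decomposition[OF W cp sd] have sim: "similar_mat_wit W B P Q"
    and ut: "upper_triangular B" and dg: "diag_mat B = es" by auto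
  note PQ = similar_mat_witD2[OF W sim]
  have B: "B \<in> carrier_mat p p" and P: "P \<in> carrier_mat p p" and Q: "Q \<in> carrier_mat p p"
    using PQ by auto
  have Bes: "B $$ (i, i) = es ! i" if "i < p" for i
    using dg B that by (auto simp: diag_mat_def)
  have "(\<Sum>i<p. Y $$ (i, i)) = (\<Sum>e\<leftarrow>es. 1 / (e + t))"
    if t: "t > 0" and Y: "Y \<in> carrier_mat p p" and inv: "(W + t \<cdot>\<^sub>m 1\<^sub>m p) * Y = 1\<^sub>m p" for t Y
  proof -
    let ?T = "t \<cdot>\<^sub>m 1\<^sub>m p :: real mat"
    have T: "?T \<in> carrier_mat p p" by simp
    have PTQ: "P * ?T * Q = ?T"
      using P Q PQ(1) mult_smult_distrib[OF P one_carrier_mat, of t] mult_smult_assoc_mat[OF P Q, of t]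
      by simp
    have WT: "W + ?T = P * (B + ?T) * Q"
    proof -
      have "P * (B + ?T) * Q = (P * B + P * ?T) * Q"
        using mult_add_distrib_mat[OF P B T] by simp
      also have "\<dots> = P * B * Q + P * ?T * Q"
        using P B T Q by (intro add_mult_distrib_mat) auto
      finally show ?thesis using PTQ PQ(3) by simp
    qed
    \<comment> \<open>The change of basis applied to \<open>Y\<close>: a right inverse of the
      triangular \<open>B + ?T\<close> with the same trace as \<open>Y\<close>.\<close>
    define Z where "Z = Q * Y * P"
    have Z: "Z \<in> carrier_mat p p" unfolding Z_def using P Q Y by auto
    have BT: "B + ?T \<in> carrier_mat p p" using B by auto
    have assoc: "Q * P * (C * (Q * Y * P)) = Q * (P * C * Q * Y) * P" if "C \<in> carrier_mat p p" for C
      using that Q Y P by (simp add: assoc_mult_mat[of _ p p _ p _ p] mult_carrier_mat[of _ p p _ p])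
    have "(B + ?T) * Z = (Q * P) * ((B + ?T) * (Q * Y * P))"
      unfolding PQ(2) Z_def[symmetric] using mult_carrier_mat[OF BT Z] by simp
    also have "\<dots> = Q * (P * (B + ?T) * Q * Y) * P"
      by (rule assoc[OF BT])
    also have "\<dots> = Q * P" unfolding WT[symmetric] inv using Q P by simp
    finally have BZ: "(B + ?T) * Z = 1\<^sub>m p" using PQ(2) by simp
    have d: "(B + ?T) $$ (i, i) = es ! i + t" if "i < p" for i
      using that B Bes by simp
    have pos: "es ! i + t > 0" if "i < p" for i
      using nn[of "es ! i"] that len t by (simp add: add_nonneg_pos)
    have ut': "upper_triangular (B + ?T)"
      using ut B by (auto simp: upper_triangular_def)
    have Zi: "Z $$ (i, i) = 1 / (es ! i + t)" if "i < p" for i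
    proof -
      have "Z $$ (i, i) = 1 / (B + ?T) $$ (i, i)"
        using d pos that
        by (intro upper_triangular_right_inverse_diag[OF BT Z ut' BZ]) (auto simp: less_imp_neq[symmetric] simp del: index_add_mat)
      then show ?thesis using d that by simp
    qed
    have "(\<Sum>i<p. Y $$ (i, i)) = (\<Sum>i<p. (Y * (P * Q)) $$ (i, i))"
      unfolding PQ(1) using Y by simp
    also have "Y * (P * Q) = (Y * P) * Q" using Y P Q by simp
    also have "(\<Sum>i<p. (Y * P * Q) $$ (i, i)) = (\<Sum>i<p. (Q * (Y * P)) $$ (i, i))"
      using Y P Q by (intro trace_mult_commute) auto
    also have "Q * (Y * P) = Z" unfolding Z_def using Y P Q by simp
    also have "(\<Sum>i<p. Z $$ (i, i)) = (\<Sum>e\<leftarrow>es. 1 / (e + t))"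
      using Zi by (simp add: sum_list_sum_nth len lessThan_atLeast0)
    finally show ?thesis .
  qed
  moreover have "proots (char_poly W) = mset es" by (simp only: cp proots_linear_factors)
  ultimately show ?thesis using len nn by (intro that)
qed

section \<open>Covariances of products of tensor entries\<close>

lemma finite_dsubsets [simp, intro]: "finite (dsubsets n d)"
  unfolding dsubsets_def by (rule finite_subset[of _ "Pow {..<n}"]) auto

lemma card_dsubsets: "card (dsubsets n d) = n choose d"
  unfolding dsubsets_def using n_subsets[of "{..<n}" d] by simp

lemma finite_dsubsetsD: "I \<in> dsubsets n d \<Longrightarrow> finite I"
  unfolding dsubsets_def by (auto intro: finite_subset)

text \<open>The exponent of the coordinate \<open>i\<close> in the product of the four tensor
  entries indexed by \<open>I\<close>, \<open>J\<close>, \<open>K\<close>, \<open>L\<close>.\<close>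

definition multiplicity4 :: "nat set \<Rightarrow> nat set \<Rightarrow> nat set \<Rightarrow> nat set \<Rightarrow> nat \<Rightarrow> nat" where
  "multiplicity4 I J K L i = of_bool (i \<in> I) + of_bool (i \<in> J) + of_bool (i \<in> K) + of_bool (i \<in> L)"

text \<open>Bounds \<open>\<bar>E X\<^sup>r\<bar>\<close> for \<open>r \<le> 4\<close> and centred \<open>X\<close> with unit variance and fourth moment at most \<open>C\<close>.\<close>

definition moment_bound :: "real \<Rightarrow> nat \<Rightarrow> real" where
  "moment_bound C r = (if r = 1 then 0 else if r \<le> 2 then 1 else C)"

lemma sum_Pow_insert:
  assumes "finite S" "a \<notin> S"
  shows "(\<Sum>P\<in>Pow (insert a S). f P) = (\<Sum>P\<in>Pow S. f P) + (\<Sum>P\<in>Pow S. f (insert a P))"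
proof -
  have "inj_on (insert a) (Pow S)"
    using assms(2) by (auto simp: inj_on_def)
  then show ?thesis unfolding Pow_insert
    using assms by (subst sum.union_disjoint) (auto simp: sum.reindex)
qed

text \<open>Distributivity: choosing \<open>P\<close> and \<open>Q\<close> amounts to choosing,
  independently for each element, one of the four membership patterns.\<close>

lemma sum_Pow_Pow_prod:
  fixes h :: "'i \<Rightarrow> bool \<Rightarrow> bool \<Rightarrow> 'a::comm_semiring_1"
  assumes "finite S"
  shows "(\<Sum>P\<in>Pow S. \<Sum>Q\<in>Pow S. \<Prod>i\<in>S. h i (i \<in> P) (i \<in> Q))
    = (\<Prod>i\<in>S. h i False False + h i False True + h i True False + h i True True)"
  using assms
proof (induction S)
  case (insert a S)
  let ?w = "\<lambda>P Q. \<Prod>i\<in>S. h i (i \<in> P) (i \<in> Q)"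
  have w: "(\<Prod>i\<in>insert a S. h i (i \<in> P) (i \<in> Q)) = h a (a \<in> P) (a \<in> Q) * ?w P Q" for P Q
    using insert by simp
  have w1: "?w (insert a P) Q = ?w P Q" "?w P (insert a Q) = ?w P Q" for P Q
  proof -
    have "(i \<in> insert a P) = (i \<in> P)" if "i \<in> S" for i P using that insert by auto
    then show "?w (insert a P) Q = ?w P Q" "?w P (insert a Q) = ?w P Q" by simp_all
  qed
  have no: "a \<notin> P" if "P \<in> Pow S" for P using that insert by auto
  have "(\<Sum>P\<in>Pow (insert a S). \<Sum>Q\<in>Pow (insert a S). \<Prod>i\<in>insert a S. h i (i \<in> P) (i \<in> Q))
      = (\<Sum>P\<in>Pow S. \<Sum>Q\<in>Pow S. (h a False False + h a False True + h a True False + h a True True) * ?w P Q)"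
    unfolding w sum_Pow_insert[OF insert.hyps] sum.distrib[symmetric]
    by (intro sum.cong refl) (simp only: w1, simp add: no algebra_simps)
  then show ?case
    unfolding sum_distrib_left[symmetric] insert.IH using insert by simp
qed simp

text \<open>Consecutive binomials have ratio \<open>(k + 1) / (n - k)\<close>, at most
  \<open>d / (n - d + 1)\<close> as long as \<open>k < d\<close>.\<close>

lemma binomial_decrease:
  assumes "j \<le> d" "d \<le> n"
  shows "real (n choose (d - j)) \<le> real (n choose d) * (real d / real (n - d + 1)) ^ j"
  using assms(1)
proof (induction j)
  case (Suc j)
  define k where "k = d - Suc j"
  have k: "d - j = Suc k" "k < n" "Suc k \<le> d" "n - d + 1 \<le> n - k" using Suc.prems assms by (auto simp: k_def)
  have "(n - k) * (n choose k) = Suc k * (n choose Suc k)"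
    by (simp only: binomial_absorb_comp binomial_absorption)
  then have "real (n - k) * real (n choose k) = real (Suc k) * real (n choose Suc k)"
    by (metis of_nat_mult)
  then have "real (n choose k) = real (n choose Suc k) * (real (Suc k) / real (n - k))"
    using k by (simp add: field_simps)
  also have "\<dots> \<le> real (n choose Suc k) * (real d / real (n - d + 1))"
    using k by (intro mult_left_mono frac_le) (auto simp del: of_nat_Suc of_nat_diff)
  also have "\<dots> \<le> real (n choose d) * (real d / real (n - d + 1)) ^ j * (real d / real (n - d + 1))"
    using Suc k by (intro mult_right_mono) auto
  finally show ?case by (simp add: k_def mult_ac)
qed simp

text \<open>The common part outside \<open>S\<close> determines both sets and has
  \<open>d - card P\<close> elements. A single such pair forces \<open>card P = card Q\<close>, so
  \<open>\<tau>^2\<close> per element of \<open>P\<close> may be rewritten as \<open>\<tau>\<close>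
  per element of \<open>P\<close> and of \<open>Q\<close>; if there is no pair, the bound is
  trivial.\<close>

lemma card_paired_subsets:
  assumes d: "d \<le> n" and tau: "\<tau> = sqrt (real d / real (n - d + 1))"
  shows "real (card {(K, L) \<in> dsubsets n d \<times> dsubsets n d. K \<inter> S = P \<and> L \<inter> S = Q \<and> K - S = L - S})
    \<le> real (n choose d) * \<tau> ^ (card P + card Q)" (is "real (card ?X) \<le> _")
proof (cases "?X = {}")
  case True
  have "\<tau> \<ge> 0" by (simp add: tau)
  then show ?thesis unfolding True by simp
next
  case False
  have cd: "card (K - S) = d - card P \<and> card P \<le> d" if "K \<in> dsubsets n d" "K \<inter> S = P" for K P
  proof -
    have "finite K" "card K = d" using finite_dsubsetsD[OF that(1)] that(1) by (simp_all add: dsubsets_def)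
    moreover have "K - S = K - P" "P \<subseteq> K" using that by auto
    ultimately show ?thesis
      using card_Diff_subset[OF finite_subset, of P K] card_mono[of K P] by auto
  qed
  from False obtain K L where KL: "K \<in> dsubsets n d" "L \<in> dsubsets n d" "K \<inter> S = P" "L \<inter> S = Q" "K - S = L - S"
    by auto
  have eq: "card Q = card P" "card P \<le> d" using cd[OF KL(1,3)] cd[OF KL(2,4)] KL(5) by auto
  have "inj_on (\<lambda>(K, L). K - S) ?X"
  proof (rule inj_onI)
    fix X Y assume XY: "X \<in> ?X" "Y \<in> ?X" and eq: "(\<lambda>(K, L). K - S) X = (\<lambda>(K, L). K - S) Y"
    obtain K L K' L' where [simp]: "X = (K, L)" "Y = (K', L')" by (metis surj_pair)
    have "K \<inter> S = K' \<inter> S" "L \<inter> S = L' \<inter> S" "K - S = K' - S" "L - S = L' - S"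
      using XY eq by auto
    then show "X = Y" by simp (metis Int_Diff_Un)
  qed
  then have "card ?X = card ((\<lambda>(K, L). K - S) ` ?X)" by (simp add: card_image)
  also have "\<dots> \<le> card (dsubsets n (d - card P))"
    using cd by (intro card_mono) (auto simp: dsubsets_def)
  finally have "card ?X \<le> n choose (d - card P)" by (simp add: card_dsubsets)
  then have "real (card ?X) \<le> real (n choose (d - card P))" by simp
  also have "\<dots> \<le> real (n choose d) * (real d / real (n - d + 1)) ^ card P"
    by (rule binomial_decrease[OF eq(2) d])
  also have "real d / real (n - d + 1) = \<tau>\<^sup>2" by (simp add: tau)
  also have "(\<tau>\<^sup>2) ^ card P = \<tau> ^ (card P + card Q)" by (simp add: eq power_mult[symmetric] mult_2)
  finally show ?thesis .
qed

text \<open>Outside \<open>S\<close> an index lying in exactly one of \<open>K\<close>,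
  \<open>L\<close> has multiplicity one and kills the product, and every other index contributes 1.
  Inside \<open>S\<close> the product depends only on the traces, so the fibre is its cardinality
  times one weight.\<close>

lemma sum_moment_bound_fibre:
  assumes d: "d \<le> n" and tau: "\<tau> = sqrt (real d / real (n - d + 1))" and C: "C \<ge> 1"
    and IJ: "I \<in> dsubsets n d" "J \<in> dsubsets n d" and S: "S = I \<union> J"
    and PQ: "P \<subseteq> S" "Q \<subseteq> S"
  shows "(\<Sum>(K, L) \<in> {(K, L) \<in> dsubsets n d \<times> dsubsets n d. K \<inter> S = P \<and> L \<inter> S = Q}.
            \<Prod>i<n. moment_bound C (multiplicity4 I J K L i))
    \<le> real (n choose d) * (\<Prod>i\<in>S. \<tau> ^ (of_bool (i \<in> P) + of_bool (i \<in> Q)) * moment_bound C (multiplicity4 I J P Q i))"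
    (is "(\<Sum>(K, L)\<in>?X. ?G K L) \<le> _")
proof -
  have finS: "finite S" and Sn: "S \<subseteq> {..<n}"
    using IJ finite_dsubsetsD[OF IJ(1)] finite_dsubsetsD[OF IJ(2)] by (auto simp: S dsubsets_def)
  let ?w = "\<Prod>i\<in>S. moment_bound C (multiplicity4 I J P Q i)"
  have w0: "?w \<ge> 0" using C by (intro prod_nonneg) (auto simp: moment_bound_def)
  have t0: "\<tau> \<ge> 0" by (simp add: tau)
  have G: "?G K L = (if K - S = L - S then ?w else 0)" if "(K, L) \<in> ?X" for K L
  proof -
    have KL: "K \<inter> S = P" "L \<inter> S = Q" "K \<subseteq> {..<n}" "L \<subseteq> {..<n}" using that by (auto simp: dsubsets_def)
    have "?G K L = (\<Prod>i\<in>S. moment_bound C (multiplicity4 I J K L i))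
        * (\<Prod>i\<in>{..<n} - S. moment_bound C (multiplicity4 I J K L i))"
      using Sn by (subst prod.subset_diff[of S]) (auto simp: mult_ac)
    also have "(\<Prod>i\<in>S. moment_bound C (multiplicity4 I J K L i)) = ?w"
      using KL by (intro prod.cong refl arg_cong[of _ _ "moment_bound C"]) (auto simp: multiplicity4_def)
    also have "(\<Prod>i\<in>{..<n} - S. moment_bound C (multiplicity4 I J K L i)) = (if K - S = L - S then 1 else 0)"
    proof (cases "K - S = L - S")
      case True
      have "moment_bound C (multiplicity4 I J K L i) = 1" if "i \<in> {..<n} - S" for i
      proof -
        have "i \<in> K \<longleftrightarrow> i \<in> L" using True that by blast
        then show ?thesis using that by (auto simp: multiplicity4_def moment_bound_def S)
      qed
      then show ?thesis using True by simp
    next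
      case False
      then obtain i where i: "i \<notin> S" "(i \<in> K) \<noteq> (i \<in> L)" by blast
      then have "i \<in> {..<n} - S" using KL by auto
      moreover have "moment_bound C (multiplicity4 I J K L i) = 0"
        using i by (auto simp: multiplicity4_def moment_bound_def S)
      ultimately have "\<exists>i\<in>{..<n} - S. moment_bound C (multiplicity4 I J K L i) = 0" by blast
      then show ?thesis using False by (simp add: prod_zero)
    qed
    finally show ?thesis by simp
  qed
  have finX: "finite ?X" by (rule finite_subset[of _ "dsubsets n d \<times> dsubsets n d"]) auto
  have "(\<Sum>(K, L)\<in>?X. ?G K L) = (\<Sum>(K, L)\<in>?X. if K - S = L - S then ?w else 0)"
    using G by (intro sum.cong) auto
  also have "\<dots> = (\<Sum>(K, L)\<in>{(K, L) \<in> ?X. K - S = L - S}. ?w)"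
    using finX by (intro sum.mono_neutral_cong_right) (auto split: if_splits)
  also have "{(K, L) \<in> ?X. K - S = L - S} = {(K, L) \<in> dsubsets n d \<times> dsubsets n d. K \<inter> S = P \<and> L \<inter> S = Q \<and> K - S = L - S}"
    by auto
  also have "(\<Sum>(K, L)\<in>\<dots>. ?w) = real (card \<dots>) * ?w"
    by (simp add: case_prod_unfold)
  also have "\<dots> \<le> real (n choose d) * \<tau> ^ (card P + card Q) * ?w"
    by (intro mult_right_mono[OF _ w0] card_paired_subsets d tau)
  also have "\<tau> ^ (card P + card Q) = (\<Prod>i\<in>S. \<tau> ^ (of_bool (i \<in> P) + of_bool (i \<in> Q)))"
  proof -
    have *: "(\<Prod>i\<in>S. \<tau> ^ of_bool (i \<in> P)) = \<tau> ^ card P" if "P \<subseteq> S" for P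
    proof -
      have "(\<Prod>i\<in>S. \<tau> ^ of_bool (i \<in> P)) = (\<Prod>i\<in>P. \<tau>)"
        using finS that by (intro prod.mono_neutral_cong_right) auto
      then show ?thesis by simp
    qed
    show ?thesis by (simp add: power_add prod.distrib * PQ)
  qed
  finally show ?thesis by (simp add: prod.distrib mult_ac)
qed

lemma sum_moment_bound:
  assumes d: "d \<le> n" and tau: "\<tau> = sqrt (real d / real (n - d + 1))" and C: "C \<ge> 1"
    and IJ: "I \<in> dsubsets n d" "J \<in> dsubsets n d" and S: "S = I \<union> J"
    and F: "F \<subseteq> Pow S \<times> Pow S"
  shows "(\<Sum>(K, L) \<in> {(K, L) \<in> dsubsets n d \<times> dsubsets n d. (K \<inter> S, L \<inter> S) \<in> F}.
            \<Prod>i<n. moment_bound C (multiplicity4 I J K L i))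
    \<le> real (n choose d) * (\<Sum>(P, Q)\<in>F. \<Prod>i\<in>S. \<tau> ^ (of_bool (i \<in> P) + of_bool (i \<in> Q))
          * moment_bound C (multiplicity4 I J P Q i))"
    (is "(\<Sum>(K, L)\<in>?X. ?G K L) \<le> _")
proof -
  have finS: "finite S" using finite_dsubsetsD[OF IJ(1)] finite_dsubsetsD[OF IJ(2)] by (simp add: S)
  have finF: "finite F" by (rule finite_subset[OF F]) (simp add: finS)
  have finX: "finite ?X" by (rule finite_subset[of _ "dsubsets n d \<times> dsubsets n d"]) auto
  have "(\<Sum>(K, L)\<in>?X. ?G K L)
      = (\<Sum>PQ\<in>F. \<Sum>KL\<in>{KL \<in> ?X. (\<lambda>(K, L). (K \<inter> S, L \<inter> S)) KL = PQ}. (\<lambda>(K, L). ?G K L) KL)"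
    using finX finF by (intro sum.group[symmetric]) auto
  also have "\<dots> \<le> (\<Sum>PQ\<in>F. real (n choose d) * (case PQ of (P, Q) \<Rightarrow> \<Prod>i\<in>S. \<tau> ^ (of_bool (i \<in> P) + of_bool (i \<in> Q))
          * moment_bound C (multiplicity4 I J P Q i)))"
  proof (intro sum_mono, clarify)
    fix P Q assume PQ: "(P, Q) \<in> F"
    have eq: "{KL \<in> ?X. (\<lambda>(K, L). (K \<inter> S, L \<inter> S)) KL = (P, Q)}
        = {(K, L) \<in> dsubsets n d \<times> dsubsets n d. K \<inter> S = P \<and> L \<inter> S = Q}"
      using PQ by auto
    show "(\<Sum>KL\<in>{KL \<in> ?X. (\<lambda>(K, L). (K \<inter> S, L \<inter> S)) KL = (P, Q)}. (\<lambda>(K, L). ?G K L) KL)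
       \<le> real (n choose d) * (\<Prod>i\<in>S. \<tau> ^ (of_bool (i \<in> P) + of_bool (i \<in> Q)) * moment_bound C (multiplicity4 I J P Q i))"
      unfolding eq using F PQ by (intro sum_moment_bound_fibre d tau C IJ S) auto
  qed
  finally show ?thesis by (simp add: sum_distrib_left case_prod_unfold)
qed

text \<open>The sum factors over the elements of \<open>S\<close>. An element of
  \<open>I \<inter> J\<close> has base multiplicity 2 and its four patterns give at most
  \<open>1 + 2 * C * \<tau> + C * \<tau>^2\<close>. An element of only one set has base multiplicity
  1, so its first pattern gives 0 and the others \<open>2 * \<tau> + C * \<tau>^2\<close>.\<close>

lemma prod_local_weights:
  assumes tau: "0 \<le> \<tau>" "\<tau> \<le> 1" and C: "C \<ge> 1" and S: "S = I \<union> J" "finite S"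
  shows "(\<Sum>(P, Q)\<in>Pow S \<times> Pow S. \<Prod>i\<in>S. \<tau> ^ (of_bool (i \<in> P) + of_bool (i \<in> Q))
          * moment_bound C (multiplicity4 I J P Q i))
    \<le> (1 + 3 * C * \<tau>) ^ card (I \<inter> J) * (3 * C * \<tau>) ^ card (S - I \<inter> J)"
proof -
  define h where "h i b c = \<tau> ^ (of_bool b + of_bool c)
    * moment_bound C (of_bool (i \<in> I) + of_bool (i \<in> J) + of_bool b + of_bool c)" for i b c
  have tt: "\<tau> * \<tau> \<le> \<tau>" using tau mult_left_le[of \<tau> \<tau>] by simp
  have tC: "\<tau> \<le> C * \<tau>" using mult_right_mono[OF C tau(1)] by simp
  have Ctt: "C * (\<tau> * \<tau>) \<le> C * \<tau>" using tt C by (intro mult_left_mono) auto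
  have "(\<Sum>(P, Q)\<in>Pow S \<times> Pow S. \<Prod>i\<in>S. \<tau> ^ (of_bool (i \<in> P) + of_bool (i \<in> Q))
          * moment_bound C (multiplicity4 I J P Q i))
      = (\<Sum>P\<in>Pow S. \<Sum>Q\<in>Pow S. \<Prod>i\<in>S. h i (i \<in> P) (i \<in> Q))"
    using S by (simp add: sum.cartesian_product h_def multiplicity4_def)
  also have "\<dots> = (\<Prod>i\<in>S. h i False False + h i False True + h i True False + h i True True)"
    by (rule sum_Pow_Pow_prod[OF S(2)])
  also have "\<dots> \<le> (\<Prod>i\<in>S. if i \<in> I \<inter> J then 1 + 3 * C * \<tau> else 3 * C * \<tau>)"
  proof (rule prod_mono, intro conjI)
    fix i assume i: "i \<in> S"
    show "0 \<le> h i False False + h i False True + h i True False + h i True True"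
      using tau C by (auto simp: h_def moment_bound_def)
    show "h i False False + h i False True + h i True False + h i True True
       \<le> (if i \<in> I \<inter> J then 1 + 3 * C * \<tau> else 3 * C * \<tau>)"
      using i S tC Ctt by (auto simp: h_def moment_bound_def algebra_simps)
  qed
  also have "\<dots> = (\<Prod>i\<in>I \<inter> J. 1 + 3 * C * \<tau>) * (\<Prod>i\<in>S - I \<inter> J. 3 * C * \<tau>)"
  proof -
    have "S \<inter> {i. i \<in> I \<inter> J} = I \<inter> J" "S \<inter> - {i. i \<in> I \<inter> J} = S - I \<inter> J" using S by auto
    then show ?thesis by (simp only: prod.If_cases[OF S(2)])
  qed
  finally show ?thesis by simp
qed

lemma power_one_plus_le:
  fixes u :: real assumes "u \<ge> 0"
  shows "(1 + u) ^ d - 1 \<le> d * u * (1 + u) ^ d"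
proof (induction d)
  case (Suc d)
  have "(1 + u) ^ Suc d - 1 = ((1 + u) ^ d - 1) * (1 + u) + u" by (simp add: algebra_simps)
  also have "\<dots> \<le> d * u * (1 + u) ^ d * (1 + u) + u * (1 + u) ^ Suc d"
    using Suc assms one_le_power[of "1 + u" "Suc d"]
    by (intro add_mono mult_right_mono) (auto simp: mult_le_cancel_left1 simp del: power_Suc)
  finally show ?case by (simp add: algebra_simps)
qed simp

text \<open>For \<open>I \<noteq> J\<close> some element lies in only one of the sets and supplies a
  factor \<open>u\<close>. For \<open>I = J\<close> a pair \<open>K\<close>, \<open>L\<close>
  disjoint from \<open>I\<close> has covariance 0, either because \<open>K = L\<close> makes the
  product of moments 1, or because an index of multiplicity one makes it 0. What remains is
  \<open>(1 + u) ^ d - 1\<close>.\<close>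

lemma sum_covariance_bound:
  fixes \<mu> :: "nat \<Rightarrow> nat \<Rightarrow> real"
  assumes d: "d > 0" "d \<le> n" and tau: "\<tau> = sqrt (real d / real (n - d + 1))" "\<tau> \<le> 1"
    and C: "C \<ge> 1" and u: "u = 3 * C * \<tau>" "u \<le> 1"
    and mu: "\<And>i. i < n \<Longrightarrow> \<mu> i 0 = 1" "\<And>i. i < n \<Longrightarrow> \<mu> i 1 = 0" "\<And>i. i < n \<Longrightarrow> \<mu> i 2 = 1"
      "\<And>i. i < n \<Longrightarrow> \<bar>\<mu> i 3\<bar> \<le> C" "\<And>i. i < n \<Longrightarrow> 1 \<le> \<mu> i 4" "\<And>i. i < n \<Longrightarrow> \<mu> i 4 \<le> C"
    and IJ: "I \<in> dsubsets n d" "J \<in> dsubsets n d"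
  shows "(\<Sum>K\<in>dsubsets n d. \<Sum>L\<in>dsubsets n d.
      \<bar>(\<Prod>i<n. \<mu> i (multiplicity4 I J K L i)) - of_bool (I = J) * of_bool (K = L)\<bar>)
    \<le> real (n choose d) * (d * u * (1 + u) ^ d)"
proof -
  let ?D = "dsubsets n d" and ?S = "I \<union> J"
  let ?E = "\<lambda>K L. \<Prod>i<n. \<mu> i (multiplicity4 I J K L i)"
  let ?G = "\<lambda>K L. \<Prod>i<n. moment_bound C (multiplicity4 I J K L i)"
  let ?cov = "\<lambda>K L. ?E K L - of_bool (I = J) * of_bool (K = L)"
  let ?w = "\<lambda>P Q. \<Prod>i\<in>?S. \<tau> ^ (of_bool (i \<in> P) + of_bool (i \<in> Q)) * moment_bound C (multiplicity4 I J P Q i)"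
  have fin: "finite ?S" using finite_dsubsetsD[OF IJ(1)] finite_dsubsetsD[OF IJ(2)] by simp
  have t0: "\<tau> \<ge> 0" by (simp add: tau)
  have u0: "u \<ge> 0" using u C t0 by simp
  have mult: "multiplicity4 I J K L i \<in> {0, 1, 2, 3, 4}" for K L i
    by (auto simp: multiplicity4_def)
  have mb: "\<bar>\<mu> i r\<bar> \<le> moment_bound C r" if "i < n" "r \<in> {0, 1, 2, 3, 4}" for i r
  proof -
    have "\<bar>\<mu> i 4\<bar> \<le> C" using mu(5,6)[OF that(1)] by simp
    then show ?thesis using that(2) mu(1-4)[OF that(1)] by (auto simp: moment_bound_def)
  qed
  have EG: "\<bar>?E K L\<bar> \<le> ?G K L" for K L
    unfolding abs_prod using mb mult by (intro prod_mono) auto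
  \<comment> \<open>When 1 is subtracted, all multiplicities are 0, 2 or 4; the corresponding
    moments are at least 1, so subtracting does not increase the absolute value.\<close>
  have covG: "\<bar>?cov K L\<bar> \<le> ?G K L" if "K \<in> ?D" "L \<in> ?D" for K L
  proof (cases "I = J \<and> K = L")
    case True
    have "1 \<le> ?E K L"
    proof (rule prod_ge_1)
      fix i assume "i \<in> {..<n}"
      then show "1 \<le> \<mu> i (multiplicity4 I J K L i)"
        using True mu(1,3,5)[of i] by (auto simp: multiplicity4_def numeral_2_eq_2 eval_nat_numeral)
    qed
    then show ?thesis using EG[of K L] True by simp
  next
    case False
    then show ?thesis using EG[of K L] by auto
  qed
  show ?thesis
  proof (cases "I = J")
    case False
    have nz: "card (?S - I \<inter> J) \<ge> 1"
    proof -
      have "?S - I \<inter> J \<noteq> {}" using False by blast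
      then show ?thesis using fin by (simp add: Suc_le_eq card_gt_0_iff)
    qed
    have "(\<Sum>K\<in>?D. \<Sum>L\<in>?D. \<bar>?cov K L\<bar>) \<le> (\<Sum>K\<in>?D. \<Sum>L\<in>?D. ?G K L)"
      using covG by (intro sum_mono) auto
    also have "\<dots> = (\<Sum>(K, L) \<in> {(K, L) \<in> ?D \<times> ?D. (K \<inter> ?S, L \<inter> ?S) \<in> Pow ?S \<times> Pow ?S}. ?G K L)"
      unfolding sum.cartesian_product by (intro sum.cong) auto
    also have "\<dots> \<le> real (n choose d) * (\<Sum>(P, Q)\<in>Pow ?S \<times> Pow ?S. ?w P Q)"
      by (rule sum_moment_bound[OF d(2) tau(1) C IJ refl subset_refl])
    also have "\<dots> \<le> real (n choose d) * ((1 + u) ^ card (I \<inter> J) * u ^ card (?S - I \<inter> J))"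
      unfolding u(1) by (intro mult_left_mono prod_local_weights t0 tau C refl fin) auto
    also have "\<dots> \<le> real (n choose d) * ((1 + u) ^ d * u)"
    proof (intro mult_left_mono mult_mono)
      have "card (I \<inter> J) \<le> d"
        using card_mono[OF finite_dsubsetsD[OF IJ(1)], of "I \<inter> J"] IJ by (simp add: dsubsets_def)
      then show "(1 + u) ^ card (I \<inter> J) \<le> (1 + u) ^ d" using u0 by (intro power_increasing) auto
      show "u ^ card (?S - I \<inter> J) \<le> u" using power_decreasing[OF nz u0 u(2)] by simp
    qed (use u0 in auto)
    also have "\<dots> \<le> real (n choose d) * (d * u * (1 + u) ^ d)"
    proof (intro mult_left_mono)
      have "1 * (u * (1 + u) ^ d) \<le> real d * (u * (1 + u) ^ d)"
        using d u0 by (intro mult_right_mono) auto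
      then show "(1 + u) ^ d * u \<le> d * u * (1 + u) ^ d" by (simp add: mult_ac)
    qed simp
    finally show ?thesis .
  next
    case True
    let ?F = "Pow ?S \<times> Pow ?S - {({}, {})}"
    have cov0: "?cov K L = 0" if KL: "K \<in> ?D" "L \<in> ?D" "(K \<inter> ?S, L \<inter> ?S) \<notin> ?F" for K L
    proof -
      have dis: "K \<inter> I = {}" "L \<inter> I = {}" using KL True by auto
      show ?thesis
      proof (cases "K = L")
        case eq: True
        have "\<mu> i (multiplicity4 I J K L i) = 1" if "i < n" for i
          using mu(1,3)[OF that] dis eq True by (auto simp: multiplicity4_def numeral_2_eq_2)
        then show ?thesis using eq True by simp
      next
        case neq: False
        then obtain i where i: "(i \<in> K) \<noteq> (i \<in> L)" by blast
        then have "i < n" "i \<notin> I" using KL dis by (auto simp: dsubsets_def)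
        moreover from this have "\<mu> i (multiplicity4 I J K L i) = 0"
          using mu(2)[of i] i True by (auto simp: multiplicity4_def)
        ultimately have "?E K L = 0" by (intro prod_zero) auto
        then show ?thesis using neq by simp
      qed
    qed
    \<comment> \<open>The excluded pair of empty traces has weight exactly 1, which is the constant
      term of \<open>(1 + u) ^ d\<close>.\<close>
    have w0: "?w {} {} = 1" using True by (auto simp: multiplicity4_def moment_bound_def intro!: prod.neutral)
    have "(\<Sum>K\<in>?D. \<Sum>L\<in>?D. \<bar>?cov K L\<bar>)
        = (\<Sum>(K, L) \<in> {(K, L) \<in> ?D \<times> ?D. (K \<inter> ?S, L \<inter> ?S) \<in> ?F}. \<bar>?cov K L\<bar>)"
      unfolding sum.cartesian_product using cov0 by (intro sum.mono_neutral_right) auto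
    also have "\<dots> \<le> (\<Sum>(K, L) \<in> {(K, L) \<in> ?D \<times> ?D. (K \<inter> ?S, L \<inter> ?S) \<in> ?F}. ?G K L)"
    proof (rule sum_mono)
      fix KL assume "KL \<in> {(K, L) \<in> ?D \<times> ?D. (K \<inter> ?S, L \<inter> ?S) \<in> ?F}"
      then obtain K L where KL: "KL = (K, L)" "K \<in> ?D" "L \<in> ?D" by blast
      show "(case KL of (K, L) \<Rightarrow> \<bar>?cov K L\<bar>) \<le> (case KL of (K, L) \<Rightarrow> ?G K L)"
        unfolding KL(1) prod.case by (rule covG[OF KL(2,3)])
    qed
    also have "\<dots> \<le> real (n choose d) * (\<Sum>(P, Q)\<in>?F. ?w P Q)"
      by (rule sum_moment_bound[OF d(2) tau(1) C IJ refl]) auto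
    also have "(\<Sum>(P, Q)\<in>?F. ?w P Q) = (\<Sum>(P, Q)\<in>Pow ?S \<times> Pow ?S. ?w P Q) - 1"
      using fin w0 by (subst sum_diff1) auto
    also have "real (n choose d) * \<dots> \<le> real (n choose d) * ((1 + u) ^ card (I \<inter> J) * u ^ card (?S - I \<inter> J) - 1)"
      unfolding u(1) by (intro mult_left_mono diff_right_mono prod_local_weights t0 tau C refl fin) auto
    also have "\<dots> = real (n choose d) * ((1 + u) ^ d - 1)" using True IJ by (simp add: dsubsets_def)
    also have "\<dots> \<le> real (n choose d) * (d * u * (1 + u) ^ d)"
      using power_one_plus_le[OF u0] by (intro mult_left_mono) auto
    finally show ?thesis .
  qed
qed

section \<open>The bounded-difference inequality\<close>

text \<open>For a centred variable the linear term integrates to 0, which leaves a sub-Gaussian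
  bound. This takes the place of Hoeffding's lemma, with a larger constant.\<close>

lemma exp_le_linear_plus_exp_square: "exp y \<le> y + exp (y\<^sup>2)" for y :: real
proof -
  have sq: "1 + y\<^sup>2 \<le> exp (y\<^sup>2)" by (rule exp_ge_add_one_self)
  consider "y > 1" | "0 \<le> y" "y \<le> 1" | "-1 \<le> y" "y < 0" | "y < -1" by linarith
  then show ?thesis
  proof cases
    case 1
    then have "y \<le> y\<^sup>2" by (simp add: power2_eq_square)
    then have "exp y \<le> exp (y\<^sup>2)" by simp
    then show ?thesis using 1 by linarith
  next
    case 2
    then have "exp y \<le> 1 + y + y\<^sup>2" by (intro exp_bound)
    then show ?thesis using sq by linarith
  next
    \<comment> \<open>For \<open>u = - y\<close> the claim becomes
      \<open>1 / (1 + u + u^2 / 2) \<le> 1 - u + u^2\<close>: the product of the two polynomials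
      exceeds 1 by a polynomial with nonnegative coefficients.\<close>
    case 3
    define u where "u = - y"
    have u: "0 \<le> u" "u \<le> 1" using 3 by (auto simp: u_def)
    have "1 + u + u\<^sup>2 / 2 \<le> exp u" by (rule exp_lower_Taylor_quadratic[OF u(1)])
    then have "1 / exp u \<le> 1 / (1 + u + u\<^sup>2 / 2)"
      using u by (intro divide_left_mono mult_pos_pos) (auto intro: add_pos_nonneg)
    also have "\<dots> \<le> 1 - u + u\<^sup>2"
    proof -
      have "(1 - u + u\<^sup>2) * (1 + u + u\<^sup>2 / 2) = 1 + (u\<^sup>2 + u^3 + u^4) / 2"
        by (simp add: field_simps power2_eq_square eval_nat_numeral)
      moreover have "(u\<^sup>2 + u^3 + u^4) / 2 \<ge> 0" using u by simp
      ultimately have "1 \<le> (1 - u + u\<^sup>2) * (1 + u + u\<^sup>2 / 2)" by linarith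
      moreover have "1 + u + u\<^sup>2 / 2 > 0" using u by (simp add: add_pos_nonneg)
      ultimately show ?thesis by (simp add: divide_le_eq)
    qed
    finally have "exp y \<le> 1 + y + y\<^sup>2" by (simp add: u_def exp_minus field_simps)
    then show ?thesis using sq by linarith
  next
    case 4
    then have "1 * (- y) \<le> (- y) * (- y)" by (intro mult_right_mono) auto
    then have "- y \<le> y\<^sup>2" by (simp add: power2_eq_square)
    moreover have "exp y \<le> 1" using 4 by simp
    ultimately show ?thesis using sq by linarith
  qed
qed

text \<open>Oscillation at most \<open>c\<close> keeps \<open>f\<close> within \<open>c\<close> of
  its mean, since the mean is an average of values of \<open>f\<close>.\<close>

lemma (in prob_space) centered_mgf_bound:
  fixes f :: "'a \<Rightarrow> real"
  assumes f: "f \<in> borel_measurable M" "\<And>x y. x \<in> space M \<Longrightarrow> y \<in> space M \<Longrightarrow> \<bar>f x - f y\<bar> \<le> c"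
    and b: "\<And>x. x \<in> space M \<Longrightarrow> \<bar>f x\<bar> \<le> B"
  shows "(\<integral>x. exp (l * (f x - expectation f)) \<partial>M) \<le> exp (l\<^sup>2 * c\<^sup>2)"
proof -
  have intf: "integrable M f" using f b by (intro integrable_const_bound[of _ B]) auto
  have dev: "\<bar>f x - expectation f\<bar> \<le> c" if x: "x \<in> space M" for x
  proof -
    have "f x - expectation f = (\<integral>y. f x - f y \<partial>M)" using intf by (simp add: prob_space)
    also have "\<bar>\<dots>\<bar> \<le> (\<integral>y. \<bar>f x - f y\<bar> \<partial>M)" by (rule integral_abs_bound)
    also have "\<dots> \<le> (\<integral>y. c \<partial>M)" using intf f x by (intro integral_mono) auto
    finally show ?thesis by (simp add: prob_space)
  qed
  let ?Y = "\<lambda>x. l * (f x - expectation f)"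
  have Y: "\<bar>?Y x\<bar> \<le> \<bar>l\<bar> * c" if "x \<in> space M" for x
    using dev[OF that] by (simp add: abs_mult mult_left_mono)
  have Y2: "exp ((?Y x)\<^sup>2) \<le> exp (l\<^sup>2 * c\<^sup>2)" if "x \<in> space M" for x
  proof -
    have "\<bar>?Y x\<bar>\<^sup>2 \<le> (\<bar>l\<bar> * c)\<^sup>2" using Y[OF that] by (intro power_mono) auto
    then show ?thesis by (simp add: power_mult_distrib)
  qed
  have "(\<integral>x. exp (?Y x) \<partial>M) \<le> (\<integral>x. ?Y x + exp (l\<^sup>2 * c\<^sup>2) \<partial>M)"
  proof (rule integral_mono)
    show "integrable M (\<lambda>x. exp (?Y x))"
    proof (rule integrable_const_bound[of _ "exp (\<bar>l\<bar> * c)"])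
      show "AE x in M. norm (exp (?Y x)) \<le> exp (\<bar>l\<bar> * c)"
        using Y by (auto intro!: AE_I2 simp: abs_le_iff)
    qed (use f in measurable)
    show "integrable M (\<lambda>x. ?Y x + exp (l\<^sup>2 * c\<^sup>2))" using intf by auto
    show "exp (?Y x) \<le> ?Y x + exp (l\<^sup>2 * c\<^sup>2)" if "x \<in> space M" for x
      using exp_le_linear_plus_exp_square[of "?Y x"] Y2[OF that] by linarith
  qed
  also have "\<dots> = exp (l\<^sup>2 * c\<^sup>2)" using intf by (simp add: prob_space)
  finally show ?thesis .
qed

text \<open>Coordinate \<open>k\<close> is integrated first. For the other coordinates fixed,
  \<open>f - g\<close> is centred with oscillation at most \<open>c\<close>, where \<open>g\<close>
  is the mean over coordinate \<open>k\<close>, and this costs one factor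
  \<open>exp (l^2 * c^2)\<close>. The function \<open>g\<close> inherits the bound \<open>B\<close>
  and the difference bound \<open>c\<close>, so the induction continues with it.\<close>

lemma bounded_difference_mgf:
  fixes N :: "'k \<Rightarrow> 'b measure" and f :: "('k \<Rightarrow> 'b) \<Rightarrow> real"
  assumes N: "\<And>k. prob_space (N k)" and K: "finite K"
    and f: "f \<in> borel_measurable (PiM K N)" and B: "\<And>x. x \<in> space (PiM K N) \<Longrightarrow> \<bar>f x\<bar> \<le> B"
    and diff: "\<And>k x y. k \<in> K \<Longrightarrow> x \<in> space (PiM K N) \<Longrightarrow> y \<in> space (N k) \<Longrightarrow> \<bar>f (x(k := y)) - f x\<bar> \<le> c"
  shows "(\<integral>x. exp (l * (f x - (\<integral>x. f x \<partial>PiM K N))) \<partial>PiM K N) \<le> exp (l\<^sup>2 * c\<^sup>2 * card K)"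
  using K f B diff
proof (induction K arbitrary: f)
  case empty
  interpret prob_space "PiM {} N" by (intro prob_space_PiM) simp
  have "(\<integral>x. f x \<partial>PiM {} N) = f (\<lambda>_. undefined)"
  proof -
    have "(\<integral>x. f x \<partial>PiM {} N) = (\<integral>x. f (\<lambda>_. undefined) \<partial>PiM {} N)"
      by (intro Bochner_Integration.integral_cong refl) (simp add: space_PiM)
    then show ?thesis by (simp add: prob_space)
  qed
  then have "(\<integral>x. exp (l * (f x - (\<integral>x. f x \<partial>PiM {} N))) \<partial>PiM {} N) = (\<integral>x. 1 \<partial>PiM {} N)"
    by (intro Bochner_Integration.integral_cong refl) (simp add: space_PiM)
  then show ?case by (simp add: prob_space)
next
  case (insert k K f)
  interpret N: prob_space "N j" for j by (rule N)
  interpret product_sigma_finite N by unfold_locales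
  interpret P: prob_space "PiM K N" by (intro prob_space_PiM N)
  interpret P': prob_space "PiM (insert k K) N" by (intro prob_space_PiM N)
  note f = insert.prems(1) and B = insert.prems(2) and diff = insert.prems(3)
  have sp: "x(k := y) \<in> space (PiM (insert k K) N)" if "x \<in> space (PiM K N)" "y \<in> space (N k)" for x y
    using that insert.hyps by (auto simp: space_PiM PiE_def extensional_def Pi_def)
  define g where "g x = (\<integral>y. f (x(k := y)) \<partial>N k)" for x
  have fm: "(\<lambda>y. f (x(k := y))) \<in> borel_measurable (N k)" if "x \<in> space (PiM K N)" for x
    using measurable_compose[OF measurable_component_update[OF that insert.hyps(2)] f] .
  have fm2: "(\<lambda>(x, y). f (x(k := y))) \<in> borel_measurable (PiM K N \<Otimes>\<^sub>M N k)"
    using measurable_compose[OF measurable_add_dim f] by (simp add: case_prod_unfold fun_upd_def)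
  have fi: "integrable (N k) (\<lambda>y. f (x(k := y)))" if "x \<in> space (PiM K N)" for x
  proof (rule N.integrable_const_bound[of _ B])
    show "AE y in N k. norm (f (x(k := y))) \<le> B"
      unfolding real_norm_def by (intro AE_I2 B sp[OF that])
  qed (rule fm[OF that])
  have gm: "g \<in> borel_measurable (PiM K N)"
    unfolding g_def using fm2 by (rule N.borel_measurable_lebesgue_integral)
  have gB: "\<bar>g x\<bar> \<le> B" if x: "x \<in> space (PiM K N)" for x
  proof -
    have "\<bar>g x\<bar> \<le> (\<integral>y. \<bar>f (x(k := y))\<bar> \<partial>N k)" unfolding g_def by (rule integral_abs_bound)
    also have "\<dots> \<le> (\<integral>y. B \<partial>N k)"
      by (intro integral_mono B sp[OF x] integrable_abs fi[OF x] N.integrable_const)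
    finally show ?thesis by (simp add: N.prob_space)
  qed
  have gdiff: "\<bar>g (x(j := z)) - g x\<bar> \<le> c" if j: "j \<in> K" and x: "x \<in> space (PiM K N)" and z: "z \<in> space (N j)" for j x z
  proof -
    have jk: "j \<noteq> k" using j insert.hyps by auto
    have xz: "x(j := z) \<in> space (PiM K N)" using j x z by (auto simp: space_PiM PiE_def extensional_def Pi_def)
    have "g (x(j := z)) - g x = (\<integral>y. f ((x(j := z))(k := y)) - f (x(k := y)) \<partial>N k)"
      unfolding g_def using fi[OF x] fi[OF xz] by simp
    also have "\<bar>\<dots>\<bar> \<le> (\<integral>y. \<bar>f ((x(j := z))(k := y)) - f (x(k := y))\<bar> \<partial>N k)"
      by (rule integral_abs_bound)
    also have "\<dots> \<le> (\<integral>y. c \<partial>N k)"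
    proof (rule integral_mono)
      show "\<bar>f ((x(j := z))(k := y)) - f (x(k := y))\<bar> \<le> c" if "y \<in> space (N k)" for y
        unfolding fun_upd_twist[OF jk] using j by (intro diff sp[OF x that] z) simp
    qed (use fi[OF x] fi[OF xz] in auto)
    finally show ?thesis by (simp add: N.prob_space)
  qed
  let ?E = "\<integral>x. f x \<partial>PiM (insert k K) N" and ?E' = "\<integral>x. g x \<partial>PiM K N"
  have fint: "integrable (PiM (insert k K) N) f"
    using f B by (intro P'.integrable_const_bound[of _ B]) auto
  have E: "?E = ?E'" unfolding g_def by (rule product_integral_insert[OF insert.hyps fint])
  have expint: "integrable Q (\<lambda>x. exp (l * (h x - e)))"
    if "prob_space Q" "h \<in> borel_measurable Q" "\<And>x. x \<in> space Q \<Longrightarrow> \<bar>h x\<bar> \<le> B"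
    for Q :: "'z measure" and h :: "'z \<Rightarrow> real" and e
  proof -
    interpret Q: prob_space Q by fact
    show ?thesis
    proof (rule Q.integrable_const_bound[of _ "exp (\<bar>l\<bar> * (B + \<bar>e\<bar>))"])
      have "l * (h x - e) \<le> \<bar>l\<bar> * (B + \<bar>e\<bar>)" if "x \<in> space Q" for x
      proof -
        have "l * (h x - e) \<le> \<bar>l\<bar> * \<bar>h x - e\<bar>" by (metis abs_ge_self abs_mult)
        also have "\<dots> \<le> \<bar>l\<bar> * (B + \<bar>e\<bar>)" using \<open>\<And>x. x \<in> space Q \<Longrightarrow> \<bar>h x\<bar> \<le> B\<close>[OF that]
          by (intro mult_left_mono) auto
        finally show ?thesis .
      qed
      then show "AE x in Q. norm (exp (l * (h x - e))) \<le> exp (\<bar>l\<bar> * (B + \<bar>e\<bar>))" by auto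
    qed (use that(2) in measurable)
  qed
  have "(\<integral>x. exp (l * (f x - ?E)) \<partial>PiM (insert k K) N)
      = (\<integral>x. (\<integral>y. exp (l * (f (x(k := y)) - ?E)) \<partial>N k) \<partial>PiM K N)"
    by (rule product_integral_insert[OF insert.hyps expint[OF P'.prob_space_axioms f B]])
  also have "\<dots> = (\<integral>x. exp (l * (g x - ?E')) * (\<integral>y. exp (l * (f (x(k := y)) - g x)) \<partial>N k) \<partial>PiM K N)"
  proof (intro Bochner_Integration.integral_cong refl)
    fix x
    have "(\<integral>y. exp (l * (f (x(k := y)) - ?E)) \<partial>N k)
        = (\<integral>y. exp (l * (g x - ?E')) * exp (l * (f (x(k := y)) - g x)) \<partial>N k)"
      unfolding E by (intro Bochner_Integration.integral_cong refl) (simp add: algebra_simps flip: exp_add)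
    then show "(\<integral>y. exp (l * (f (x(k := y)) - ?E)) \<partial>N k)
        = exp (l * (g x - ?E')) * (\<integral>y. exp (l * (f (x(k := y)) - g x)) \<partial>N k)" by simp
  qed
  also have "\<dots> \<le> (\<integral>x. exp (l * (g x - ?E')) * exp (l\<^sup>2 * c\<^sup>2) \<partial>PiM K N)"
  proof (rule integral_mono_AE')
    show "integrable (PiM K N) (\<lambda>x. exp (l * (g x - ?E')) * exp (l\<^sup>2 * c\<^sup>2))"
      using expint[OF P.prob_space_axioms gm gB] by auto
    have "(\<integral>y. exp (l * (f (x(k := y)) - g x)) \<partial>N k) \<le> exp (l\<^sup>2 * c\<^sup>2)" if x: "x \<in> space (PiM K N)" for x
      unfolding g_def
    proof (rule N.centered_mgf_bound[OF fm[OF x]])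
      show "\<bar>f (x(k := y)) - f (x(k := z))\<bar> \<le> c" if "y \<in> space (N k)" "z \<in> space (N k)" for y z
        using diff[OF insertI1 sp[OF x that(2)] that(1)] unfolding fun_upd_upd .
      show "\<bar>f (x(k := y))\<bar> \<le> B" if "y \<in> space (N k)" for y using B[OF sp[OF x that]] .
    qed
    then show "AE x in PiM K N. exp (l * (g x - ?E')) * (\<integral>y. exp (l * (f (x(k := y)) - g x)) \<partial>N k)
        \<le> exp (l * (g x - ?E')) * exp (l\<^sup>2 * c\<^sup>2)"
      by (intro AE_I2) simp
    show "AE x in PiM K N. 0 \<le> exp (l * (g x - ?E')) * exp (l\<^sup>2 * c\<^sup>2)" by simp
  qed
  also have "\<dots> = (\<integral>x. exp (l * (g x - ?E')) \<partial>PiM K N) * exp (l\<^sup>2 * c\<^sup>2)" by simp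
  also have "\<dots> \<le> exp (l\<^sup>2 * c\<^sup>2 * card K) * exp (l\<^sup>2 * c\<^sup>2)"
    by (intro mult_right_mono insert.IH gm gB gdiff) auto
  also have "\<dots> = exp (l\<^sup>2 * c\<^sup>2 * card (insert k K))"
    using insert.hyps by (simp add: exp_add[symmetric] algebra_simps)
  finally show ?case .
qed

text \<open>Independence makes the joint law a product measure, and Markov's inequality for the
  exponential is applied to both signs of the deviation. The parameter \<open>l\<close> stays free
  for a later choice.\<close>

lemma (in prob_space) bounded_difference_tail:
  fixes X :: "'k \<Rightarrow> 'a \<Rightarrow> 'b" and f :: "('k \<Rightarrow> 'b) \<Rightarrow> real"
  assumes ind: "indep_vars N X K" and K: "finite K" "K \<noteq> {}"
    and f: "f \<in> borel_measurable (PiM K N)" and B: "\<And>x. x \<in> space (PiM K N) \<Longrightarrow> \<bar>f x\<bar> \<le> B"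
    and diff: "\<And>k x y. k \<in> K \<Longrightarrow> x \<in> space (PiM K N) \<Longrightarrow> y \<in> space (N k) \<Longrightarrow> \<bar>f (x(k := y)) - f x\<bar> \<le> c"
    and l: "l > 0"
  defines "Z \<equiv> \<lambda>\<omega>. f (\<lambda>k\<in>K. X k \<omega>)"
  shows "prob {\<omega> \<in> space M. \<bar>Z \<omega> - expectation Z\<bar> \<ge> \<epsilon>} \<le> 2 * exp (l\<^sup>2 * c\<^sup>2 * card K - l * \<epsilon>)"
proof -
  have rv: "X k \<in> measurable M (N k)" if "k \<in> K" for k using ind that by (auto simp: indep_vars_def)
  obtain k0 where k0: "k0 \<in> K" using K by auto
  \<comment> \<open>The product bound asks for a probability measure at every index, so outside
    \<open>K\<close> the law at \<open>k0\<close> is repeated.\<close>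
  define D where "D k = (if k \<in> K then distr M (N k) (X k) else distr M (N k0) (X k0))" for k
  have D: "prob_space (D k)" for k
    unfolding D_def using rv k0 by (auto intro!: prob_space_distr)
  have XM: "(\<lambda>\<omega>. \<lambda>k\<in>K. X k \<omega>) \<in> measurable M (PiM K N)" using rv by (intro measurable_restrict)
  have "distr M (PiM K N) (\<lambda>\<omega>. \<lambda>k\<in>K. X k \<omega>) = PiM K (\<lambda>k. distr M (N k) (X k))"
    using indep_vars_iff_distr_eq_PiM'[where M' = N and X = X and I = K, OF K(2) rv] ind by blast
  also have "\<dots> = PiM K D" by (intro PiM_cong) (auto simp: D_def)
  finally have distr: "distr M (PiM K N) (\<lambda>\<omega>. \<lambda>k\<in>K. X k \<omega>) = PiM K D" .
  have sets: "sets (PiM K D) = sets (PiM K N)" unfolding distr[symmetric] by simp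
  have space: "space (PiM K D) = space (PiM K N)" using sets by (rule sets_eq_imp_space_eq)
  have fD: "f \<in> borel_measurable (PiM K D)" using f unfolding measurable_cong_sets[OF sets refl] .
  have Zm: "Z \<in> borel_measurable M" unfolding Z_def using measurable_compose[OF XM f] .
  have ZB: "\<bar>Z \<omega>\<bar> \<le> B" if "\<omega> \<in> space M" for \<omega>
    unfolding Z_def using B measurable_space[OF XM that] by auto
  have tr: "(\<integral>x. h (f x) \<partial>PiM K D) = expectation (\<lambda>\<omega>. h (Z \<omega>))" if "h \<in> borel_measurable borel" for h :: "real \<Rightarrow> real"
    unfolding distr[symmetric] Z_def using XM f that by (subst integral_distr) auto
  have mgf: "expectation (\<lambda>\<omega>. exp (l * (Z \<omega> - expectation Z))) \<le> exp (l\<^sup>2 * c\<^sup>2 * card K)" for l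
  proof -
    have "(\<integral>x. exp (l * (f x - (\<integral>x. f x \<partial>PiM K D))) \<partial>PiM K D) \<le> exp (l\<^sup>2 * c\<^sup>2 * card K)"
      using K(1) fD
    proof (rule bounded_difference_mgf[OF D])
      show "\<bar>f x\<bar> \<le> B" if "x \<in> space (PiM K D)" for x using that B space by simp
      show "\<bar>f (x(k := y)) - f x\<bar> \<le> c" if "k \<in> K" "x \<in> space (PiM K D)" "y \<in> space (D k)" for k x y
        using that diff[of k x y] space by (simp add: D_def)
    qed
    then show ?thesis using tr[of "\<lambda>x. x"] tr[of "\<lambda>x. exp (l * (x - expectation Z))"] by simp
  qed
  have tail: "prob {\<omega> \<in> space M. s * (Z \<omega> - expectation Z) \<ge> \<epsilon>} \<le> exp (l\<^sup>2 * c\<^sup>2 * card K - l * \<epsilon>)"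
    if s: "s\<^sup>2 = 1" for s :: real
  proof -
    let ?u = "\<lambda>\<omega>. exp ((l * s) * (Z \<omega> - expectation Z))"
    have int: "integrable M ?u"
    proof (rule integrable_const_bound[of _ "exp (\<bar>l * s\<bar> * (B + \<bar>expectation Z\<bar>))"])
      have "(l * s) * (Z \<omega> - expectation Z) \<le> \<bar>l * s\<bar> * (B + \<bar>expectation Z\<bar>)" if "\<omega> \<in> space M" for \<omega>
      proof -
        have "(l * s) * (Z \<omega> - expectation Z) \<le> \<bar>l * s\<bar> * \<bar>Z \<omega> - expectation Z\<bar>" by (metis abs_ge_self abs_mult)
        also have "\<dots> \<le> \<bar>l * s\<bar> * (B + \<bar>expectation Z\<bar>)" using ZB[OF that] by (intro mult_left_mono) auto
        finally show ?thesis .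
      qed
      then show "AE \<omega> in M. norm (?u \<omega>) \<le> exp (\<bar>l * s\<bar> * (B + \<bar>expectation Z\<bar>))" by auto
    qed (use Zm in measurable)
    have "{\<omega> \<in> space M. s * (Z \<omega> - expectation Z) \<ge> \<epsilon>} = {\<omega> \<in> space M. exp (l * \<epsilon>) \<le> ?u \<omega>}"
      using l by (auto simp: mult.assoc)
    also have "prob \<dots> \<le> expectation ?u / exp (l * \<epsilon>)"
      using int by (intro integral_Markov_inequality_measure[where A = "{}"]) auto
    also have "\<dots> \<le> exp ((l * s)\<^sup>2 * c\<^sup>2 * card K) / exp (l * \<epsilon>)"
      by (intro divide_right_mono mgf) simp
    finally show ?thesis using s by (simp add: exp_diff power_mult_distrib)
  qed
  have "{\<omega> \<in> space M. \<bar>Z \<omega> - expectation Z\<bar> \<ge> \<epsilon>}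
      \<subseteq> {\<omega> \<in> space M. 1 * (Z \<omega> - expectation Z) \<ge> \<epsilon>} \<union> {\<omega> \<in> space M. (-1) * (Z \<omega> - expectation Z) \<ge> \<epsilon>}"
    by auto
  then have "prob {\<omega> \<in> space M. \<bar>Z \<omega> - expectation Z\<bar> \<ge> \<epsilon>}
      \<le> prob ({\<omega> \<in> space M. 1 * (Z \<omega> - expectation Z) \<ge> \<epsilon>} \<union> {\<omega> \<in> space M. (-1) * (Z \<omega> - expectation Z) \<ge> \<epsilon>})"
    using Zm by (intro finite_measure_mono) auto
  also have "\<dots> \<le> prob {\<omega> \<in> space M. 1 * (Z \<omega> - expectation Z) \<ge> \<epsilon>} + prob {\<omega> \<in> space M. (-1) * (Z \<omega> - expectation Z) \<ge> \<epsilon>}"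
    using Zm by (intro measure_Un_le) auto
  also have "\<dots> \<le> 2 * exp (l\<^sup>2 * c\<^sup>2 * card K - l * \<epsilon>)"
    using tail[of 1] tail[of "-1"] by simp
  finally show ?thesis .
qed

section \<open>The resolvent trace of a tensor sample\<close>

lemma resolv_measurable:
  assumes "\<And>k a. k \<in> set ks \<Longrightarrow> a \<in> D \<Longrightarrow> (\<lambda>\<omega>. x \<omega> k a) \<in> borel_measurable N"
  shows "(\<lambda>\<omega>. resolv D t c (x \<omega>) ks a b) \<in> borel_measurable N"
  using assms
proof (induction ks arbitrary: a b)
  case (Cons k ks)
  have R: "(\<lambda>\<omega>. resolv D t c (x \<omega>) ks a b) \<in> borel_measurable N" for a b
    using Cons by simp
  have x: "(\<lambda>\<omega>. x \<omega> k a) \<in> borel_measurable N" if "a \<in> D" for a using Cons that by simp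
  have a: "(\<lambda>\<omega>. app D (resolv D t c (x \<omega>) ks) (x \<omega> k) a) \<in> borel_measurable N" for a
    unfolding app_def by (intro borel_measurable_sum borel_measurable_times R x)
  have q: "(\<lambda>\<omega>. quad D (resolv D t c (x \<omega>) ks) (x \<omega> k)) \<in> borel_measurable N"
    unfolding quad_def by (intro borel_measurable_sum borel_measurable_times a x)
  show ?case unfolding resolv.simps
    by (intro borel_measurable_diff borel_measurable_times borel_measurable_divide
        borel_measurable_add borel_measurable_const R a q)
qed simp

text \<open>Both traces lie in the same interval of length \<open>1 / t\<close>, whose upper end is
  the trace with column \<open>k\<close> removed.\<close>

lemma trace_resolv_change_one:
  fixes x y :: "nat \<Rightarrow> 'i \<Rightarrow> real"
  assumes D: "finite D" "t > 0" "c \<ge> 0" and k: "k < m"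
    and eq: "\<And>j a. j < m \<Longrightarrow> j \<noteq> k \<Longrightarrow> a \<in> D \<Longrightarrow> x j a = y j a"
  shows "\<bar>(\<Sum>a\<in>D. resolv D t c x [0..<m] a a) - (\<Sum>a\<in>D. resolv D t c y [0..<m] a a)\<bar> \<le> 1 / t"
proof -
  let ?T = "\<lambda>x ks. \<Sum>a\<in>D. resolv D t c x ks a a"
  let ?r = "remove1 k [0..<m]"
  have perm: "?T x [0..<m] = ?T x (k # ?r)" for x :: "nat \<Rightarrow> 'i \<Rightarrow> real"
    using k by (intro sum.cong refl resolv_mset_eq[OF D]) simp_all
  have "resolv D t c x ?r = resolv D t c y ?r"
    using eq by (intro resolv_cong) auto
  then show ?thesis unfolding perm[of x] perm[of y]
    using trace_resolv_Cons[OF D, where x = x and k = k and ks = ?r]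
      trace_resolv_Cons[OF D, where x = y and k = k and ks = ?r]
    by (simp only: abs_le_iff) linarith
qed

lemma (in prob_space) expectation_abs_le_sqrt:
  assumes "integrable M f" "integrable M (\<lambda>\<omega>. (f \<omega>)\<^sup>2)"
  shows "expectation (\<lambda>\<omega>. \<bar>f \<omega>\<bar>) \<le> sqrt (expectation (\<lambda>\<omega>. (f \<omega>)\<^sup>2))"
proof (rule real_le_rsqrt)
  show "(expectation (\<lambda>\<omega>. \<bar>f \<omega>\<bar>))\<^sup>2 \<le> expectation (\<lambda>\<omega>. (f \<omega>)\<^sup>2)"
    using variance_positive[of "\<lambda>\<omega>. \<bar>f \<omega>\<bar>"] variance_eq[of "\<lambda>\<omega>. \<bar>f \<omega>\<bar>"] assms by simp
qed

text \<open>The bound on the covariance row sums relative to \<open>n choose d\<close>; to leading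
  order it is \<open>3 * C * d * \<tau>\<close>.\<close>

definition cov_err :: "nat \<Rightarrow> nat \<Rightarrow> real \<Rightarrow> real" where
  "cov_err n d C = (let u = 3 * C * sqrt (real d / real (n - d + 1)) in d * u * (1 + u) ^ d)"

text \<open>The setting for a single \<open>n\<close>: limits are taken outside, and all bounds
  inside are explicit in \<open>n\<close>, \<open>d\<close>, \<open>m\<close>, \<open>C\<close> and
  \<open>t\<close>.\<close>

locale tensor_sample = prob_space M for M :: "'a measure" +
  fixes n d m :: nat and \<xi> :: "nat \<Rightarrow> nat \<Rightarrow> 'a \<Rightarrow> real" and C t :: real
  assumes indep: "indep_vars (\<lambda>_. borel) (\<lambda>(j, i). \<xi> j i) ({..<m} \<times> {..<n})"
    and int1: "\<And>j i. j < m \<Longrightarrow> i < n \<Longrightarrow> integrable M (\<xi> j i)"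
    and mean: "\<And>j i. j < m \<Longrightarrow> i < n \<Longrightarrow> expectation (\<xi> j i) = 0"
    and int2: "\<And>j i. j < m \<Longrightarrow> i < n \<Longrightarrow> integrable M (\<lambda>\<omega>. (\<xi> j i \<omega>)^2)"
    and var: "\<And>j i. j < m \<Longrightarrow> i < n \<Longrightarrow> expectation (\<lambda>\<omega>. (\<xi> j i \<omega>)^2) = 1"
    and int4: "\<And>j i. j < m \<Longrightarrow> i < n \<Longrightarrow> integrable M (\<lambda>\<omega>. (\<xi> j i \<omega>)^4)"
    and four: "\<And>j i. j < m \<Longrightarrow> i < n \<Longrightarrow> expectation (\<lambda>\<omega>. (\<xi> j i \<omega>)^4) \<le> C"
    and d0: "d > 0" and dn: "d \<le> n" and m0: "m > 0" and t0: "t > 0"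
begin

abbreviation "D \<equiv> dsubsets n d"

definition col :: "'a \<Rightarrow> nat \<Rightarrow> nat set \<Rightarrow> real" where
  "col \<omega> k I = (\<Prod>i\<in>I. \<xi> k i \<omega>)"

lemma rv: "j < m \<Longrightarrow> i < n \<Longrightarrow> \<xi> j i \<in> borel_measurable M"
  using int1 by blast

text \<open>From \<open>(\<xi>^2 - 1)^2 \<ge> 0\<close>. Besides giving \<open>C \<ge> 1\<close>,
  this supplies the lower bound on fourth moments used for the covariances.\<close>

lemma fourth_moment_ge: "j < m \<Longrightarrow> i < n \<Longrightarrow> 1 \<le> expectation (\<lambda>\<omega>. (\<xi> j i \<omega>)^4)"
proof -
  assume ji: "j < m" "i < n"
  have "expectation (\<lambda>\<omega>. 2 * (\<xi> j i \<omega>)^2 - 1) \<le> expectation (\<lambda>\<omega>. (\<xi> j i \<omega>)^4)"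
  proof (rule integral_mono)
    show "2 * (\<xi> j i \<omega>)^2 - 1 \<le> (\<xi> j i \<omega>)^4" for \<omega>
      using zero_le_power2[of "(\<xi> j i \<omega>)^2 - 1"] by (simp add: power2_diff flip: power_mult)
  qed (use int2 int4 ji in auto)
  then show ?thesis using int2[OF ji] var[OF ji] by (simp add: prob_space)
qed

lemma C_ge_1: "C \<ge> 1"
  using fourth_moment_ge[of 0 0] four[of 0 0] m0 d0 dn by linarith

text \<open>With \<open>y = \<bar>\<xi>\<bar>\<close>, expanding
  \<open>y^2 * (y - 1)^2 \<ge> 0\<close> dominates the cube by the mean of the second and fourth
  powers.\<close>

lemma third_moment:
  assumes ji: "j < m" "i < n"
  shows "integrable M (\<lambda>\<omega>. (\<xi> j i \<omega>)^3)" "\<bar>expectation (\<lambda>\<omega>. (\<xi> j i \<omega>)^3)\<bar> \<le> C"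
proof -
  have le: "\<bar>(\<xi> j i \<omega>)^3\<bar> \<le> ((\<xi> j i \<omega>)^2 + (\<xi> j i \<omega>)^4) / 2" for \<omega>
  proof -
    let ?y = "\<bar>\<xi> j i \<omega>\<bar>"
    have "0 \<le> ?y^2 * (?y - 1)^2" by simp
    then have "2 * ?y^3 \<le> ?y^2 + ?y^4"
      by (simp add: power2_eq_square eval_nat_numeral algebra_simps)
    then show ?thesis by (simp add: power_abs)
  qed
  have i24: "integrable M (\<lambda>\<omega>. ((\<xi> j i \<omega>)^2 + (\<xi> j i \<omega>)^4) / 2)"
    using int2[OF ji] int4[OF ji] by auto
  show i3: "integrable M (\<lambda>\<omega>. (\<xi> j i \<omega>)^3)"
  proof (rule Bochner_Integration.integrable_bound[OF i24])
    show "AE \<omega> in M. norm ((\<xi> j i \<omega>)^3) \<le> norm (((\<xi> j i \<omega>)^2 + (\<xi> j i \<omega>)^4) / 2)"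
      using le by (intro AE_I2) (auto intro: order_trans)
  qed (use rv[OF ji] in measurable)
  have "\<bar>expectation (\<lambda>\<omega>. (\<xi> j i \<omega>)^3)\<bar> \<le> expectation (\<lambda>\<omega>. \<bar>(\<xi> j i \<omega>)^3\<bar>)" by (rule integral_abs_bound)
  also have "\<dots> \<le> expectation (\<lambda>\<omega>. ((\<xi> j i \<omega>)^2 + (\<xi> j i \<omega>)^4) / 2)"
    using i3 i24 le by (intro integral_mono) auto
  also have "\<dots> = (1 + expectation (\<lambda>\<omega>. (\<xi> j i \<omega>)^4)) / 2"
    using int2[OF ji] int4[OF ji] var[OF ji] by simp
  also have "\<dots> \<le> C" using four[OF ji] C_ge_1 by simp
  finally show "\<bar>expectation (\<lambda>\<omega>. (\<xi> j i \<omega>)^3)\<bar> \<le> C" .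
qed

lemma integrable_moment:
  assumes "j < m" "i < n" "r \<le> 4"
  shows "integrable M (\<lambda>\<omega>. (\<xi> j i \<omega>)^r)"
proof -
  have "r = 0 \<or> r = 1 \<or> r = 2 \<or> r = 3 \<or> r = 4" using assms(3) by auto
  then show ?thesis using int1 int2 int4 third_moment(1) assms(1,2) by auto
qed

section \<open>Moments of products of entries of one column\<close>

lemma col_product:
  assumes "I \<subseteq> {..<n}" "J \<subseteq> {..<n}" "K \<subseteq> {..<n}" "L \<subseteq> {..<n}"
  shows "col \<omega> k I * col \<omega> k J * col \<omega> k K * col \<omega> k L = (\<Prod>i<n. \<xi> k i \<omega> ^ multiplicity4 I J K L i)"
proof -
  have "col \<omega> k I = (\<Prod>i<n. \<xi> k i \<omega> ^ of_bool (i \<in> I))" if "I \<subseteq> {..<n}" for I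
    unfolding col_def using that by (intro prod.mono_neutral_cong_left) auto
  then show ?thesis using assms by (simp add: multiplicity4_def power_add prod.distrib mult_ac)
qed

text \<open>Regrouped by coordinates, the product has independent factors, each a power with
  exponent at most 4. Products of two entries are recovered with \<open>K = L = {}\<close>.\<close>

lemma
  assumes k: "k < m" and sub: "I \<subseteq> {..<n}" "J \<subseteq> {..<n}" "K \<subseteq> {..<n}" "L \<subseteq> {..<n}"
  shows integrable_col4: "integrable M (\<lambda>\<omega>. col \<omega> k I * col \<omega> k J * col \<omega> k K * col \<omega> k L)"
    and expectation_col4: "expectation (\<lambda>\<omega>. col \<omega> k I * col \<omega> k J * col \<omega> k K * col \<omega> k L)
      = (\<Prod>i<n. expectation (\<lambda>\<omega>. \<xi> k i \<omega> ^ multiplicity4 I J K L i))"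
proof -
  have m4: "multiplicity4 I J K L i \<le> 4" for i by (simp add: multiplicity4_def)
  let ?Y = "\<lambda>q \<omega>. (\<lambda>(j, i). \<xi> j i) q \<omega> ^ multiplicity4 I J K L (snd q)"
  have "indep_vars (\<lambda>_. borel) (\<lambda>(j, i). \<xi> j i) (Pair k ` {..<n})"
    by (rule indep_vars_subset[OF indep]) (use k in auto)
  then have ind: "indep_vars (\<lambda>_. borel) ?Y (Pair k ` {..<n})"
    by (rule indep_vars_compose2) simp
  have int: "integrable M (?Y q)" if "q \<in> Pair k ` {..<n}" for q
    using integrable_moment[OF k _ m4] that by auto
  have prod: "(\<Prod>i<n. f (k, i)) = (\<Prod>q\<in>Pair k ` {..<n}. f q)" for f :: "nat \<times> nat \<Rightarrow> real"
    by (simp add: prod.reindex inj_on_def)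
  have eq: "(\<Prod>i<n. \<xi> k i \<omega> ^ multiplicity4 I J K L i) = (\<Prod>q\<in>Pair k ` {..<n}. ?Y q \<omega>)" for \<omega>
    using prod[of "\<lambda>q. ?Y q \<omega>"] by simp
  show "integrable M (\<lambda>\<omega>. col \<omega> k I * col \<omega> k J * col \<omega> k K * col \<omega> k L)"
    unfolding col_product[OF sub] eq by (rule indep_vars_integrable[OF _ ind int]) simp_all
  have "expectation (\<lambda>\<omega>. \<Prod>q\<in>Pair k ` {..<n}. ?Y q \<omega>) = (\<Prod>q\<in>Pair k ` {..<n}. expectation (?Y q))"
    by (rule indep_vars_lebesgue_integral[OF _ ind int]) simp_all
  then show "expectation (\<lambda>\<omega>. col \<omega> k I * col \<omega> k J * col \<omega> k K * col \<omega> k L)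
      = (\<Prod>i<n. expectation (\<lambda>\<omega>. \<xi> k i \<omega> ^ multiplicity4 I J K L i))"
    unfolding col_product[OF sub] eq using prod[of "\<lambda>q. expectation (?Y q)"] by simp
qed

lemma col_empty [simp]: "col \<omega> k {} = 1"
  by (simp add: col_def)

lemma
  assumes k: "k < m" and sub: "I \<subseteq> {..<n}" "J \<subseteq> {..<n}"
  shows integrable_col2: "integrable M (\<lambda>\<omega>. col \<omega> k I * col \<omega> k J)"
    and expectation_col2: "expectation (\<lambda>\<omega>. col \<omega> k I * col \<omega> k J) = of_bool (I = J)"
proof -
  have e: "{} \<subseteq> {..<n}" by simp
  show "integrable M (\<lambda>\<omega>. col \<omega> k I * col \<omega> k J)"
    using integrable_col4[OF k sub e e] by simp
  let ?mu = "\<lambda>i. expectation (\<lambda>\<omega>. \<xi> k i \<omega> ^ multiplicity4 I J {} {} i)"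
  have E: "expectation (\<lambda>\<omega>. col \<omega> k I * col \<omega> k J) = (\<Prod>i<n. ?mu i)"
    using expectation_col4[OF k sub e e] by simp
  show "expectation (\<lambda>\<omega>. col \<omega> k I * col \<omega> k J) = of_bool (I = J)"
  proof (cases "I = J")
    case True
    have "?mu i = 1" if "i < n" for i
      using var[OF k that] True by (simp add: multiplicity4_def prob_space power2_eq_square)
    then show ?thesis using E True by simp
  next
    case False
    then obtain i where i: "(i \<in> I) \<noteq> (i \<in> J)" by blast
    then have "i < n" using sub by auto
    moreover from this have "?mu i = 0" using i mean[OF k] by (auto simp: multiplicity4_def)
    ultimately have "(\<Prod>i<n. ?mu i) = 0" by (intro prod_zero) auto
    then show ?thesis using E False by simp
  qed
qed

text \<open>The covariance of two products of tensor entries, written through coordinate moments in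
  the shape that the row-sum bound expects.\<close>

definition cov :: "nat \<Rightarrow> nat set \<times> nat set \<Rightarrow> nat set \<times> nat set \<Rightarrow> real" where
  "cov k \<alpha> \<beta> = (\<Prod>i<n. expectation (\<lambda>\<omega>. \<xi> k i \<omega> ^ multiplicity4 (fst \<alpha>) (snd \<alpha>) (fst \<beta>) (snd \<beta>) i))
     - of_bool (fst \<alpha> = snd \<alpha>) * of_bool (fst \<beta> = snd \<beta>)"

definition centered :: "nat \<Rightarrow> nat set \<times> nat set \<Rightarrow> 'a \<Rightarrow> real" where
  "centered k \<alpha> \<omega> = col \<omega> k (fst \<alpha>) * col \<omega> k (snd \<alpha>) - of_bool (fst \<alpha> = snd \<alpha>)"

lemma D_subset: "I \<in> D \<Longrightarrow> I \<subseteq> {..<n}"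
  by (simp add: dsubsets_def)

lemma
  assumes k: "k < m" and a: "\<alpha> \<in> D \<times> D" and b: "\<beta> \<in> D \<times> D"
  shows integrable_centered: "integrable M (\<lambda>\<omega>. centered k \<alpha> \<omega> * centered k \<beta> \<omega>)"
    and expectation_centered: "expectation (\<lambda>\<omega>. centered k \<alpha> \<omega> * centered k \<beta> \<omega>) = cov k \<alpha> \<beta>"
proof -
  obtain I J K L where ab: "\<alpha> = (I, J)" "\<beta> = (K, L)" by (metis surj_pair)
  have s: "I \<subseteq> {..<n}" "J \<subseteq> {..<n}" "K \<subseteq> {..<n}" "L \<subseteq> {..<n}"
    using a b ab D_subset by auto
  note i4 = integrable_col4[OF k s] and i2 = integrable_col2[OF k s(1,2)] integrable_col2[OF k s(3,4)]
  have eq: "centered k \<alpha> \<omega> * centered k \<beta> \<omega> = col \<omega> k I * col \<omega> k J * col \<omega> k K * col \<omega> k L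
      - of_bool (K = L) * (col \<omega> k I * col \<omega> k J) - of_bool (I = J) * (col \<omega> k K * col \<omega> k L)
      + of_bool (I = J) * of_bool (K = L)" for \<omega>
    by (simp add: centered_def ab algebra_simps)
  show "integrable M (\<lambda>\<omega>. centered k \<alpha> \<omega> * centered k \<beta> \<omega>)"
    unfolding eq using i4 i2 by auto
  have "expectation (\<lambda>\<omega>. centered k \<alpha> \<omega> * centered k \<beta> \<omega>)
      = expectation (\<lambda>\<omega>. col \<omega> k I * col \<omega> k J * col \<omega> k K * col \<omega> k L)
        - of_bool (K = L) * of_bool (I = J) - of_bool (I = J) * of_bool (K = L) + of_bool (I = J) * of_bool (K = L)"
    unfolding eq using i4 i2 expectation_col2[OF k s(1,2)] expectation_col2[OF k s(3,4)]
    by (simp add: prob_space)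
  then show "expectation (\<lambda>\<omega>. centered k \<alpha> \<omega> * centered k \<beta> \<omega>) = cov k \<alpha> \<beta>"
    unfolding expectation_col4[OF k s] by (simp add: cov_def ab)
qed

lemma cov_sym: "cov k \<alpha> \<beta> = cov k \<beta> \<alpha>"
proof -
  have "multiplicity4 I J K L = multiplicity4 K L I J" for I J K L
    by (simp add: fun_eq_iff multiplicity4_def)
  then have "multiplicity4 (fst \<alpha>) (snd \<alpha>) (fst \<beta>) (snd \<beta>) = multiplicity4 (fst \<beta>) (snd \<beta>) (fst \<alpha>) (snd \<alpha>)" .
  then show ?thesis unfolding cov_def by simp
qed

abbreviation "err \<equiv> cov_err n d C"

lemma err_nonneg: "err \<ge> 0"
  unfolding cov_err_def Let_def using C_ge_1 by simp

lemma cov_row_sum: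
  assumes k: "k < m" and small: "3 * C * sqrt (real d / real (n - d + 1)) \<le> 1" and a: "\<alpha> \<in> D \<times> D"
  shows "(\<Sum>\<beta>\<in>D \<times> D. \<bar>cov k \<alpha> \<beta>\<bar>) \<le> real (n choose d) * err"
proof -
  let ?\<tau> = "sqrt (real d / real (n - d + 1))"
  have "?\<tau> * 1 \<le> ?\<tau> * (3 * C)" using C_ge_1 by (intro mult_left_mono) auto
  moreover have "?\<tau> * (3 * C) = 3 * C * ?\<tau>" by (rule mult.commute)
  ultimately have "?\<tau> \<le> 1" using small by linarith
  then have "(\<Sum>K\<in>D. \<Sum>L\<in>D. \<bar>cov k \<alpha> (K, L)\<bar>) \<le> real (n choose d) * err"
    unfolding cov_def cov_err_def Let_def fst_conv snd_conv
    using a small C_ge_1 d0 dn mean[OF k] var[OF k] third_moment(2)[OF k] fourth_moment_ge[OF k] four[OF k]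
    by (intro sum_covariance_bound[where \<tau> = ?\<tau> and C = C and \<mu> = "\<lambda>i r. expectation (\<lambda>\<omega>. \<xi> k i \<omega> ^ r)"])
       (auto simp: prob_space)
  then show ?thesis unfolding sum.cartesian_product by (simp add: case_prod_unfold)
qed

section \<open>Fluctuation of the leave-one-out quadratic forms\<close>

definition leave_one_out :: "nat \<Rightarrow> 'a \<Rightarrow> nat set \<Rightarrow> nat set \<Rightarrow> real" where
  "leave_one_out k \<omega> = resolv D t (1 / real m) (col \<omega>) (remove1 k [0..<m])"

lemma col_measurable: "k < m \<Longrightarrow> I \<in> D \<Longrightarrow> (\<lambda>\<omega>. col \<omega> k I) \<in> borel_measurable M"
  unfolding col_def using D_subset rv by (intro borel_measurable_prod) blast

lemma leave_one_out_measurable: "(\<lambda>\<omega>. leave_one_out k \<omega> a b) \<in> borel_measurable M"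
  unfolding leave_one_out_def
proof (rule resolv_measurable)
  fix j a assume "j \<in> set (remove1 k [0..<m])" "a \<in> D"
  then show "(\<lambda>\<omega>. col \<omega> j a) \<in> borel_measurable M"
    using set_remove1_subset[of k "[0..<m]"] by (intro col_measurable) auto
qed

lemma leave_one_out_bound: "a \<in> D \<Longrightarrow> b \<in> D \<Longrightarrow> \<bar>leave_one_out k \<omega> a b\<bar> \<le> 1 / t"
  unfolding leave_one_out_def using t0 by (intro resolv_entry_bound) auto

text \<open>The two products are measurable functions of disjoint blocks of the array
  \<open>\<xi>\<close>: all rows but \<open>k\<close>, and row \<open>k\<close>. Products of two
  terms appear because the second moment of the quadratic form needs exactly these.\<close>

lemma indep_leave_one_out_centered:
  assumes k: "k < m" and a: "\<alpha> \<in> D \<times> D" and b: "\<beta> \<in> D \<times> D"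
  shows "indep_var borel (\<lambda>\<omega>. leave_one_out k \<omega> (fst \<alpha>) (snd \<alpha>) * leave_one_out k \<omega> (fst \<beta>) (snd \<beta>))
    borel (\<lambda>\<omega>. centered k \<alpha> \<omega> * centered k \<beta> \<omega>)"
proof -
  let ?A = "({..<m} - {k}) \<times> {..<n}" and ?B = "{k} \<times> {..<n}"
  let ?X = "\<lambda>S \<omega>. restrict (\<lambda>q. (\<lambda>(j, i). \<xi> j i) q \<omega>) S"
  define c2 where "c2 z j I = (\<Prod>i\<in>I. z (j, i))" for z :: "nat \<times> nat \<Rightarrow> real" and j I
  define R where "R z = resolv D t (1 / real m) (c2 z) (remove1 k [0..<m])" for z
  define Z where "Z z \<alpha> = c2 z k (fst \<alpha>) * c2 z k (snd \<alpha>) - of_bool (fst \<alpha> = snd \<alpha>)" for z and \<alpha> :: "nat set \<times> nat set"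
  have ind: "indep_var (PiM ?A (\<lambda>_. borel)) (?X ?A) (PiM ?B (\<lambda>_. borel)) (?X ?B)"
    by (rule indep_var_restrict[OF indep]) (use k in auto)
  have c2m: "(\<lambda>z. c2 z j I) \<in> borel_measurable (PiM S (\<lambda>_. borel))" if "{j} \<times> {..<n} \<subseteq> S" "I \<in> D" for S j I
    unfolding c2_def
  proof (intro borel_measurable_prod)
    fix i assume "i \<in> I"
    then have "(j, i) \<in> S" using that D_subset by auto
    then show "(\<lambda>z. z (j, i)) \<in> borel_measurable (PiM S (\<lambda>_. borel))" by (rule measurable_component_singleton)
  qed
  have Rm: "(\<lambda>z. R z a b) \<in> borel_measurable (PiM ?A (\<lambda>_. borel))" for a b
    unfolding R_def by (intro resolv_measurable c2m) auto
  have Zm: "(\<lambda>z. Z z \<alpha>) \<in> borel_measurable (PiM ?B (\<lambda>_. borel))" if "\<alpha> \<in> D \<times> D" for \<alpha>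
    unfolding Z_def using that by (intro borel_measurable_diff borel_measurable_times c2m borel_measurable_const) auto
  have "indep_var borel ((\<lambda>z. R z (fst \<alpha>) (snd \<alpha>) * R z (fst \<beta>) (snd \<beta>)) \<circ> ?X ?A)
      borel ((\<lambda>z. Z z \<alpha> * Z z \<beta>) \<circ> ?X ?B)"
    by (intro indep_var_compose[OF ind] borel_measurable_times Rm Zm a b)
  moreover have "R (?X ?A \<omega>) = leave_one_out k \<omega>" for \<omega>
    unfolding R_def leave_one_out_def
  proof (intro resolv_cong)
    fix j I assume "j \<in> set (remove1 k [0..<m])" "I \<in> D"
    then show "c2 (?X ?A \<omega>) j I = col \<omega> j I"
      unfolding c2_def col_def using D_subset by (intro prod.cong) auto
  qed
  moreover have "Z (?X ?B \<omega>) \<alpha> = centered k \<alpha> \<omega>" if "\<alpha> \<in> D \<times> D" for \<alpha> \<omega>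
  proof -
    have "c2 (?X ?B \<omega>) k I = col \<omega> k I" if "I \<in> D" for I
      unfolding c2_def col_def using D_subset[OF that] by (intro prod.cong) auto
    then show ?thesis using that by (auto simp: Z_def centered_def)
  qed
  ultimately show ?thesis using a b by (simp add: o_def)
qed

definition dev :: "nat \<Rightarrow> 'a \<Rightarrow> real" where
  "dev k \<omega> = quad D (leave_one_out k \<omega>) (col \<omega> k) - (\<Sum>a\<in>D. leave_one_out k \<omega> a a)"

text \<open>The entries of a column are orthonormal, so subtracting the trace is the same as
  centring each product of two entries.\<close>

lemma dev_eq: "dev k \<omega> = (\<Sum>\<alpha>\<in>D \<times> D. leave_one_out k \<omega> (fst \<alpha>) (snd \<alpha>) * centered k \<alpha> \<omega>)"
proof -
  have "(\<Sum>\<alpha>\<in>D \<times> D. leave_one_out k \<omega> (fst \<alpha>) (snd \<alpha>) * centered k \<alpha> \<omega>)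
      = (\<Sum>I\<in>D. \<Sum>J\<in>D. leave_one_out k \<omega> I J * (col \<omega> k I * col \<omega> k J)) - (\<Sum>I\<in>D. \<Sum>J\<in>D. if I = J then leave_one_out k \<omega> I J else 0)"
    unfolding sum.cartesian_product sum_subtractf[symmetric]
    by (intro sum.cong refl) (simp add: case_prod_unfold centered_def algebra_simps)
  also have "\<dots> = dev k \<omega>"
    by (simp add: dev_def quad_def app_def sum_distrib_left mult_ac)
  finally show ?thesis by simp
qed

lemma dev_measurable: "k < m \<Longrightarrow> dev k \<in> borel_measurable M"
  unfolding dev_def[abs_def] quad_def app_def
  by (intro borel_measurable_diff borel_measurable_sum borel_measurable_times leave_one_out_measurable col_measurable)

text \<open>By independence the second moment is the sum of
  \<open>G \<alpha> \<beta> * cov k \<alpha> \<beta>\<close>, with \<open>G\<close> the Gram matrix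
  of the resolvent entries. The Schur test bounds \<open>\<bar>G \<alpha> \<beta>\<bar>\<close> by
  the mean of two diagonal entries, which leaves the largest row sum of the covariances times the
  trace of \<open>G\<close>; that trace is an expected squared Frobenius norm, at most
  \<open>(n choose d) / t^2\<close>.\<close>

lemma dev_second_moment:
  assumes k: "k < m" and small: "3 * C * sqrt (real d / real (n - d + 1)) \<le> 1"
  shows "integrable M (\<lambda>\<omega>. (dev k \<omega>)\<^sup>2)"
    "expectation (\<lambda>\<omega>. (dev k \<omega>)\<^sup>2) \<le> err * (real (n choose d) / t)\<^sup>2"
proof -
  let ?DD = "D \<times> D"
  let ?B = "\<lambda>\<alpha> \<omega>. leave_one_out k \<omega> (fst \<alpha>) (snd \<alpha>)" and ?Z = "centered k"
  have Bb: "\<bar>?B \<alpha> \<omega>\<bar> \<le> 1 / t" if "\<alpha> \<in> ?DD" for \<alpha> \<omega> using that by (intro leave_one_out_bound) auto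
  have BBi: "integrable M (\<lambda>\<omega>. ?B \<alpha> \<omega> * ?B \<beta> \<omega>)" if "\<alpha> \<in> ?DD" "\<beta> \<in> ?DD" for \<alpha> \<beta>
  proof (rule integrable_const_bound[of _ "1 / t * (1 / t)"])
    show "AE \<omega> in M. norm (?B \<alpha> \<omega> * ?B \<beta> \<omega>) \<le> 1 / t * (1 / t)"
      unfolding real_norm_def abs_mult using t0
      by (intro AE_I2 mult_mono Bb that) auto
  qed (intro borel_measurable_times leave_one_out_measurable)
  have sq: "(dev k \<omega>)\<^sup>2 = (\<Sum>\<alpha>\<in>?DD. \<Sum>\<beta>\<in>?DD. (?B \<alpha> \<omega> * ?B \<beta> \<omega>) * (?Z \<alpha> \<omega> * ?Z \<beta> \<omega>))" for \<omega>
    unfolding dev_eq power2_eq_square sum_product by (intro sum.cong refl) (simp only: mult_ac)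
  note ii = indep_var_integrable[OF indep_leave_one_out_centered[OF k] BBi integrable_centered[OF k]]
  show "integrable M (\<lambda>\<omega>. (dev k \<omega>)\<^sup>2)"
    unfolding sq by (intro Bochner_Integration.integrable_sum ii)
  define G where "G \<alpha> \<beta> = expectation (\<lambda>\<omega>. ?B \<alpha> \<omega> * ?B \<beta> \<omega>)" for \<alpha> \<beta>
  have G0: "0 \<le> G \<alpha> \<alpha>" for \<alpha> unfolding G_def by (intro Bochner_Integration.integral_nonneg) simp
  have GB: "\<bar>G \<alpha> \<beta>\<bar> \<le> (G \<alpha> \<alpha> + G \<beta> \<beta>) / 2" if ab: "\<alpha> \<in> ?DD" "\<beta> \<in> ?DD" for \<alpha> \<beta>
  proof -
    have "\<bar>G \<alpha> \<beta>\<bar> \<le> expectation (\<lambda>\<omega>. \<bar>?B \<alpha> \<omega> * ?B \<beta> \<omega>\<bar>)"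
      unfolding G_def by (rule integral_abs_bound)
    also have "\<dots> \<le> expectation (\<lambda>\<omega>. (?B \<alpha> \<omega> * ?B \<alpha> \<omega> + ?B \<beta> \<omega> * ?B \<beta> \<omega>) / 2)"
    proof (rule integral_mono)
      show "\<bar>?B \<alpha> \<omega> * ?B \<beta> \<omega>\<bar> \<le> (?B \<alpha> \<omega> * ?B \<alpha> \<omega> + ?B \<beta> \<omega> * ?B \<beta> \<omega>) / 2" for \<omega>
        using sum_squares_bound[of "\<bar>?B \<alpha> \<omega>\<bar>" "\<bar>?B \<beta> \<omega>\<bar>"] by (simp add: abs_mult power2_eq_square)
    qed (use BBi[OF ab] BBi[OF ab(1,1)] BBi[OF ab(2,2)] in auto)
    also have "\<dots> = (G \<alpha> \<alpha> + G \<beta> \<beta>) / 2"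
      unfolding G_def using BBi[OF ab(1,1)] BBi[OF ab(2,2)] by simp
    finally show ?thesis .
  qed
  have Gcov: "expectation (\<lambda>\<omega>. (?B \<alpha> \<omega> * ?B \<beta> \<omega>) * (?Z \<alpha> \<omega> * ?Z \<beta> \<omega>)) = G \<alpha> \<beta> * cov k \<alpha> \<beta>"
    if ab: "\<alpha> \<in> ?DD" "\<beta> \<in> ?DD" for \<alpha> \<beta>
    unfolding G_def
    by (simp only: indep_var_lebesgue_integral[OF indep_leave_one_out_centered[OF k ab] BBi[OF ab] integrable_centered[OF k ab]]
          expectation_centered[OF k ab])
  have row: "expectation (\<lambda>\<omega>. \<Sum>\<beta>\<in>?DD. (?B \<alpha> \<omega> * ?B \<beta> \<omega>) * (?Z \<alpha> \<omega> * ?Z \<beta> \<omega>)) = (\<Sum>\<beta>\<in>?DD. G \<alpha> \<beta> * cov k \<alpha> \<beta>)"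
    if a: "\<alpha> \<in> ?DD" for \<alpha>
    by (subst Bochner_Integration.integral_sum) (auto intro!: sum.cong ii Gcov a)
  have E: "expectation (\<lambda>\<omega>. (dev k \<omega>)\<^sup>2) = (\<Sum>\<alpha>\<in>?DD. \<Sum>\<beta>\<in>?DD. G \<alpha> \<beta> * cov k \<alpha> \<beta>)"
    unfolding sq
    by (subst Bochner_Integration.integral_sum) (auto intro!: sum.cong Bochner_Integration.integrable_sum ii row)
  have frob: "(\<Sum>\<alpha>\<in>?DD. G \<alpha> \<alpha>) \<le> real (n choose d) / t\<^sup>2"
  proof -
    have "(\<Sum>\<alpha>\<in>?DD. G \<alpha> \<alpha>) = expectation (\<lambda>\<omega>. \<Sum>\<alpha>\<in>?DD. ?B \<alpha> \<omega> * ?B \<alpha> \<omega>)"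
      unfolding G_def by (intro Bochner_Integration.integral_sum[symmetric] BBi)
    also have "\<dots> \<le> expectation (\<lambda>\<omega>. real (n choose d) / t\<^sup>2)"
    proof (rule integral_mono)
      show "(\<Sum>\<alpha>\<in>?DD. ?B \<alpha> \<omega> * ?B \<alpha> \<omega>) \<le> real (n choose d) / t\<^sup>2" for \<omega>
        using resolv_frobenius[of D t "1 / real m", where x = "col \<omega>" and ks = "remove1 k [0..<m]"] t0
        unfolding sum.cartesian_product leave_one_out_def power2_eq_square by (simp add: case_prod_unfold card_dsubsets)
      show "integrable M (\<lambda>\<omega>. \<Sum>\<alpha>\<in>?DD. ?B \<alpha> \<omega> * ?B \<alpha> \<omega>)"
        by (intro Bochner_Integration.integrable_sum BBi)
    qed auto
    finally show ?thesis by (simp add: prob_space)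
  qed
  have "(\<Sum>\<alpha>\<in>?DD. \<Sum>\<beta>\<in>?DD. G \<alpha> \<beta> * cov k \<alpha> \<beta>)
      \<le> (\<Sum>\<alpha>\<in>?DD. \<Sum>\<beta>\<in>?DD. G \<alpha> \<alpha> / 2 * \<bar>cov k \<alpha> \<beta>\<bar> + G \<beta> \<beta> / 2 * \<bar>cov k \<alpha> \<beta>\<bar>)"
  proof (intro sum_mono)
    fix \<alpha> \<beta> assume ab: "\<alpha> \<in> ?DD" "\<beta> \<in> ?DD"
    have "G \<alpha> \<beta> * cov k \<alpha> \<beta> \<le> \<bar>G \<alpha> \<beta>\<bar> * \<bar>cov k \<alpha> \<beta>\<bar>"
      by (metis abs_ge_self abs_mult)
    also have "\<dots> \<le> (G \<alpha> \<alpha> + G \<beta> \<beta>) / 2 * \<bar>cov k \<alpha> \<beta>\<bar>"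
      by (intro mult_right_mono GB ab) simp
    finally show "G \<alpha> \<beta> * cov k \<alpha> \<beta> \<le> G \<alpha> \<alpha> / 2 * \<bar>cov k \<alpha> \<beta>\<bar> + G \<beta> \<beta> / 2 * \<bar>cov k \<alpha> \<beta>\<bar>"
      by (simp add: add_divide_distrib distrib_right)
  qed
  \<comment> \<open>By symmetry of \<open>cov\<close>, exchanging the sums shows that both halves
    are the same weighted row sum.\<close>
  also have "\<dots> = (\<Sum>\<alpha>\<in>?DD. G \<alpha> \<alpha> * (\<Sum>\<beta>\<in>?DD. \<bar>cov k \<alpha> \<beta>\<bar>))"
  proof -
    have "(\<Sum>\<alpha>\<in>?DD. \<Sum>\<beta>\<in>?DD. G \<beta> \<beta> / 2 * \<bar>cov k \<alpha> \<beta>\<bar>) = (\<Sum>\<beta>\<in>?DD. \<Sum>\<alpha>\<in>?DD. G \<beta> \<beta> / 2 * \<bar>cov k \<alpha> \<beta>\<bar>)"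
      by (rule sum.swap)
    then have "(\<Sum>\<alpha>\<in>?DD. \<Sum>\<beta>\<in>?DD. G \<beta> \<beta> / 2 * \<bar>cov k \<alpha> \<beta>\<bar>) = (\<Sum>\<alpha>\<in>?DD. \<Sum>\<beta>\<in>?DD. G \<alpha> \<alpha> / 2 * \<bar>cov k \<alpha> \<beta>\<bar>)"
      by (simp only: cov_sym[of k])
    moreover have "(\<Sum>\<alpha>\<in>?DD. \<Sum>\<beta>\<in>?DD. G \<alpha> \<alpha> / 2 * \<bar>cov k \<alpha> \<beta>\<bar>) = (\<Sum>\<alpha>\<in>?DD. G \<alpha> \<alpha> * (\<Sum>\<beta>\<in>?DD. \<bar>cov k \<alpha> \<beta>\<bar>)) / 2"
      by (simp add: sum_distrib_left sum_divide_distrib)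
    ultimately show ?thesis unfolding sum.distrib by linarith
  qed
  also have "\<dots> \<le> (\<Sum>\<alpha>\<in>?DD. G \<alpha> \<alpha> * (real (n choose d) * err))"
    by (intro sum_mono mult_left_mono cov_row_sum[OF k small] G0)
  also have "\<dots> = (\<Sum>\<alpha>\<in>?DD. G \<alpha> \<alpha>) * (real (n choose d) * err)"
    by (simp only: sum_distrib_right)
  also have "\<dots> \<le> (real (n choose d) / t\<^sup>2) * (real (n choose d) * err)"
    using err_nonneg by (intro mult_right_mono frob) auto
  finally show "expectation (\<lambda>\<omega>. (dev k \<omega>)\<^sup>2) \<le> err * (real (n choose d) / t)\<^sup>2"
    unfolding E by (simp add: power_divide power2_eq_square mult_ac)
qed

section \<open>Mean and concentration of the resolvent trace\<close>

definition tr_res :: "'a \<Rightarrow> real" where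
  "tr_res \<omega> = (\<Sum>a\<in>D. resolv D t (1 / real m) (col \<omega>) [0..<m] a a)"

lemma tr_res_measurable: "tr_res \<in> borel_measurable M"
  unfolding tr_res_def[abs_def]
  by (intro borel_measurable_sum resolv_measurable col_measurable) auto

lemma tr_res_bounds: "0 \<le> tr_res \<omega>" "tr_res \<omega> \<le> real (n choose d) / t"
  unfolding tr_res_def using trace_resolv_bounds[of D t "1 / real m"] t0 by (auto simp: card_dsubsets)

lemma integrable_tr_res: "integrable M tr_res"
  using tr_res_bounds tr_res_measurable
  by (intro integrable_const_bound[of _ "real (n choose d) / t"]) auto

text \<open>The residual of the Marchenko-Pastur equation
  \<open>y * (1 - t * s) - 1 + 1 / (1 + y * s) = 0\<close> at the finite ratio
  \<open>y = (n choose d) / m\<close> and \<open>s = tr_res / (n choose d)\<close>.\<close>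

definition defect :: "'a \<Rightarrow> real" where
  "defect \<omega> = (real (n choose d) - t * tr_res \<omega>) / m - 1 + 1 / (1 + tr_res \<omega> / m)"

lemma expectation_defect:
  assumes small: "3 * C * sqrt (real d / real (n - d + 1)) \<le> 1"
  shows "integrable M defect"
    "expectation (\<lambda>\<omega>. \<bar>defect \<omega>\<bar>) \<le> (sqrt err * real (n choose d) + 1) / (t * real m)"
proof -
  have le: "\<bar>defect \<omega>\<bar> \<le> (\<Sum>k<m. \<bar>dev k \<omega>\<bar> + 1 / t) / (real m)\<^sup>2" for \<omega>
    unfolding defect_def tr_res_def dev_def leave_one_out_def
    using self_consistent_bound[of D t m "col \<omega>"] t0 m0 by (simp only: card_dsubsets finite_dsubsets of_nat_power)
  have d2: "integrable M (\<lambda>\<omega>. (dev k \<omega>)\<^sup>2)" if "k < m" for k by (rule dev_second_moment[OF that small])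
  have d1: "integrable M (dev k)" if "k < m" for k
    by (rule square_integrable_imp_integrable[OF dev_measurable[OF that] d2[OF that]])
  have int: "integrable M (\<lambda>\<omega>. (\<Sum>k<m. \<bar>dev k \<omega>\<bar> + 1 / t) / (real m)\<^sup>2)"
    using d1 by (intro integrable_divide Bochner_Integration.integrable_sum Bochner_Integration.integrable_add integrable_abs) auto
  have dm: "defect \<in> borel_measurable M"
    unfolding defect_def[abs_def] using tr_res_measurable by measurable
  show di: "integrable M defect"
  proof (rule Bochner_Integration.integrable_bound[OF int dm])
    show "AE \<omega> in M. norm (defect \<omega>) \<le> norm ((\<Sum>k<m. \<bar>dev k \<omega>\<bar> + 1 / t) / (real m)\<^sup>2)"
      using le by (intro AE_I2) (metis abs_ge_self order_trans real_norm_def)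
  qed
  have Ed: "expectation (\<lambda>\<omega>. \<bar>dev k \<omega>\<bar>) \<le> sqrt err * real (n choose d) / t" if k: "k < m" for k
  proof -
    have "expectation (\<lambda>\<omega>. \<bar>dev k \<omega>\<bar>) \<le> sqrt (expectation (\<lambda>\<omega>. (dev k \<omega>)\<^sup>2))"
      by (rule expectation_abs_le_sqrt[OF d1[OF k] d2[OF k]])
    also have "\<dots> \<le> sqrt (err * (real (n choose d) / t)\<^sup>2)"
      using dev_second_moment(2)[OF k small] by (rule real_sqrt_le_mono)
    also have "\<dots> = sqrt err * real (n choose d) / t" using t0 by (simp add: real_sqrt_mult)
    finally show ?thesis .
  qed
  have "expectation (\<lambda>\<omega>. \<bar>defect \<omega>\<bar>) \<le> expectation (\<lambda>\<omega>. (\<Sum>k<m. \<bar>dev k \<omega>\<bar> + 1 / t) / (real m)\<^sup>2)"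
    by (intro integral_mono integrable_abs di int le)
  also have "\<dots> = (\<Sum>k<m. expectation (\<lambda>\<omega>. \<bar>dev k \<omega>\<bar>) + 1 / t) / (real m)\<^sup>2"
  proof -
    have "expectation (\<lambda>\<omega>. \<Sum>k<m. \<bar>dev k \<omega>\<bar> + 1 / t) = (\<Sum>k<m. expectation (\<lambda>\<omega>. \<bar>dev k \<omega>\<bar> + 1 / t))"
      using d1 by (intro Bochner_Integration.integral_sum) auto
    also have "\<dots> = (\<Sum>k<m. expectation (\<lambda>\<omega>. \<bar>dev k \<omega>\<bar>) + 1 / t)"
      using d1 by (intro sum.cong refl) (simp add: prob_space)
    finally show ?thesis by (simp only: integral_divide_zero)
  qed
  also have "\<dots> \<le> (\<Sum>k<m. sqrt err * real (n choose d) / t + 1 / t) / (real m)\<^sup>2"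
    using Ed by (intro divide_right_mono sum_mono add_right_mono) auto
  also have "\<dots> = (sqrt err * real (n choose d) + 1) / (t * real m)"
    using m0 t0 by (simp add: power2_eq_square field_simps)
  finally show "expectation (\<lambda>\<omega>. \<bar>defect \<omega>\<bar>) \<le> (sqrt err * real (n choose d) + 1) / (t * real m)" .
qed

text \<open>Stability is applied at each sample point before the expectation is taken. The
  comparison is with the law of parameter \<open>y\<close>, the ratio at this \<open>n\<close>, so
  the error is explicit; the passage to the limit ratio is left to continuity.\<close>

lemma stieltjes_mean:
  assumes small: "3 * C * sqrt (real d / real (n - d + 1)) \<le> 1"
  defines "y \<equiv> real (n choose d) / real m"
  shows "\<bar>expectation tr_res / real (n choose d) - mp_stieltjes y t\<bar> \<le> (sqrt err * y + 1 / real m) / (t\<^sup>2 * y)"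
proof -
  let ?p = "real (n choose d)" and ?s = "mp_stieltjes y t"
  have p: "?p > 0" using dn by simp
  have y: "y > 0" unfolding y_def using p m0 by simp
  have le: "y * t * \<bar>tr_res \<omega> / ?p - ?s\<bar> \<le> \<bar>defect \<omega>\<bar>" for \<omega>
  proof -
    have "defect \<omega> = y * (1 - t * (tr_res \<omega> / ?p)) - 1 + 1 / (1 + y * (tr_res \<omega> / ?p))"
      unfolding defect_def y_def using p m0 by (simp add: field_simps)
    then show ?thesis
      using self_consistent_stability[OF y t0 _ mp_stieltjes_root[OF y t0], of "tr_res \<omega> / ?p"] tr_res_bounds(1)[of \<omega>] p
      by simp
  qed
  have i: "integrable M (\<lambda>\<omega>. tr_res \<omega> / ?p - ?s)" using integrable_tr_res by auto
  have "expectation tr_res / ?p - ?s = expectation (\<lambda>\<omega>. tr_res \<omega> / ?p - ?s)"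
    using integrable_tr_res by (simp add: prob_space)
  also have "\<bar>\<dots>\<bar> \<le> expectation (\<lambda>\<omega>. \<bar>tr_res \<omega> / ?p - ?s\<bar>)" by (rule integral_abs_bound)
  also have "\<dots> \<le> expectation (\<lambda>\<omega>. \<bar>defect \<omega>\<bar> / (y * t))"
    using le y t0 i expectation_defect(1)[OF small] by (intro integral_mono) (auto simp: field_simps)
  also have "\<dots> = expectation (\<lambda>\<omega>. \<bar>defect \<omega>\<bar>) / (y * t)" by simp
  also have "\<dots> \<le> (sqrt err * ?p + 1) / (t * real m) / (y * t)"
    using y t0 by (intro divide_right_mono expectation_defect(2)[OF small]) auto
  also have "\<dots> = (sqrt err * y + 1 / real m) / (t\<^sup>2 * y)"
    using m0 t0 p unfolding y_def by (simp add: field_simps power2_eq_square)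
  finally show ?thesis .
qed

text \<open>The independent blocks are whole columns, so there are only \<open>m\<close> of them,
  each moving the trace by at most \<open>1 / t\<close>.\<close>

lemma tr_res_concentration:
  assumes l: "l > 0"
  shows "prob {\<omega> \<in> space M. \<bar>tr_res \<omega> - expectation tr_res\<bar> \<ge> \<epsilon>} \<le> 2 * exp (l\<^sup>2 * (1 / t)\<^sup>2 * m - l * \<epsilon>)"
proof -
  let ?S = "\<lambda>j. {j} \<times> {..<n}" and ?N = "\<lambda>j. PiM ({j} \<times> {..<n}) (\<lambda>_. borel :: real measure)"
  let ?X = "\<lambda>j \<omega>. restrict (\<lambda>q. (\<lambda>(j, i). \<xi> j i) q \<omega>) ({j} \<times> {..<n})"
  define c2 where "c2 z j I = (\<Prod>i\<in>I. z j (j, i))" for z :: "nat \<Rightarrow> nat \<times> nat \<Rightarrow> real" and j I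
  define f where "f z = (\<Sum>a\<in>D. resolv D t (1 / real m) (c2 z) [0..<m] a a)" for z
  have ind: "indep_vars ?N ?X {..<m}"
    by (rule indep_vars_restrict[OF indep]) (auto simp: disjoint_family_on_def)
  have fm: "f \<in> borel_measurable (PiM {..<m} ?N)"
    unfolding f_def[abs_def]
  proof (intro borel_measurable_sum resolv_measurable)
    fix j I assume j: "j \<in> set [0..<m]" and I: "I \<in> D"
    show "(\<lambda>z. c2 z j I) \<in> borel_measurable (PiM {..<m} ?N)"
      unfolding c2_def
    proof (intro borel_measurable_prod)
      fix i assume "i \<in> I"
      then have "(j, i) \<in> ?S j" using D_subset[OF I] by auto
      then have "(\<lambda>z. z (j, i)) \<in> borel_measurable (?N j)" by (rule measurable_component_singleton)
      moreover have "(\<lambda>z. z j) \<in> measurable (PiM {..<m} ?N) (?N j)"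
        using j by (intro measurable_component_singleton) auto
      ultimately show "(\<lambda>z. z j (j, i)) \<in> borel_measurable (PiM {..<m} ?N)"
        by (rule measurable_compose[rotated])
    qed
  qed
  have fB: "\<bar>f z\<bar> \<le> real (n choose d) / t" for z
    unfolding f_def using trace_resolv_bounds[of D t "1 / real m" "c2 z" "[0..<m]"] t0
    by (simp add: card_dsubsets)
  have diff: "\<bar>f (z(k := y)) - f z\<bar> \<le> 1 / t" if "k \<in> {..<m}" for k z y
    unfolding f_def
  proof (rule trace_resolv_change_one)
    show "c2 (z(k := y)) j a = c2 z j a" if "j \<noteq> k" for j a using that by (simp add: c2_def)
  qed (use that t0 in auto)
  have eq: "f (\<lambda>k\<in>{..<m}. ?X k \<omega>) = tr_res \<omega>" for \<omega>
  proof -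
    have "resolv D t (1 / real m) (c2 (\<lambda>k\<in>{..<m}. ?X k \<omega>)) [0..<m] = resolv D t (1 / real m) (col \<omega>) [0..<m]"
    proof (rule resolv_cong)
      fix k I assume "k \<in> set [0..<m]" "I \<in> D"
      then show "c2 (\<lambda>k\<in>{..<m}. ?X k \<omega>) k I = col \<omega> k I"
        unfolding c2_def col_def using D_subset by (intro prod.cong) auto
    qed
    then show ?thesis by (simp add: f_def tr_res_def)
  qed
  have "prob {\<omega> \<in> space M. \<bar>f (\<lambda>k\<in>{..<m}. ?X k \<omega>) - expectation (\<lambda>\<omega>. f (\<lambda>k\<in>{..<m}. ?X k \<omega>))\<bar> \<ge> \<epsilon>}
      \<le> 2 * exp (l\<^sup>2 * (1 / t)\<^sup>2 * card {..<m} - l * \<epsilon>)"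
    using m0 by (intro bounded_difference_tail[where N = ?N and B = "real (n choose d) / t"] ind fm fB diff l) auto
  then show ?thesis unfolding eq by simp
qed

end

section \<open>Convergence of the empirical spectral distribution\<close>

lemma sub_enum_bij: "bij_betw (sub_enum n d) {..<n choose d} (dsubsets n d)"
proof -
  have "\<exists>f. bij_betw f {..<n choose d} (dsubsets n d)"
    by (rule finite_same_card_bij) (auto simp: card_dsubsets)
  then show ?thesis unfolding sub_enum_def by (rule someI_ex)
qed

lemma sample_cov_index:
  assumes "a < n choose d" "b < n choose d"
  shows "sample_cov n d m xs $$ (a, b)
    = 1 / real m * (\<Sum>j<m. tensor_entry (xs j) (sub_enum n d a) * tensor_entry (xs j) (sub_enum n d b))"
  using assms unfolding sample_cov_def tensor_data_matrix_def
  by (auto simp: scalar_prod_def lessThan_atLeast0 intro!: sum.cong)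

lemma sample_cov_carrier: "sample_cov n d m xs \<in> carrier_mat (n choose d) (n choose d)"
  unfolding sample_cov_def tensor_data_matrix_def by auto

text \<open>This links the matrix indexed by numbers with the resolvent indexed by subsets:
  transported along \<open>sub_enum\<close>, \<open>resolv\<close> is a right inverse of
  \<open>W + t\<close>, so its trace is the sum of \<open>1 / (e + t)\<close> over the
  eigenvalues.\<close>

lemma sample_cov_spectrum:
  obtains es where "length es = n choose d" "\<And>e. e \<in> set es \<Longrightarrow> 0 \<le> e"
    "\<And>x. esd_cdf (sample_cov n d m xs) x = list_avg (indicator {..x}) es"
    "\<And>t. t > 0 \<Longrightarrow> (\<Sum>I\<in>dsubsets n d. resolv (dsubsets n d) t (1 / real m) (\<lambda>k. tensor_entry (xs k)) [0..<m] I I)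
       = (\<Sum>e\<leftarrow>es. 1 / (e + t))"
proof -
  let ?W = "sample_cov n d m xs" and ?p = "n choose d" and ?D = "dsubsets n d" and ?f = "sub_enum n d"
  let ?x = "\<lambda>k. tensor_entry (xs k)"
  note W = sample_cov_carrier[of n d m xs]
  have sym: "?W $$ (i, j) = ?W $$ (j, i)" if "i < ?p" "j < ?p" for i j
    using that by (simp add: sample_cov_index mult.commute)
  have psd: "0 \<le> (\<Sum>i<?p. \<Sum>j<?p. v i * ?W $$ (i, j) * v j)" for v
  proof -
    have "(\<Sum>i<?p. \<Sum>j<?p. v i * ?W $$ (i, j) * v j)
        = (\<Sum>i<?p. \<Sum>j<?p. \<Sum>k<m. 1 / real m * ((v i * ?x k (?f i)) * (v j * ?x k (?f j))))"
      by (intro sum.cong refl) (simp add: sample_cov_index sum_distrib_left sum_distrib_right mult_ac)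
    also have "\<dots> = (\<Sum>i<?p. \<Sum>k<m. \<Sum>j<?p. 1 / real m * ((v i * ?x k (?f i)) * (v j * ?x k (?f j))))"
      by (intro sum.cong refl sum.swap)
    also have "\<dots> = (\<Sum>k<m. \<Sum>i<?p. \<Sum>j<?p. 1 / real m * ((v i * ?x k (?f i)) * (v j * ?x k (?f j))))"
      by (rule sum.swap)
    also have "\<dots> = (\<Sum>k<m. 1 / real m * (\<Sum>i<?p. v i * ?x k (?f i))\<^sup>2)"
      unfolding power2_eq_square sum_product unfolding sum_distrib_left ..
    also have "\<dots> \<ge> 0" by (intro sum_nonneg) simp
    finally show ?thesis .
  qed
  obtain es where es: "length es = ?p" "proots (char_poly ?W) = mset es" "\<And>e. e \<in> set es \<Longrightarrow> 0 \<le> e"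
    "\<And>t Y. t > 0 \<Longrightarrow> Y \<in> carrier_mat ?p ?p \<Longrightarrow> (?W + t \<cdot>\<^sub>m 1\<^sub>m ?p) * Y = 1\<^sub>m ?p \<Longrightarrow>
       (\<Sum>i<?p. Y $$ (i, i)) = (\<Sum>e\<leftarrow>es. 1 / (e + t))"
    by (rule real_symmetric_psd_spectrum[OF W sym psd]) (assumption | rule that | blast)+
  have esd: "esd_cdf ?W x = list_avg (indicator {..x}) es" for x
  proof -
    have "real (size (filter_mset (\<lambda>r. r \<le> x) (mset es))) = (\<Sum>e\<leftarrow>es. indicator {..x} e)" for es :: "real list"
      by (induction es) auto
    then show ?thesis using W es(1) by (simp add: esd_cdf_def es(2) list_avg_def)
  qed
  have tr: "(\<Sum>I\<in>?D. resolv ?D t (1 / real m) ?x [0..<m] I I) = (\<Sum>e\<leftarrow>es. 1 / (e + t))" if t: "t > 0" for t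
  proof -
    let ?R = "resolv ?D t (1 / real m) ?x [0..<m]"
    define Y where "Y = mat ?p ?p (\<lambda>(i, j). ?R (?f i) (?f j))"
    have Y: "Y \<in> carrier_mat ?p ?p" by (simp add: Y_def)
    have fD: "?f i \<in> ?D" if "i < ?p" for i using sub_enum_bij[of n d] that by (auto simp: bij_betw_def)
    have inj: "?f i = ?f j \<longleftrightarrow> i = j" if "i < ?p" "j < ?p" for i j
      using sub_enum_bij[of n d] that by (auto simp: bij_betw_def inj_on_def)
    have "(?W + t \<cdot>\<^sub>m 1\<^sub>m ?p) * Y = 1\<^sub>m ?p"
    proof (rule eq_matI)
      fix i j assume "i < dim_row (1\<^sub>m ?p :: real mat)" "j < dim_col (1\<^sub>m ?p :: real mat)"
      then have ij: "i < ?p" "j < ?p" by auto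
      have A: "?W + t \<cdot>\<^sub>m 1\<^sub>m ?p \<in> carrier_mat ?p ?p" using W by auto
      have ent: "(?W + t \<cdot>\<^sub>m 1\<^sub>m ?p) $$ (i, k) = reg_gram t (1 / real m) ?x [0..<m] (?f i) (?f k)" if "k < ?p" for k
        using that ij W inj[OF ij(1) that]
        by (simp add: sample_cov_index reg_gram_def interv_sum_list_conv_sum_set_nat lessThan_atLeast0)
      have "((?W + t \<cdot>\<^sub>m 1\<^sub>m ?p) * Y) $$ (i, j) = (\<Sum>k<?p. (?W + t \<cdot>\<^sub>m 1\<^sub>m ?p) $$ (i, k) * Y $$ (k, j))"
        by (rule index_mult_mat_sum[OF A Y ij])
      also have "\<dots> = (\<Sum>k<?p. reg_gram t (1 / real m) ?x [0..<m] (?f i) (?f k) * ?R (?f k) (?f j))"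
        using ent ij by (intro sum.cong refl arg_cong2[where f = "(*)"]) (auto simp: Y_def)
      also have "\<dots> = (\<Sum>I\<in>?D. reg_gram t (1 / real m) ?x [0..<m] (?f i) I * ?R I (?f j))"
        by (rule sum.reindex_bij_betw[OF sub_enum_bij])
      also have "\<dots> = (if ?f i = ?f j then 1 else 0)"
        using t ij fD by (intro resolv_inverse) auto
      finally show "((?W + t \<cdot>\<^sub>m 1\<^sub>m ?p) * Y) $$ (i, j) = 1\<^sub>m ?p $$ (i, j)"
        using ij inj by simp
    qed (use W Y in auto)
    from es(4)[OF t Y this] have "(\<Sum>i<?p. Y $$ (i, i)) = (\<Sum>e\<leftarrow>es. 1 / (e + t))" .
    moreover have "(\<Sum>i<?p. Y $$ (i, i)) = (\<Sum>i<?p. ?R (?f i) (?f i))" by (simp add: Y_def)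
    moreover have "\<dots> = (\<Sum>I\<in>?D. ?R I I)" by (rule sum.reindex_bij_betw[OF sub_enum_bij])
    ultimately show ?thesis by simp
  qed
  show ?thesis using that[OF es(1,3) esd tr] .
qed

text \<open>The hypothesis says \<open>d^3 / n\<close> tends to 0. As \<open>d \<le> d^3\<close>,
  eventually \<open>2 * d \<le> n\<close>, and then \<open>n - d + 1\<close> is at least
  \<open>n / 2\<close>, which bounds \<open>d * \<tau>\<close> by the square root of
  \<open>2 * d^3 / n\<close>.\<close>

lemma growth_consequences:
  fixes d :: "nat \<Rightarrow> nat"
  assumes d0: "\<And>n. d n > 0" and dlim: "(\<lambda>n. real (d n) / real n powr (1/3)) \<longlonglongrightarrow> 0"
  shows "\<forall>\<^sub>F n in sequentially. d n \<le> n \<and> n \<le> n choose d n"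
    and "(\<lambda>n. real (d n) * sqrt (real (d n) / real (n - d n + 1))) \<longlonglongrightarrow> 0"
proof -
  have cube: "(\<lambda>n. real (d n) ^ 3 / real n) \<longlonglongrightarrow> 0"
  proof (rule Lim_transform_eventually)
    show "(\<lambda>n. (real (d n) / real n powr (1/3)) ^ 3) \<longlonglongrightarrow> 0"
      using tendsto_power[OF dlim, of 3] by simp
    show "\<forall>\<^sub>F n in sequentially. (real (d n) / real n powr (1/3)) ^ 3 = real (d n) ^ 3 / real n"
      using eventually_gt_at_top[of 0]
    proof eventually_elim
      case (elim n)
      have "(real n powr (1/3)) ^ 3 = (real n powr (1/3)) powr 3" using elim by simp
      also have "\<dots> = real n powr (1/3 * 3)" by (rule powr_powr)
      finally show ?case using elim by (simp add: power_divide)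
    qed
  qed
  have "\<forall>\<^sub>F n in sequentially. real (d n) ^ 3 / real n < 1 / 2"
    using order_tendstoD(2)[OF cube, of "1/2"] by simp
  then have half: "\<forall>\<^sub>F n in sequentially. n > 0 \<and> 2 * d n \<le> n"
    using eventually_gt_at_top[of 0]
  proof eventually_elim
    case (elim n)
    have "real (d n) ^ 1 \<le> real (d n) ^ 3" using d0[of n] by (intro power_increasing) auto
    moreover have "real (d n) ^ 3 < real n / 2" using elim by (simp add: field_simps)
    ultimately have "2 * real (d n) \<le> real n" unfolding power_one_right by linarith
    then show ?case using elim by linarith
  qed
  show "\<forall>\<^sub>F n in sequentially. d n \<le> n \<and> n \<le> n choose d n"
    using half
  proof eventually_elim
    case (elim n)
    let ?\<theta> = "real (d n) / real (n - d n + 1)"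
    have "?\<theta> \<le> 1" using elim by simp
    \<comment> \<open>Taking \<open>d - 1\<close> steps down leads to \<open>n choose 1 = n\<close>,
      with a ratio at most 1 in each step.\<close>
    have "real (n choose (d n - (d n - 1))) \<le> real (n choose d n) * ?\<theta> ^ (d n - 1)"
      using elim by (intro binomial_decrease) auto
    also have "\<dots> \<le> real (n choose d n) * 1"
      using \<open>?\<theta> \<le> 1\<close> by (intro mult_left_mono power_le_one) auto
    finally show ?case using elim d0[of n] by simp
  qed
  show "(\<lambda>n. real (d n) * sqrt (real (d n) / real (n - d n + 1))) \<longlonglongrightarrow> 0"
  proof (rule tendsto_sandwich[OF _ _ tendsto_const])
    have "(\<lambda>n. sqrt (2 * (real (d n) ^ 3 / real n))) \<longlonglongrightarrow> sqrt (2 * 0)"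
      by (intro tendsto_real_sqrt tendsto_mult_left cube)
    then show "(\<lambda>n. sqrt (2 * (real (d n) ^ 3 / real n))) \<longlonglongrightarrow> 0" by simp
    show "\<forall>\<^sub>F n in sequentially. 0 \<le> real (d n) * sqrt (real (d n) / real (n - d n + 1))" by simp
    show "\<forall>\<^sub>F n in sequentially. real (d n) * sqrt (real (d n) / real (n - d n + 1)) \<le> sqrt (2 * (real (d n) ^ 3 / real n))"
      using half
    proof eventually_elim
      case (elim n)
      have "real (d n) * sqrt (real (d n) / real (n - d n + 1)) = sqrt (real (d n) ^ 3 / real (n - d n + 1))"
        by (simp add: real_sqrt_divide real_sqrt_mult eval_nat_numeral mult_ac)
      also have "real (d n) ^ 3 / real (n - d n + 1) \<le> real (d n) ^ 3 / (real n / 2)"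
        using elim by (intro divide_left_mono) (auto simp: of_nat_diff)
      finally show ?case by (simp add: mult_ac)
    qed
  qed
qed

text \<open>Since \<open>(1 + u) ^ d \<le> exp (d * u)\<close>, everything is controlled by
  \<open>d * u\<close>; since \<open>d \<ge> 1\<close>, so is \<open>u\<close> itself.\<close>

lemma cov_err_tendsto_0:
  fixes d :: "nat \<Rightarrow> nat"
  assumes d0: "\<And>n. d n > 0" and C: "C \<ge> 0"
    and lim: "(\<lambda>n. real (d n) * sqrt (real (d n) / real (n - d n + 1))) \<longlonglongrightarrow> 0"
  shows "(\<lambda>n. cov_err n (d n) C) \<longlonglongrightarrow> 0"
    and "\<forall>\<^sub>F n in sequentially. 3 * C * sqrt (real (d n) / real (n - d n + 1)) \<le> 1"
proof -
  define u where "u n = 3 * C * sqrt (real (d n) / real (n - d n + 1))" for n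
  have u0: "u n \<ge> 0" for n using C by (simp add: u_def)
  have du: "(\<lambda>n. real (d n) * u n) \<longlonglongrightarrow> 0"
    using tendsto_mult_left[OF lim, of "3 * C"] by (simp add: u_def mult_ac)
  have le: "u n \<le> real (d n) * u n" for n
    using mult_right_mono[of 1 "real (d n)" "u n"] u0[of n] d0[of n] by simp
  have "\<forall>\<^sub>F n in sequentially. real (d n) * u n < 1" using order_tendstoD(2)[OF du, of 1] by simp
  then show "\<forall>\<^sub>F n in sequentially. 3 * C * sqrt (real (d n) / real (n - d n + 1)) \<le> 1"
    unfolding u_def[symmetric] by eventually_elim (meson le less_imp_le order_trans)
  show "(\<lambda>n. cov_err n (d n) C) \<longlonglongrightarrow> 0"
  proof (rule tendsto_sandwich[OF _ _ tendsto_const])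
    have "(\<lambda>n. real (d n) * u n * exp (real (d n) * u n)) \<longlonglongrightarrow> 0 * exp 0"
      by (intro tendsto_mult tendsto_exp du)
    then show "(\<lambda>n. real (d n) * u n * exp (real (d n) * u n)) \<longlonglongrightarrow> 0" by simp
    have eq: "cov_err n (d n) C = real (d n) * u n * (1 + u n) ^ d n" for n
      by (simp add: cov_err_def u_def Let_def)
    show "\<forall>\<^sub>F n in sequentially. 0 \<le> cov_err n (d n) C" unfolding eq using u0 by simp
    have "(1 + u n) ^ d n \<le> exp (u n) ^ d n" for n
      using u0[of n] by (intro power_mono) auto
    then have "cov_err n (d n) C \<le> real (d n) * u n * exp (real (d n) * u n)" for n
      unfolding eq exp_of_nat_mult using u0[of n] by (intro mult_left_mono) auto
    then show "\<forall>\<^sub>F n in sequentially. cov_err n (d n) C \<le> real (d n) * u n * exp (real (d n) * u n)" by simp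
  qed
qed

text \<open>The mean converges by the bound at the finite ratio and continuity of
  \<open>mp_stieltjes\<close> in the ratio. Deviations of order \<open>p\<close> have probability
  exponentially small in \<open>p\<close>, because \<open>m\<close> is at most a multiple of
  \<open>p\<close>, and \<open>p \<ge> n\<close> makes these probabilities summable.\<close>

lemma (in prob_space) AE_stieltjes_limit:
  fixes d m :: "nat \<Rightarrow> nat" and \<xi> :: "nat \<Rightarrow> nat \<Rightarrow> nat \<Rightarrow> 'a \<Rightarrow> real"
  assumes TS: "\<forall>\<^sub>F n in sequentially. tensor_sample M n (d n) (m n) (\<xi> n) C t"
    and small: "\<forall>\<^sub>F n in sequentially. 3 * C * sqrt (real (d n) / real (n - d n + 1)) \<le> 1"
    and err: "(\<lambda>n. cov_err n (d n) C) \<longlonglongrightarrow> 0"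
    and big: "\<forall>\<^sub>F n in sequentially. n \<le> n choose d n"
    and lam: "lam > 0" and ratio: "(\<lambda>n. real (n choose d n) / real (m n)) \<longlonglongrightarrow> lam"
    and t: "t > 0"
  shows "AE \<omega> in M. (\<lambda>n. tensor_sample.tr_res n (d n) (m n) (\<xi> n) t \<omega> / real (n choose d n)) \<longlonglongrightarrow> mp_stieltjes lam t"
proof -
  define p where "p n = real (n choose d n)" for n
  define T where "T n = tensor_sample.tr_res n (d n) (m n) (\<xi> n) t" for n
  define y where "y n = p n / real (m n)" for n
  have y: "y \<longlonglongrightarrow> lam" using ratio by (simp add: y_def[abs_def] p_def)
  have p_top: "filterlim p at_top sequentially"
    unfolding p_def
    by (rule filterlim_at_top_mono[OF filterlim_real_sequentially]) (use big in eventually_elim, simp)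
  have p_pos: "\<forall>\<^sub>F n in sequentially. p n > 0"
    using filterlim_at_top_dense[THEN iffD1, OF p_top] by blast
  have m_pos: "\<forall>\<^sub>F n in sequentially. m n > 0"
    using TS by eventually_elim (simp add: tensor_sample_def tensor_sample_axioms_def)
  have inv_m: "(\<lambda>n. 1 / real (m n)) \<longlonglongrightarrow> 0"
  proof (rule Lim_transform_eventually)
    have "(\<lambda>n. inverse (p n)) \<longlonglongrightarrow> 0" by (rule filterlim_compose[OF tendsto_inverse_0_at_top[OF filterlim_ident] p_top])
    from tendsto_mult[OF y this] show "(\<lambda>n. y n * inverse (p n)) \<longlonglongrightarrow> 0" by simp
    show "\<forall>\<^sub>F n in sequentially. y n * inverse (p n) = 1 / real (m n)"
      using p_pos by eventually_elim (simp add: y_def)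
  qed
  have mean: "(\<lambda>n. expectation (T n) / p n) \<longlonglongrightarrow> mp_stieltjes lam t"
  proof -
    have bd: "\<forall>\<^sub>F n in sequentially. norm (expectation (T n) / p n - mp_stieltjes (y n) t)
        \<le> (sqrt (cov_err n (d n) C) * y n + 1 / real (m n)) / (t\<^sup>2 * y n)"
      unfolding T_def p_def y_def real_norm_def
      using TS small by eventually_elim (rule tensor_sample.stieltjes_mean)
    have "(\<lambda>n. (sqrt (cov_err n (d n) C) * y n + 1 / real (m n)) / (t\<^sup>2 * y n))
        \<longlonglongrightarrow> (sqrt 0 * lam + 0) / (t\<^sup>2 * lam)"
      using lam t by (intro tendsto_intros err y inv_m) auto
    then have "(\<lambda>n. expectation (T n) / p n - mp_stieltjes (y n) t) \<longlonglongrightarrow> 0"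
      by (intro Lim_null_comparison[OF bd]) simp
    moreover have "(\<lambda>n. mp_stieltjes (y n) t) \<longlonglongrightarrow> mp_stieltjes lam t"
      unfolding mp_stieltjes_def using lam t by (intro tendsto_intros y) auto
    ultimately show ?thesis using tendsto_add by fastforce
  qed
  have conc: "AE \<omega> in M. \<forall>\<^sub>F n in sequentially. \<bar>T n \<omega> - expectation (T n)\<bar> < \<epsilon> * p n" if e: "\<epsilon> > 0" for \<epsilon>
  proof -
    \<comment> \<open>Eventually the ratio \<open>y n\<close> exceeds \<open>lam / 2\<close>, which
      is \<open>m n \<le> K * p n\<close>.\<close>
    define K where "K = 2 / lam"
    have K: "K > 0" using lam by (simp add: K_def)
    \<comment> \<open>The minimiser of \<open>l^2 * K / t^2 - l * \<epsilon>\<close>, with minimum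
      \<open>- \<kappa>\<close>.\<close>
    define l where "l = \<epsilon> * t\<^sup>2 / (2 * K)"
    have l: "l > 0" using e t K by (simp add: l_def)
    define \<kappa> where "\<kappa> = \<epsilon>\<^sup>2 * t\<^sup>2 / (4 * K)"
    have kap: "\<kappa> > 0" using e t K by (simp add: \<kappa>_def)
    have mK: "\<forall>\<^sub>F n in sequentially. real (m n) \<le> K * p n"
    proof -
      have "\<forall>\<^sub>F n in sequentially. y n > lam / 2" using order_tendstoD(1)[OF y, of "lam / 2"] lam by simp
      then show ?thesis using m_pos by eventually_elim (use lam in \<open>simp add: y_def K_def field_simps\<close>)
    qed
    define good where "good n \<longleftrightarrow> tensor_sample M n (d n) (m n) (\<xi> n) C t \<and> real (m n) \<le> K * p n \<and> real n \<le> p n" for n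
    have ev_good: "\<forall>\<^sub>F n in sequentially. good n"
      using TS mK big by eventually_elim (simp add: good_def p_def)
    \<comment> \<open>Taking the empty set at the finitely many bad \<open>n\<close> makes
      measurability and the geometric bound hold for every \<open>n\<close>.\<close>
    define A where "A n = (if good n then {\<omega> \<in> space M. \<bar>T n \<omega> - expectation (T n)\<bar> \<ge> \<epsilon> * p n} else {})" for n
    have A_sets: "A n \<in> sets M" for n
    proof (cases "good n")
      case True
      then have "T n \<in> borel_measurable M"
        unfolding T_def good_def using tensor_sample.tr_res_measurable by blast
      then show ?thesis by (simp add: A_def)
    qed (simp add: A_def)
    have prob_A: "prob (A n) \<le> 2 * exp (- \<kappa>) ^ n" for n
    proof (cases "good n")
      case True
      then have G: "tensor_sample M n (d n) (m n) (\<xi> n) C t" "real (m n) \<le> K * p n" "real n \<le> p n"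
        by (auto simp: good_def)
      have "prob (A n) \<le> 2 * exp (l\<^sup>2 * (1 / t)\<^sup>2 * real (m n) - l * (\<epsilon> * p n))"
        using True tensor_sample.tr_res_concentration[OF G(1) l, of "\<epsilon> * p n"] by (simp add: A_def T_def)
      also have "\<dots> \<le> 2 * exp (l\<^sup>2 * (1 / t)\<^sup>2 * (K * p n) - l * (\<epsilon> * p n))"
        using G(2) by (intro mult_left_mono iffD2[OF exp_le_cancel_iff] diff_right_mono) auto
      also have "l\<^sup>2 * (1 / t)\<^sup>2 * (K * p n) - l * (\<epsilon> * p n) = - (\<kappa> * p n)"
        using K t by (simp add: l_def \<kappa>_def field_simps power2_eq_square)
      also have "exp (- (\<kappa> * p n)) \<le> exp (- (\<kappa> * real n))"
        using G(3) kap by simp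
      also have "exp (- (\<kappa> * real n)) = exp (- \<kappa>) ^ n"
        by (simp add: exp_of_nat_mult[symmetric] mult_ac)
      finally show ?thesis by simp
    qed (simp add: A_def)
    have "summable (\<lambda>n. 2 * exp (- \<kappa>) ^ n)"
      using kap by (intro summable_mult summable_geometric) simp
    then have "summable (\<lambda>n. prob (A n))"
      by (rule summable_comparison_test'[of _ 0]) (simp add: prob_A)
    then have "AE \<omega> in M. \<forall>\<^sub>F n in sequentially. \<omega> \<in> space M - A n"
      by (intro borel_cantelli_AE1 A_sets) (auto simp: less_top[symmetric])
    then show ?thesis
    proof (rule AE_mp, intro AE_I2 impI)
      fix \<omega> assume "\<omega> \<in> space M" "\<forall>\<^sub>F n in sequentially. \<omega> \<in> space M - A n"
      from this(2) ev_good show "\<forall>\<^sub>F n in sequentially. \<bar>T n \<omega> - expectation (T n)\<bar> < \<epsilon> * p n"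
        by eventually_elim (auto simp: A_def)
    qed
  qed
  \<comment> \<open>The tolerances \<open>1 / (j + 1)\<close> are cofinal and countable, so a single
    null set serves all of them.\<close>
  have "AE \<omega> in M. \<forall>j. \<forall>\<^sub>F n in sequentially. \<bar>T n \<omega> - expectation (T n)\<bar> < inverse (real (Suc j)) * p n"
    unfolding AE_all_countable using conc by simp
  then show ?thesis
  proof (rule AE_mp, intro AE_I2 impI)
    fix \<omega> assume H: "\<forall>j. \<forall>\<^sub>F n in sequentially. \<bar>T n \<omega> - expectation (T n)\<bar> < inverse (real (Suc j)) * p n"
    have "(\<lambda>n. T n \<omega> / p n - expectation (T n) / p n) \<longlonglongrightarrow> 0"
    proof (rule tendstoI)
      fix e :: real assume "e > 0"
      then obtain j where j: "inverse (real (Suc j)) < e" using reals_Archimedean by blast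
      from H[rule_format, of j] p_pos show "\<forall>\<^sub>F n in sequentially. dist (T n \<omega> / p n - expectation (T n) / p n) 0 < e"
      proof eventually_elim
        case (elim n)
        have "\<bar>T n \<omega> - expectation (T n)\<bar> / p n < inverse (real (Suc j))"
          using elim by (simp add: divide_less_eq)
        then show ?case using j elim by (simp add: dist_real_def diff_divide_distrib[symmetric])
      qed
    qed
    from tendsto_add[OF this mean] show "(\<lambda>n. tensor_sample.tr_res n (d n) (m n) (\<xi> n) t \<omega> / real (n choose d n)) \<longlonglongrightarrow> mp_stieltjes lam t"
      by (simp add: T_def p_def)
  qed
qed

theorem theorem1p4:
  fixes M :: "'a measure"
    and d m :: "nat \<Rightarrow> nat"
    and \<xi> :: "nat \<Rightarrow> nat \<Rightarrow> nat \<Rightarrow> 'a \<Rightarrow> real"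
    and lam C :: real
  assumes "prob_space M"
    and "\<And>n. d n > 0"
    and "(\<lambda>n. real (d n) / real n powr (1/3)) \<longlonglongrightarrow> 0"
    and "\<And>n. m n > 0"
    and "lam > 0"
    and "(\<lambda>n. real (n choose d n) / real (m n)) \<longlonglongrightarrow> lam"
    and "\<And>n. prob_space.indep_vars M (\<lambda>_. borel) (\<lambda>(j, i). \<xi> n j i) ({..<m n} \<times> {..<n})"
    and "\<And>n j i. j < m n \<Longrightarrow> i < n \<Longrightarrow> integrable M (\<xi> n j i)"
    and "\<And>n j i. j < m n \<Longrightarrow> i < n \<Longrightarrow> (\<integral>\<omega>. \<xi> n j i \<omega> \<partial>M) = 0"
    and "\<And>n j i. j < m n \<Longrightarrow> i < n \<Longrightarrow> integrable M (\<lambda>\<omega>. (\<xi> n j i \<omega>)^2)"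
    and "\<And>n j i. j < m n \<Longrightarrow> i < n \<Longrightarrow> (\<integral>\<omega>. (\<xi> n j i \<omega>)^2 \<partial>M) = 1"
    and "\<And>n j i. j < m n \<Longrightarrow> i < n \<Longrightarrow> integrable M (\<lambda>\<omega>. (\<xi> n j i \<omega>)^4)"
    and "\<And>n j i. j < m n \<Longrightarrow> i < n \<Longrightarrow> (\<integral>\<omega>. (\<xi> n j i \<omega>)^4 \<partial>M) \<le> C"
  shows "AE \<omega> in M. weak_conv (\<lambda>n. esd_cdf (sample_cov n (d n) (m n) (\<lambda>j i. \<xi> n j i \<omega>))) (mp_cdf lam)"
proof -
  interpret prob_space M by fact
  note growth = growth_consequences[OF assms(2,3)]
  have C: "C \<ge> 0"
  proof -
    \<comment> \<open>The instance \<open>n = 1\<close> with first column and first coordinate is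
      within range because \<open>m 1 > 0\<close>.\<close>
    have "0 \<le> (\<integral>\<omega>. (\<xi> 1 0 0 \<omega>)^4 \<partial>M)" by (intro Bochner_Integration.integral_nonneg) simp
    also have "\<dots> \<le> C" by (rule assms(13)) (simp_all add: assms(4))
    finally show ?thesis .
  qed
  note err = cov_err_tendsto_0[OF assms(2) C growth(2)]
  have TS: "\<forall>\<^sub>F n in sequentially. tensor_sample M n (d n) (m n) (\<xi> n) C t" if "t > 0" for t
    using growth(1)
  proof eventually_elim
    case (elim n)
    show ?case by unfold_locales (use elim assms that in auto)
  qed
  have big: "\<forall>\<^sub>F n in sequentially. n \<le> n choose d n" using growth(1) by eventually_elim simp
  let ?s = "\<lambda>n t \<omega>. tensor_sample.tr_res n (d n) (m n) (\<xi> n) t \<omega> / real (n choose d n)"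
  have "AE \<omega> in M. (\<lambda>n. ?s n t \<omega>) \<longlonglongrightarrow> mp_stieltjes lam t" if "t > 0" for t
    by (rule AE_stieltjes_limit[OF TS[OF that] err(2,1) big assms(5,6) that])
  \<comment> \<open>Restricting to rational \<open>t\<close> collects the exceptional sets into one
    null set.\<close>
  then have "AE \<omega> in M. \<forall>t\<in>{t. t \<in> \<rat> \<and> t > 0}. (\<lambda>n. ?s n t \<omega>) \<longlonglongrightarrow> mp_stieltjes lam t"
    by (subst AE_ball_countable) (auto intro: countable_subset[OF _ countable_rat])
  then show ?thesis
  proof (rule AE_mp, intro AE_I2 impI)
    fix \<omega> assume H: "\<forall>t\<in>{t. t \<in> \<rat> \<and> t > 0}. (\<lambda>n. ?s n t \<omega>) \<longlonglongrightarrow> mp_stieltjes lam t"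
    let ?xs = "\<lambda>n j i. \<xi> n j i \<omega>"
    define spec where "spec n es \<longleftrightarrow> length es = n choose d n \<and> (\<forall>e\<in>set es. 0 \<le> e)
      \<and> (\<forall>x. esd_cdf (sample_cov n (d n) (m n) (?xs n)) x = list_avg (indicator {..x}) es)
      \<and> (\<forall>t>0. (\<Sum>I\<in>dsubsets n (d n). resolv (dsubsets n (d n)) t (1 / real (m n)) (\<lambda>k. tensor_entry (?xs n k)) [0..<m n] I I)
         = (\<Sum>e\<leftarrow>es. 1 / (e + t)))" for n es
    \<comment> \<open>From here on the sample point is fixed and the argument is deterministic; one
      eigenvalue list is chosen for each \<open>n\<close>.\<close>
    have "\<exists>es. spec n es" for n
      by (rule sample_cov_spectrum[of n "d n" "m n" "?xs n"]) (auto simp: spec_def)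
    then obtain es where "\<And>n. spec n (es n)" by metis
    then have es: "\<And>n. length (es n) = n choose d n" "\<And>n e. e \<in> set (es n) \<Longrightarrow> 0 \<le> e"
      "\<And>n x. esd_cdf (sample_cov n (d n) (m n) (?xs n)) x = list_avg (indicator {..x}) (es n)"
      "\<And>n t. t > 0 \<Longrightarrow> (\<Sum>I\<in>dsubsets n (d n). resolv (dsubsets n (d n)) t (1 / real (m n)) (\<lambda>k. tensor_entry (?xs n k)) [0..<m n] I I)
         = (\<Sum>e\<leftarrow>es n. 1 / (e + t))"
      by (simp_all add: spec_def)
    have s_eq: "\<forall>\<^sub>F n in sequentially. ?s n t \<omega> = list_avg (\<lambda>x. 1 / (x + t)) (es n)" if t: "t > 0" for t
      using TS[OF t]
    proof eventually_elim
      case (elim n)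
      have "tensor_sample.col (\<xi> n) \<omega> = (\<lambda>k. tensor_entry (?xs n k))"
        by (intro ext) (simp add: tensor_sample.col_def[OF elim] tensor_entry_def)
      then show ?case using es(4)[OF t, of n]
        by (simp add: tensor_sample.tr_res_def[OF elim] list_avg_def es(1))
    qed
    let ?L = "lim_avg (mp_atom lam) (mp_density lam)"
    have bi: "has_bochner_integral lborel (mp_density lam) (1 - mp_atom lam)"
      by (rule mp_density_bochner[OF assms(5)])
    have "weak_conv (\<lambda>n x. list_avg (indicator {..x}) (es n)) (\<lambda>x. ?L (indicator {..x}))"
    proof (rule stieltjes_imp_weak_conv)
      show "0 \<le> mp_atom lam" by (simp add: mp_atom_def)
      show "integrable lborel (mp_density lam)" using bi by (rule integrable.intros)
      show "0 \<le> mp_density lam x" for x by (rule mp_density_nonneg[OF assms(5)])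
      show "mp_density lam x = 0" if "x < 0" for x by (rule mp_density_neg[OF that])
      show "mp_atom lam + (LINT x|lborel. mp_density lam x) = 1"
        using has_bochner_integral_integral_eq[OF bi] by simp
      show "\<forall>\<^sub>F n in sequentially. es n \<noteq> []"
        using growth(1)
      proof eventually_elim
        case (elim n)
        then have "length (es n) > 0" by (simp add: es(1))
        then show ?case by auto
      qed
      show "0 \<le> e" if "e \<in> set (es n)" for n e using es(2)[OF that] .
      show "(\<lambda>n. list_avg (\<lambda>x. 1 / (x + t)) (es n)) \<longlonglongrightarrow> ?L (\<lambda>x. 1 / (x + t))" if t: "t \<in> \<rat>" "t > 0" for t
      proof -
        have "?L (\<lambda>x. 1 / (x + t)) = mp_stieltjes lam t"
          unfolding lim_avg_def using mp_density_stieltjes[OF assms(5) t(2)] by simp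
        moreover have "(\<lambda>n. ?s n t \<omega>) \<longlonglongrightarrow> mp_stieltjes lam t" using H t by simp
        ultimately show ?thesis using Lim_transform_eventually[OF _ s_eq[OF t(2)]] by simp
      qed
    qed
    moreover have "?L (indicator {..x}) = mp_cdf lam x" for x
      unfolding lim_avg_indicator mp_cdf_def mp_atom_def by auto
    ultimately show "weak_conv (\<lambda>n. esd_cdf (sample_cov n (d n) (m n) (?xs n))) (mp_cdf lam)"
      unfolding weak_conv_def using es(3) by simp
  qed
qed

end
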